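(* Let $M>0$ be a fixed number, let $\delta\in(0,M)$, $\beta\in[0,d+p)$ and $\beta\ne d$. Then there exists an extension operator $E:\mathcal{T}^\beta_\delta(\mathcal{R}_{-\delta})\to\mathcal{S}^\beta_\delta(\mathcal{R}_{-\delta}^\infty)$ such that $$\|Eu\|_{\mathcal{S}^\beta_\delta(\mathcal{R}_{-\delta}^\infty)}\le C|d-\beta|^{-1/p}\|u\|_{\mathcal{T}^\beta_\delta(\mathcal{R}_{-\delta})}\qquad\text{for all }u\in\mathcal{T}^\beta_\delta(\mathcal{R}_{-\delta}),$$ where $C$ is a constant independent of $\delta$, $\beta$ and $u\in\mathcal{T}^\beta_\delta(\mathcal{R}_{-\delta})$.
   Context: Here $d$ is a positive integer and $1<p<\infty$. Notation: $\mathcal{R}_{-\delta}=(-\delta,0)\times\mathbb{R}^{d-1}$ and $\mathcal{R}_{-\delta}^\infty=(-\delta,\infty)\times\mathbb{R}^{d-1}$. An extension operator is a linear map $E$ with $(Eu)|_{\mathcal{R}_{-\delta}}=u$ (a.e.) for all $u$. For $\delta>0$ and $\beta\in[0,d+p)$ the kernel is $\gamma^{\beta}_\delta(r)=\frac{C_{d,p,\beta}}{\delta^{d+p-\beta}}\,r^{-\beta}\,1_{\{r<\delta\}}$ with $C_{d,p,\beta}=(d+p-\beta)/s_{d-1}$, where $s_{d-1}$ is the surface area of the unit sphere in $\mathbb{R}^d$. For a domain $U\subset\mathbb{R}^d$, $|u|^p_{\mathcal{S}^{\beta}_\delta(U)}=\int_U\int_U\gamma^\beta_\delta(|y-x|)\,|u(y)-u(x)|^p\,dy\,dx$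 and $\|u\|_{\mathcal{S}^\beta_\delta(U)}=(\|u\|_{L^p(U)}^p+|u|^p_{\mathcal{S}^\beta_\delta(U)})^{1/p}$; the space $\mathcal{S}^\beta_\delta(U)$ is the completion, with respect to this norm, of the functions in $C^1(\overline U)$ with finite norm. For measurable $V\subset\mathbb{R}^d$, $\mathcal{T}^\beta_\delta(V)$ is the space of $u\in L^p(V)$ with finite norm $\|u\|_{\mathcal{T}^\beta_\delta(V)}=\left(\frac1\delta\|u\|^p_{L^p(V)}+|u|^p_{\mathcal{T}^\beta_\delta(V)}\right)^{1/p}$, where $$|u|^p_{\mathcal{T}^\beta_\delta(V)}=\delta^{\beta-2}\int_V\int_V\frac{|u(y)-u(x)|^p}{(|y-x|\vee\delta)^{d+p-2}(|y-x|\wedge\delta)^\beta}\,dy\,dx,$$ with $a\vee b=\max(a,b)$, $a\wedge b=\min(a,b)$. *)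

theory Defs
  imports "HOL-Analysis.Analysis"
begin

text \<open>
  Euclidean space of dimension d is \<^typ>\<open>real ^ 'n\<close> with d = \<^term>\<open>CARD('n)\<close>. Functions on a set U are
  total functions of which only the values on U matter, and elements of the function spaces are
  identified when they agree almost everywhere on U. Norms take values in \<^typ>\<open>ennreal\<close>, so that
  an infinite norm is not confused with a finite one.
\<close>

definition ennroot :: "real \<Rightarrow> ennreal \<Rightarrow> ennreal" where
  "ennroot p a = (if a = top then top else ennreal (enn2real a powr (1 / p)))"

definition Lp_pow :: "real \<Rightarrow> (real ^ 'n) set \<Rightarrow> (real ^ 'n \<Rightarrow> real) \<Rightarrow> ennreal" where
  "Lp_pow p U u = (\<integral>\<^sup>+ x. ennreal (\<bar>u x\<bar> powr p) \<partial>lebesgue_on U)"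

text \<open>
  The surface area of the unit sphere in dimension d is the derivative at r = 1 of the volume
  \<open>unit_ball_vol d * r ^ d\<close> of the ball of radius r.
\<close>

definition sphere_area :: "nat \<Rightarrow> real" where
  "sphere_area d = real d * unit_ball_vol (real d)"

lemma sphere_area_closed_form:
  assumes "d > 0"
  shows "sphere_area d = 2 * pi powr (real d / 2) / Gamma (real d / 2)"
proof -
  have "Gamma (real d / 2 + 1) = real d / 2 * Gamma (real d / 2)"
    using assms by (intro Gamma_plus1) (auto elim!: nonpos_Ints_cases)
  moreover have "Gamma (real d / 2) > 0"
    using assms by (intro Gamma_real_pos) simp
  ultimately show ?thesis
    using assms unfolding sphere_area_def unit_ball_vol_def
    by (simp only:) (simp add: divide_simps)
qed

definition kernel_const :: "nat \<Rightarrow> real \<Rightarrow> real \<Rightarrow> real" where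
  "kernel_const d p \<beta> = (real d + p - \<beta>) / sphere_area d"

definition kernel :: "nat \<Rightarrow> real \<Rightarrow> real \<Rightarrow> real \<Rightarrow> real \<Rightarrow> real" where
  "kernel d p \<beta> \<delta> r =
     kernel_const d p \<beta> / \<delta> powr (real d + p - \<beta>) * r powr (- \<beta>) * indicator {..<\<delta>} r"

definition S_seminorm_pow ::
    "real \<Rightarrow> real \<Rightarrow> real \<Rightarrow> (real ^ 'n) set \<Rightarrow> (real ^ 'n \<Rightarrow> real) \<Rightarrow> ennreal" where
  "S_seminorm_pow p \<beta> \<delta> U u =
     (\<integral>\<^sup>+ x. (\<integral>\<^sup>+ y. ennreal (kernel CARD('n) p \<beta> \<delta> (norm (y - x)) * \<bar>u y - u x\<bar> powr p)
        \<partial>lebesgue_on U) \<partial>lebesgue_on U)"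

definition S_norm ::
    "real \<Rightarrow> real \<Rightarrow> real \<Rightarrow> (real ^ 'n) set \<Rightarrow> (real ^ 'n \<Rightarrow> real) \<Rightarrow> ennreal" where
  "S_norm p \<beta> \<delta> U u = ennroot p (Lp_pow p U u + S_seminorm_pow p \<beta> \<delta> U u)"

text \<open>
  Continuously differentiable up to the boundary: u and its gradient on the open set U extend
  continuously to the closure of U. No boundedness is required.
\<close>

definition C1_closure :: "(real ^ 'n) set \<Rightarrow> (real ^ 'n \<Rightarrow> real) \<Rightarrow> bool" where
  "C1_closure U u \<longleftrightarrow> continuous_on (closure U) u \<and>
     (\<exists>g. continuous_on (closure U) g \<and> (\<forall>x\<in>U. GDERIV u x :> g x))"

text \<open>
  The completion is realised as the closure of the \<open>C\<^sup>1\<close> functions of finite norm inside the space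
  of all measurable functions of finite norm. The latter space is complete (by Fatou's lemma and
  completeness of \<open>L\<^sup>p\<close>), so this closure is the completion, as a space of functions on U
  (modulo null sets), and its norm is given by the same formula.
\<close>

definition S_space :: "real \<Rightarrow> real \<Rightarrow> real \<Rightarrow> (real ^ 'n) set \<Rightarrow> (real ^ 'n \<Rightarrow> real) set" where
  "S_space p \<beta> \<delta> U = {u \<in> borel_measurable (lebesgue_on U).
     \<exists>f :: nat \<Rightarrow> real ^ 'n \<Rightarrow> real.
       (\<forall>n. C1_closure U (f n) \<and> S_norm p \<beta> \<delta> U (f n) < top) \<and>
       (\<lambda>n. S_norm p \<beta> \<delta> U (\<lambda>x. f n x - u x)) \<longlonglongrightarrow> 0}"

definition T_seminorm_pow ::
    "real \<Rightarrow> real \<Rightarrow> real \<Rightarrow> (real ^ 'n) set \<Rightarrow> (real ^ 'n \<Rightarrow> real) \<Rightarrow> ennreal" where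
  "T_seminorm_pow p \<beta> \<delta> V u =
     ennreal (\<delta> powr (\<beta> - 2)) *
     (\<integral>\<^sup>+ x. (\<integral>\<^sup>+ y. ennreal (\<bar>u y - u x\<bar> powr p /
          (max (norm (y - x)) \<delta> powr (real CARD('n) + p - 2) * min (norm (y - x)) \<delta> powr \<beta>))
        \<partial>lebesgue_on V) \<partial>lebesgue_on V)"

definition T_norm ::
    "real \<Rightarrow> real \<Rightarrow> real \<Rightarrow> (real ^ 'n) set \<Rightarrow> (real ^ 'n \<Rightarrow> real) \<Rightarrow> ennreal" where
  "T_norm p \<beta> \<delta> V u = ennroot p (ennreal (1 / \<delta>) * Lp_pow p V u + T_seminorm_pow p \<beta> \<delta> V u)"

definition T_space :: "real \<Rightarrow> real \<Rightarrow> real \<Rightarrow> (real ^ 'n) set \<Rightarrow> (real ^ 'n \<Rightarrow> real) set" where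
  "T_space p \<beta> \<delta> V = {u \<in> borel_measurable (lebesgue_on V). T_norm p \<beta> \<delta> V u < top}"

text \<open>The coordinate k plays the role of the first coordinate.\<close>

definition strip :: "'n \<Rightarrow> real \<Rightarrow> (real ^ 'n) set" where
  "strip k \<delta> = {x. - \<delta> < x $ k \<and> x $ k < 0}"

definition half_space :: "'n \<Rightarrow> real \<Rightarrow> (real ^ 'n) set" where
  "half_space k \<delta> = {x. - \<delta> < x $ k}"

text \<open>
  A linear extension operator from a space X of functions on A to a space Y of functions on B,
  as a map on classes modulo null sets: the second clause says that it is well defined on classes.
\<close>

definition extension_operator ::
    "(real ^ 'n) set \<Rightarrow> (real ^ 'n \<Rightarrow> real) set \<Rightarrow> (real ^ 'n) set \<Rightarrow> (real ^ 'n \<Rightarrow> real) set \<Rightarrow>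
     ((real ^ 'n \<Rightarrow> real) \<Rightarrow> (real ^ 'n \<Rightarrow> real)) \<Rightarrow> bool" where
  "extension_operator A X B Y E \<longleftrightarrow>
     (\<forall>u\<in>X. E u \<in> Y) \<and>
     (\<forall>u\<in>X. \<forall>v\<in>X. (AE x in lebesgue_on A. u x = v x) \<longrightarrow> (AE x in lebesgue_on B. E u x = E v x)) \<and>
     (\<forall>u\<in>X. \<forall>v\<in>X. \<forall>a b :: real. AE x in lebesgue_on B.
        E (\<lambda>z. a * u z + b * v z) x = a * E u x + b * E v x) \<and>
     (\<forall>u\<in>X. AE x in lebesgue_on A. E u x = u x)"

end

theory Submission
  imports Defs
begin

text \<open>
  For \<open>x\<close> at height \<open>t = x $ k\<close> let \<open>v x\<close> be a weighted average of \<open>u\<close> over the points of the strip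
  within distance comparable to \<open>t + 2 * \<delta>\<close> of \<open>x\<close>, with a Lipschitz weight, and let \<open>R\<close> be
  the reflection \<open>t \<mapsto> - \<bar>t\<bar>\<close>. The extension is \<open>\<chi> * v + \<psi> * (u \<circ> R - v)\<close>, where the cutoff \<open>\<psi>\<close> falls
  from 1 at height 0 to 0 at height \<open>\<delta>\<close>, and \<open>\<chi>\<close> from 1 at height \<open>M\<close> to 0 at height \<open>2 * M\<close>.

  Since the weight has Lipschitz constant of order \<open>1 / (t + 2 * \<delta>)\<close>, Jensen's inequality
  bounds \<open>\<bar>v y - v x\<bar> powr p\<close> by \<open>norm (y - x) powr p\<close> times a mean of \<open>\<bar>u b - u a\<bar> powr p\<close> over pairs in the patch
  below \<open>x\<close>. Integrating in \<open>x\<close> for a fixed pair reproduces the far part of the trace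
  seminorm. Below height \<open>\<delta>\<close> the reflection does not increase distances, so \<open>u \<circ> R\<close> is controlled by the near
  part, and \<open>u \<circ> R - v\<close> has \<open>L\<^sup>p\<close> norm of order \<open>\<delta>\<close> times the seminorm, which pays for the cutoff.

  Membership in the completion is automatic for functions of finite norm: averages over cubes in
  the direction pointing into the half space converge almost everywhere and do not increase the norm, hence
  converge in norm by a Riesz--Scheffe argument; they are continuous, and averaging once more
  with a \<open>C\<^sup>1\<close> kernel makes them \<open>C\<^sup>1\<close>.
\<close>

subsection \<open>Radial integrals and convergence in L^p\<close>

text \<open>The weight of \<open>v\<close> lives on a piece of the strip of thickness \<delta> and
  width about r = t + 2 \<delta>, so it has size 1 / (\<delta> r^(d-1)). The factor (norm (y - x) /
  r)^p and one such size for each point of a pair give the density \<delta>^(-2) r^(-(p+2d-2)). Its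
  integral over the x with r at least of order m = max (norm (b - a)) \<delta> is of order
  \<delta>^(-2) m^(-(d+p-2)): the trace kernel with its minimum replaced by \<delta>. The offset 2
  \<delta> keeps r above \<delta>, so r varies at most by a factor 2 within the range of the kernel.
  Each cutoff answers an obstacle. The reflected function exists only up to height \<delta>, and a
  cutoff there costs \<delta>^(-p), affordable for the difference with \<open>v\<close> only. And
  \<open>v\<close> need not lie in L^p of the half space: a unit of height costs order 1 / \<delta>,
  the weight in the T norm, so stopping at height 2 M gives M / \<delta>; this is where M enters.
  The p-th moment of the kernel is normalised to 1, so \<beta> acts only through this moment,
  monotonicity and the comparison with the trace kernel.\<close>

text \<open>Polar coordinates for radial functions from ball volumes alone: the half lines
  \<open>{..r}\<close> form an intersection-stable generator, and on each of them both measures give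
  the volume of the ball of radius \<open>r\<close>, on the right by the fundamental theorem of
  calculus.\<close>

lemma distr_norm_lborel:
  "distr lborel borel (norm :: 'a::euclidean_space \<Rightarrow> real) =
   density lborel (\<lambda>r. ennreal (DIM('a) * unit_ball_vol DIM('a) * r ^ (DIM('a) - 1)) * indicator {0..} r)"
    (is "?M = ?N")
proof (rule measure_eqI_generator_eq[where E = "range atMost" and \<Omega> = UNIV and A = "\<lambda>i. {..real i}"])
  have radial: "emeasure ?M {..r} = ennreal (unit_ball_vol DIM('a) * r ^ DIM('a)) \<and>
      emeasure ?N {..r} = ennreal (unit_ball_vol DIM('a) * r ^ DIM('a))" if "0 \<le> r" for r
  proof
    have "norm -` {..r} \<inter> space lborel = cball (0::'a) r"
      by auto
    then show "emeasure ?M {..r} = ennreal (unit_ball_vol DIM('a) * r ^ DIM('a))"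
      using that by (simp add: emeasure_distr emeasure_cball)
    have "emeasure ?N {..r} = (\<integral>\<^sup>+x. ennreal (DIM('a) * unit_ball_vol DIM('a) * x ^ (DIM('a) - 1)) *
        indicator {0..r} x \<partial>lborel)"
      by (subst emeasure_density) (auto intro!: nn_integral_cong split: split_indicator)
    also have "\<dots> = ennreal (unit_ball_vol DIM('a) * r ^ DIM('a) - unit_ball_vol DIM('a) * 0 ^ DIM('a))"
      using that by (intro nn_integral_FTC_Icc) (auto intro!: derivative_eq_intros)
    finally show "emeasure ?N {..r} = ennreal (unit_ball_vol DIM('a) * r ^ DIM('a))"
      by (simp add: zero_power)
  qed
  have neg: "emeasure ?M {..r} = 0 \<and> emeasure ?N {..r} = 0" if "r < 0" for r
  proof
    have "norm -` {..r} \<inter> space lborel = ({} :: 'a set)"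
      using that by (auto dest: order_trans[OF norm_ge_zero])
    then show "emeasure ?M {..r} = 0"
      by (simp add: emeasure_distr)
    have "emeasure ?N {..r} = (\<integral>\<^sup>+(x::real). 0 \<partial>lborel)"
      using that by (subst emeasure_density, simp, simp, intro nn_integral_cong) (auto split: split_indicator)
    then show "emeasure ?N {..r} = 0"
      by simp
  qed
  show "emeasure ?M X = emeasure ?N X" if X: "X \<in> range atMost" for X
  proof -
    obtain r where "X = {..r}"
      using X by blast
    then show ?thesis
      using radial[of r] neg[of r] by (cases "0 \<le> r") auto
  qed
  show "Int_stable (range atMost :: real set set)"
    by (auto simp: Int_stable_def)
  show "sets ?M = sigma_sets UNIV (range atMost)" "sets ?N = sigma_sets UNIV (range atMost)"
    by (simp_all add: borel_eq_atMost)
  show "(\<Union>i. {..real i}) = UNIV"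
    by (auto intro: real_arch_simple)
  show "emeasure ?M {..real i} \<noteq> \<infinity>" for i
    using radial[of "real i"] by simp
qed auto

lemma nn_integral_radial:
  fixes f :: "real \<Rightarrow> ennreal"
  assumes [measurable]: "f \<in> borel_measurable borel"
  shows "(\<integral>\<^sup>+x. f (norm (x::'a::euclidean_space)) \<partial>lborel) =
    (\<integral>\<^sup>+r. ennreal (DIM('a) * unit_ball_vol DIM('a) * r ^ (DIM('a) - 1)) * indicator {0..} r * f r \<partial>lborel)"
proof -
  have "(\<integral>\<^sup>+x. f (norm (x::'a)) \<partial>lborel) = integral\<^sup>N (distr lborel borel (norm :: 'a \<Rightarrow> real)) f"
    by (simp add: nn_integral_distr)
  also have "\<dots> = (\<integral>\<^sup>+r. ennreal (DIM('a) * unit_ball_vol DIM('a) * r ^ (DIM('a) - 1)) * indicator {0..} r * f r \<partial>lborel)"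
    unfolding distr_norm_lborel by (subst nn_integral_density) (auto simp: mult_ac)
  finally show ?thesis .
qed

lemma nn_integral_norm_powr_ball:
  fixes \<alpha> m :: real
  assumes "0 < \<alpha> + DIM('a)" "0 < m"
  shows "(\<integral>\<^sup>+x. ennreal (norm (x::'a::euclidean_space) powr \<alpha>) * indicator {..<m} (norm x) \<partial>lborel) =
    ennreal (DIM('a) * unit_ball_vol DIM('a) * m powr (\<alpha> + DIM('a)) / (\<alpha> + DIM('a)))"
proof -
  let ?s = "DIM('a) * unit_ball_vol DIM('a)"
  have pow: "r ^ (DIM('a) - 1) * r powr \<alpha> = r powr (\<alpha> + DIM('a) - 1)" if "0 < r" for r :: real
  proof -
    have "r ^ (DIM('a) - 1) = r powr (real DIM('a) - 1)"
      using that powr_realpow[of r "DIM('a) - 1"] by (simp add: of_nat_diff)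
    then have "r ^ (DIM('a) - 1) * r powr \<alpha> = r powr (real DIM('a) - 1 + \<alpha>)"
      by (simp only: powr_add)
    also have "real DIM('a) - 1 + \<alpha> = (\<alpha> + DIM('a) - 1)"
      by simp
    finally show ?thesis .
  qed
  have s: "0 \<le> ?s"
    by (simp add: unit_ball_vol_nonneg)
  \<comment> \<open>The identity \<open>pow'\<close> is for positive \<open>r\<close>, and the
    indicators of \<open>{..<m}\<close> and \<open>{0..m}\<close> differ at \<open>m\<close>; both
    points are null.\<close>
  have ae: "AE r in lborel. r \<noteq> (0::real) \<and> r \<noteq> m"
    using AE_lborel_singleton[of "0::real"] AE_lborel_singleton[of m] by auto
  have pow': "ennreal (?s * r ^ (DIM('a) - Suc 0)) * ennreal (r powr \<alpha>) = ennreal ?s * ennreal (r powr (\<alpha> + DIM('a) - 1))" if "0 < r" for r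
    using that s pow[OF that] by (simp add: ennreal_mult'[symmetric] mult.assoc)
  have "(\<integral>\<^sup>+x. ennreal (norm (x::'a) powr \<alpha>) * indicator {..<m} (norm x) \<partial>lborel) =
      (\<integral>\<^sup>+r. ennreal (?s * r ^ (DIM('a) - 1)) * indicator {0..} r * (ennreal (r powr \<alpha>) * indicator {..<m} r) \<partial>lborel)"
    by (rule nn_integral_radial) auto
  also have "\<dots> = (\<integral>\<^sup>+r. ennreal ?s * (ennreal (r powr (\<alpha> + DIM('a) - 1)) * indicator {0..m} r) \<partial>lborel)"
    using ae by (intro nn_integral_cong_AE, eventually_elim) (auto split: split_indicator simp: pow')
  also have "\<dots> = ennreal ?s * (\<integral>\<^sup>+r. ennreal (r powr (\<alpha> + DIM('a) - 1)) * indicator {0..m} r \<partial>lborel)"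
    by (rule nn_integral_cmult) auto
  also have "(\<integral>\<^sup>+r. ennreal (r powr (\<alpha> + DIM('a) - 1)) * indicator {0..m} r \<partial>lborel) =
      ennreal (m powr (\<alpha> + DIM('a) - 1 + 1) / (\<alpha> + DIM('a) - 1 + 1))"
    using assms by (intro nn_integral_has_integral_lebesgue' has_integral_powr_from_0) auto
  finally show ?thesis
    using s assms by (simp add: ennreal_mult'[symmetric])
qed

lemma nn_integral_norm_powr_outside_ball:
  fixes q m :: real
  assumes "DIM('a) < q" "0 < m"
  shows "(\<integral>\<^sup>+x. ennreal (norm (x::'a::euclidean_space) powr (- q)) * indicator {m..} (norm x) \<partial>lborel) =
    ennreal (DIM('a) * unit_ball_vol DIM('a) * m powr (DIM('a) - q) / (q - DIM('a)))"
proof -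
  let ?s = "DIM('a) * unit_ball_vol DIM('a)"
  have pow: "r ^ (DIM('a) - 1) * r powr (- q) = r powr (DIM('a) - q - 1)" if "0 < r" for r :: real
  proof -
    have "r ^ (DIM('a) - 1) = r powr (real DIM('a) - 1)"
      using that powr_realpow[of r "DIM('a) - 1"] by (simp add: of_nat_diff)
    then have "r ^ (DIM('a) - 1) * r powr (- q) = r powr (real DIM('a) - 1 + (- q))"
      by (simp only: powr_add)
    also have "real DIM('a) - 1 + (- q) = (DIM('a) - q - 1)"
      by simp
    finally show ?thesis .
  qed
  have s: "0 \<le> ?s"
    by (simp add: unit_ball_vol_nonneg)
  have pow': "ennreal (?s * r ^ (DIM('a) - Suc 0)) * ennreal (r powr (- q)) = ennreal ?s * ennreal (r powr (DIM('a) - q - 1))" if "0 < r" for r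
    using that s pow[OF that] by (simp add: ennreal_mult'[symmetric] mult.assoc)
  have "(\<integral>\<^sup>+x. ennreal (norm (x::'a) powr (- q)) * indicator {m..} (norm x) \<partial>lborel) =
      (\<integral>\<^sup>+r. ennreal (?s * r ^ (DIM('a) - 1)) * indicator {0..} r * (ennreal (r powr (- q)) * indicator {m..} r) \<partial>lborel)"
    by (rule nn_integral_radial) auto
  also have "\<dots> = (\<integral>\<^sup>+r. ennreal ?s * (ennreal (r powr (DIM('a) - q - 1)) * indicator {m..} r) \<partial>lborel)"
    using assms(2) by (intro nn_integral_cong) (auto split: split_indicator simp: pow')
  also have "\<dots> = ennreal ?s * (\<integral>\<^sup>+r. ennreal (r powr (DIM('a) - q - 1)) * indicator {m..} r \<partial>lborel)"
    by (rule nn_integral_cmult) auto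
  also have "(\<integral>\<^sup>+r. ennreal (r powr (DIM('a) - q - 1)) * indicator {m..} r \<partial>lborel) =
      ennreal (- (m powr (DIM('a) - q - 1 + 1)) / (DIM('a) - q - 1 + 1))"
    using assms by (intro nn_integral_has_integral_lebesgue' has_integral_powr_to_inf) auto
  also have "- (m powr (DIM('a) - q - 1 + 1)) / (DIM('a) - q - 1 + 1) = m powr (DIM('a) - q) / (q - DIM('a))"
    using assms by (simp add: field_simps)
  finally show ?thesis
    using s assms by (simp add: ennreal_mult'[symmetric])
qed

section \<open>Convexity of the p-th power\<close>

text \<open>Convexity: \<open>s powr p\<close> lies above its tangent at \<open>c\<close>, with the
  terms rearranged. Young's inequality with exponents p and p / (p - 1) gives this without
  differentiating, also at \<open>c = 0\<close>.\<close>

lemma powr_tangent_le: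
  fixes s c p :: real
  assumes "1 < p" "0 \<le> s" "0 \<le> c"
  shows "p * c powr (p - 1) * s \<le> s powr p + (p - 1) * c powr p"
proof -
  have "s * c powr (p - 1) \<le> s powr p / p + (c powr (p - 1)) powr (p / (p - 1)) / (p / (p - 1))"
    using assms by (intro Youngs_inequality) (auto simp: field_simps)
  also have "(c powr (p - 1)) powr (p / (p - 1)) = c powr p"
    using assms by (simp add: powr_powr)
  finally show ?thesis
    using assms by (simp add: field_simps)
qed

text \<open>The tangent inequality at the point \<open>c = I / A\<close> is integrated against
  \<open>D\<close>. The mass is only bounded by \<open>A\<close>, not normalised:
  \<open>A = 1\<close> serves averages, a small \<open>A\<close> serves differences of two averaging
  kernels.\<close>

lemma weighted_jensen_powr:
  fixes D h :: "'a \<Rightarrow> real"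
  assumes "1 < p" "0 < A" and [measurable]: "D \<in> borel_measurable M" "h \<in> borel_measurable M"
    and D: "\<And>x. 0 \<le> D x" "(\<integral>\<^sup>+x. ennreal (D x) \<partial>M) \<le> ennreal A"
  shows "ennreal (\<bar>\<integral>x. D x * h x \<partial>M\<bar> powr p) \<le>
    ennreal (A powr (p - 1)) * (\<integral>\<^sup>+x. ennreal (D x * \<bar>h x\<bar> powr p) \<partial>M)" (is "_ \<le> _ * ?R")
\<comment> \<open>A non-integrable product has Bochner integral 0, and an infinite right side leaves
  nothing to show.\<close>
proof (cases "integrable M (\<lambda>x. D x * h x) \<and> ?R \<noteq> top")
  case False
  then show ?thesis
    using assms(1,2) by (auto simp: not_integrable_integral_eq ennreal_mult_top)
next
  case True
  have DI: "integrable M D"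
    using D by (intro integrableI_bounded) (auto simp: le_less_trans[OF _ ennreal_less_top])
  have RI: "integrable M (\<lambda>x. D x * \<bar>h x\<bar> powr p)"
    using True D by (intro integrableI_bounded) (auto simp: top.not_eq_extremum)
  have hI: "integrable M (\<lambda>x. D x * \<bar>h x\<bar>)"
    using integrable_abs[of M "\<lambda>x. D x * h x"] True D by (auto simp: abs_mult)
  define I where "I = (\<integral>x. D x * \<bar>h x\<bar> \<partial>M)"
  define c where "c = I / A"
  have I0: "0 \<le> I"
    unfolding I_def using D by (intro integral_nonneg_AE) auto
  have c0: "0 \<le> c"
    using I0 assms by (simp add: c_def)
  have IA: "I = c * A"
    using assms by (simp add: c_def)
  have D1: "(\<integral>x. D x \<partial>M) \<le> A"
    using D assms(2) nn_integral_eq_integral[OF DI] by (simp add: ennreal_le_iff)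
  have "p * c powr (p - 1) * I = (\<integral>x. p * c powr (p - 1) * (D x * \<bar>h x\<bar>) \<partial>M)"
    unfolding I_def by simp
  also have "\<dots> \<le> (\<integral>x. D x * \<bar>h x\<bar> powr p + (p - 1) * c powr p * D x \<partial>M)"
  proof (intro integral_mono Bochner_Integration.integrable_add integrable_mult_right hI RI DI)
    fix x
    show "p * c powr (p - 1) * (D x * \<bar>h x\<bar>) \<le> D x * \<bar>h x\<bar> powr p + (p - 1) * c powr p * D x"
      using mult_left_mono[OF powr_tangent_le[OF assms(1) abs_ge_zero c0, of "h x"] D(1)[of x]]
      by (simp add: algebra_simps)
  qed
  also have "\<dots> = (\<integral>x. D x * \<bar>h x\<bar> powr p \<partial>M) + (p - 1) * c powr p * (\<integral>x. D x \<partial>M)"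
    by (subst Bochner_Integration.integral_add) (auto intro: RI DI)
  also have "\<dots> \<le> (\<integral>x. D x * \<bar>h x\<bar> powr p \<partial>M) + (p - 1) * c powr p * A"
    using assms D1 by (intro add_left_mono mult_left_mono) auto
  finally have "p * (c powr (p - 1) * c) * A \<le> (\<integral>x. D x * \<bar>h x\<bar> powr p \<partial>M) + (p - 1) * c powr p * A"
    by (simp add: IA algebra_simps)
  also have "c powr (p - 1) * c = c powr p"
    using c0 assms by (cases "c = 0") (auto simp: powr_diff)
  finally have *: "c powr p * A \<le> (\<integral>x. D x * \<bar>h x\<bar> powr p \<partial>M)"
    by (simp add: algebra_simps)
  have "\<bar>\<integral>x. D x * h x \<partial>M\<bar> \<le> I"
    unfolding I_def using integral_abs_bound[of M "\<lambda>x. D x * h x"] D by (simp add: abs_mult)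
  then have "\<bar>\<integral>x. D x * h x \<partial>M\<bar> powr p \<le> I powr p"
    using assms by (intro powr_mono2) auto
  also have "I powr p = A powr (p - 1) * (c powr p * A)"
    using c0 assms by (simp add: IA powr_mult powr_diff)
  also have "\<dots> \<le> A powr (p - 1) * (\<integral>x. D x * \<bar>h x\<bar> powr p \<partial>M)"
    using * by (intro mult_left_mono) auto
  finally show ?thesis
    using D by (subst nn_integral_eq_integral[OF RI]) (auto simp: ennreal_mult'[symmetric] intro!: ennreal_leI)
qed

lemma abs_add_powr_le:
  fixes a b p :: real
  assumes "1 < p"
  shows "\<bar>a + b\<bar> powr p \<le> 2 powr p * (\<bar>a\<bar> powr p + \<bar>b\<bar> powr p)"
proof -
  have "\<bar>a + b\<bar> \<le> 2 * max \<bar>a\<bar> \<bar>b\<bar>"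
    by auto
  then have "\<bar>a + b\<bar> powr p \<le> (2 * max \<bar>a\<bar> \<bar>b\<bar>) powr p"
    using assms by (intro powr_mono2) auto
  also have "\<dots> = 2 powr p * (max \<bar>a\<bar> \<bar>b\<bar>) powr p"
    by (simp add: powr_mult)
  also have "(max \<bar>a\<bar> \<bar>b\<bar>) powr p \<le> \<bar>a\<bar> powr p + \<bar>b\<bar> powr p"
    by (auto simp: max_def)
  finally show ?thesis
    by simp
qed

text \<open>The Riesz--Scheffe argument: Fatou's lemma for
  \<open>2 powr p * (\<bar>F n\<bar> powr p + \<bar>G\<bar> powr p) - \<bar>F n - G\<bar> powr p\<close>.\<close>

lemma tendsto_Lp_of_AE_tendsto:
  fixes F :: "nat \<Rightarrow> 'a \<Rightarrow> real" and G :: "'a \<Rightarrow> real"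
  assumes p: "1 < p" and [measurable]: "\<And>n. F n \<in> borel_measurable M" "G \<in> borel_measurable M"
    and lim: "AE x in M. (\<lambda>n. F n x) \<longlonglongrightarrow> G x"
    and le: "\<And>n. (\<integral>\<^sup>+x. ennreal (\<bar>F n x\<bar> powr p) \<partial>M) \<le> (\<integral>\<^sup>+x. ennreal (\<bar>G x\<bar> powr p) \<partial>M)"
    and fin: "(\<integral>\<^sup>+x. ennreal (\<bar>G x\<bar> powr p) \<partial>M) < top"
  shows "(\<lambda>n. \<integral>\<^sup>+x. ennreal (\<bar>F n x - G x\<bar> powr p) \<partial>M) \<longlonglongrightarrow> 0"
proof -
  define c where "c = (2::real) powr p"
  have c0: "0 < c" by (simp add: c_def)
  define I where "I = (\<integral>\<^sup>+x. ennreal (\<bar>G x\<bar> powr p) \<partial>M)"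
  define a where "a n = (\<integral>\<^sup>+x. ennreal (\<bar>F n x - G x\<bar> powr p) \<partial>M)" for n
  define b where "b n = (\<integral>\<^sup>+x. ennreal (c * (\<bar>F n x\<bar> powr p + \<bar>G x\<bar> powr p) - \<bar>F n x - G x\<bar> powr p) \<partial>M)" for n
  have pw: "\<bar>F n x - G x\<bar> powr p \<le> c * (\<bar>F n x\<bar> powr p + \<bar>G x\<bar> powr p)" for n x
    using abs_add_powr_le[OF p, of "F n x" "- G x"] by (simp add: c_def)
  have ab: "b n + a n \<le> ennreal (2 * c) * I" for n
  proof -
    have "b n + a n = (\<integral>\<^sup>+x. ennreal (c * (\<bar>F n x\<bar> powr p + \<bar>G x\<bar> powr p)) \<partial>M)"
      unfolding a_def b_def using pw by (subst nn_integral_add[symmetric]) (auto simp: ennreal_plus[symmetric] simp del: ennreal_plus intro!: nn_integral_cong)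
    also have "\<dots> = ennreal c * ((\<integral>\<^sup>+x. ennreal (\<bar>F n x\<bar> powr p) \<partial>M) + I)"
      unfolding I_def using c0 by (subst nn_integral_add[symmetric], simp, simp, subst nn_integral_cmult[symmetric])
        (auto simp: ennreal_mult intro!: nn_integral_cong)
    also have "\<dots> \<le> ennreal c * (I + I)"
      using le by (intro mult_left_mono add_mono) (auto simp: I_def)
    also have "\<dots> = ennreal (2 * c) * I"
      using c0 by (simp add: ennreal_mult mult_2[symmetric] mult_ac)
    finally show ?thesis .
  qed
  have "ennreal (2 * c) * I = (\<integral>\<^sup>+x. ennreal (2 * c * \<bar>G x\<bar> powr p) \<partial>M)"
    unfolding I_def using c0 by (subst nn_integral_cmult[symmetric]) (auto simp: ennreal_mult)
  also have "\<dots> \<le> (\<integral>\<^sup>+x. liminf (\<lambda>n. ennreal (c * (\<bar>F n x\<bar> powr p + \<bar>G x\<bar> powr p) - \<bar>F n x - G x\<bar> powr p)) \<partial>M)"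
  proof (rule nn_integral_mono_AE, use lim in eventually_elim)
    fix x assume L: "(\<lambda>n. F n x) \<longlonglongrightarrow> G x"
    have "(\<lambda>n. c * (\<bar>F n x\<bar> powr p + \<bar>G x\<bar> powr p) - \<bar>F n x - G x\<bar> powr p)
        \<longlonglongrightarrow> c * (\<bar>G x\<bar> powr p + \<bar>G x\<bar> powr p) - \<bar>G x - G x\<bar> powr p"
      using p by (intro tendsto_intros tendsto_powr2 L) auto
    then have "(\<lambda>n. ennreal (c * (\<bar>F n x\<bar> powr p + \<bar>G x\<bar> powr p) - \<bar>F n x - G x\<bar> powr p))
        \<longlonglongrightarrow> ennreal (2 * c * \<bar>G x\<bar> powr p)"
      using p by (intro tendsto_ennrealI) (simp add: algebra_simps)
    then show "ennreal (2 * c * \<bar>G x\<bar> powr p) \<le>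
        liminf (\<lambda>n. ennreal (c * (\<bar>F n x\<bar> powr p + \<bar>G x\<bar> powr p) - \<bar>F n x - G x\<bar> powr p))"
      by (simp add: lim_imp_Liminf)
  qed
  also have "\<dots> \<le> liminf b"
    unfolding b_def by (intro nn_integral_liminf) auto
  finally have *: "ennreal (2 * c) * I \<le> liminf b" .
  define K where "K = ennreal (2 * c) * I"
  have Kf: "K < top"
    using fin by (auto simp: K_def I_def ennreal_mult_less_top)
  have a_le: "a n \<le> K - b n" for n
    using ab[of n] Kf by (metis K_def add.commute ennreal_le_minus_iff le_add_diff_inverse2 order_trans
        ennreal_add_diff_cancel_right ennreal_minus_mono le_iff_add linear not_less top.extremum_strict zero_le)
  \<comment> \<open>No difference of lower limits is formed in \<open>ennreal\<close>:
    \<open>b n\<close> eventually exceeds every \<open>y\<close> below \<open>K\<close>, and then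
    \<open>a n\<close> is at most \<open>K - y\<close>.\<close>
  have "limsup a \<le> 0 + ennreal e" if "0 < e" for e :: real
  proof -
    have "\<forall>\<^sub>F n in sequentially. a n \<le> ennreal e"
    proof (cases "K = 0")
      case True
      have "a n = 0" for n
        using a_le[of n] True by simp
      then show ?thesis
        by simp
    next
      case False
      then obtain k where k: "K = ennreal k" "0 < k"
        using Kf by (cases K) (auto simp: ennreal_eq_0_iff not_le)
      \<comment> \<open>Within \<open>e\<close> of \<open>k\<close>; the bound \<open>k / 2\<close>
        keeps \<open>y\<close> positive.\<close>
      define y where "y = k - min e (k / 2)"
      have y: "0 < y" "y < k" "k - y \<le> e"
        using that k by (auto simp: y_def min_def)
      have "ennreal y < liminf b"
        using y k * by (intro less_le_trans[of _ K "liminf b"]) (auto simp: K_def[symmetric] ennreal_lessI)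
      then have "\<forall>\<^sub>F n in sequentially. ennreal y < b n"
        by (rule less_LiminfD)
      then show ?thesis
      proof eventually_elim
        case (elim n)
        have "a n \<le> K - ennreal y"
          using a_le[of n] ennreal_minus_mono[of K K "ennreal y" "b n"] elim by (simp add: less_imp_le)
        also have "\<dots> = ennreal (k - y)"
          using k y by (simp add: ennreal_minus)
        also have "\<dots> \<le> ennreal e"
          using y(3) by (rule ennreal_leI)
        finally show ?case .
      qed
    qed
    then show ?thesis
      by (simp add: Limsup_bounded)
  qed
  then have "limsup a \<le> 0"
    by (rule ennreal_le_epsilon)
  then show ?thesis
    unfolding a_def[symmetric] by (intro tendsto_0_if_Limsup_eq_0_ennreal) simp
qed

section \<open>The p-th root on extended nonnegative reals\<close>

lemma ennroot_mono: "0 < p \<Longrightarrow> a \<le> b \<Longrightarrow> ennroot p a \<le> ennroot p b"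
  unfolding ennroot_def by (auto simp: top_unique enn2real_mono top.not_eq_extremum intro!: ennreal_leI powr_mono2)

lemma ennroot_cmult:
  assumes "0 < p" "0 < c"
  shows "ennroot p (ennreal c * a) = ennreal (c powr (1 / p)) * ennroot p a"
proof (cases a)
  case (real r)
  then show ?thesis
    using assms by (simp add: ennroot_def ennreal_mult'[symmetric] powr_mult)
qed (use assms in \<open>simp add: ennroot_def ennreal_mult_top\<close>)

lemma ennroot_less_top_iff: "ennroot p a < top \<longleftrightarrow> a < top"
  by (simp add: ennroot_def top.not_eq_extremum)

lemma tendsto_ennroot_0:
  assumes "0 < p" "a \<longlonglongrightarrow> 0"
  shows "(\<lambda>n. ennroot p (a n)) \<longlonglongrightarrow> 0"
proof -
  have ev: "\<forall>\<^sub>F n in sequentially. a n < top"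
    using assms(2) by (auto intro: order_tendstoD)
  have "(\<lambda>n. enn2real (a n) powr (1 / p)) \<longlonglongrightarrow> enn2real 0 powr (1 / p)"
    using assms by (intro tendsto_powr2 tendsto_enn2real tendsto_const) auto
  then have "(\<lambda>n. ennreal (enn2real (a n) powr (1 / p))) \<longlonglongrightarrow> ennreal 0"
    using assms by (intro tendsto_ennrealI) auto
  then show ?thesis
    using ev by (subst tendsto_cong[OF eventually_mono[OF ev, of "\<lambda>n. ennroot p (a n) = ennreal (enn2real (a n) powr (1 / p))"]])
      (auto simp: ennroot_def)
qed

subsection \<open>Averages over one-sided kernels\<close>

lemma borel_strip [measurable]: "strip k \<delta> \<in> sets (borel :: (real ^ 'n) measure)"
  unfolding strip_def by measurable

lemma borel_half_space [measurable]: "half_space k \<delta> \<in> sets (borel :: (real ^ 'n) measure)"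
  unfolding half_space_def by measurable

text \<open>Moves integrals from restricted Lebesgue measure to \<open>lborel\<close>, where Fubini,
  translations and Borel measurability are at hand.\<close>

lemma nn_integral_lebesgue_on_borel:
  assumes "U \<in> sets borel"
  shows "(\<integral>\<^sup>+x. f x \<partial>lebesgue_on U) = (\<integral>\<^sup>+x. f x * indicator U x \<partial>lborel)"
  using assms by (subst nn_integral_restrict_space) (auto simp: nn_integral_completion)

lemma AE_lebesgue_on_borel:
  assumes "U \<in> sets borel"
  shows "(AE x in lebesgue_on U. P x) \<longleftrightarrow> (AE x in lborel. x \<in> U \<longrightarrow> P x)"
  using assms by (subst AE_restrict_space_iff) (auto simp: AE_completion_iff)

abbreviation Lp_integral :: "real \<Rightarrow> 'a::euclidean_space set \<Rightarrow> ('a \<Rightarrow> real) \<Rightarrow> ennreal" where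
  "Lp_integral p U f \<equiv> (\<integral>\<^sup>+x. ennreal (\<bar>f x\<bar> powr p) * indicator U x \<partial>lborel)"

lemma nn_integral_lborel_translate:
  fixes f :: "'a::euclidean_space \<Rightarrow> ennreal"
  assumes [measurable]: "f \<in> borel_measurable borel"
  shows "(\<integral>\<^sup>+x. f (x + c) \<partial>lborel) = (\<integral>\<^sup>+x. f x \<partial>lborel)"
  by (subst lborel_distr_plus[symmetric, of c], subst nn_integral_distr) (auto simp: add.commute)

lemma integral_lborel_translate:
  fixes f :: "'a::euclidean_space \<Rightarrow> 'b::{banach, second_countable_topology}"
  assumes [measurable]: "f \<in> borel_measurable borel"
  shows "(\<integral>x. f (x + c) \<partial>lborel) = (\<integral>x. f x \<partial>lborel)"
  by (subst lborel_distr_plus[symmetric, of c], subst integral_distr) (auto simp: add.commute)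

text \<open>One form for the nonlocal seminorm, the trace seminorm and its far part;
  \<open>J\<close> is the kernel as a function of the difference, which makes translation invariance
  visible.\<close>

definition double_seminorm ::
    "real \<Rightarrow> ('a::euclidean_space \<Rightarrow> real) \<Rightarrow> 'a set \<Rightarrow> ('a \<Rightarrow> real) \<Rightarrow> ennreal" where
  "double_seminorm p J U f = (\<integral>\<^sup>+x. (\<integral>\<^sup>+y. ennreal (J (y - x) * \<bar>f y - f x\<bar> powr p) * indicator U y \<partial>lborel)
     * indicator U x \<partial>lborel)"

text \<open>Turns the seminorm into the p-th power of an L^p norm of
  \<open>f (snd z) - f (fst z)\<close> on a weighted product space, so that general L^p facts apply
  to it.\<close>

lemma double_seminorm_pair:
  assumes [measurable]: "J \<in> borel_measurable borel" "f \<in> borel_measurable borel" "U \<in> sets borel"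
  shows "double_seminorm p J U f =
    (\<integral>\<^sup>+z. ennreal (J (snd z - fst z)) * (indicator U (fst z) * indicator U (snd z)) *
      ennreal (\<bar>f (snd z) - f (fst z)\<bar> powr p) \<partial>(lborel \<Otimes>\<^sub>M lborel))"
proof -
  have "double_seminorm p J U f = (\<integral>\<^sup>+x. \<integral>\<^sup>+y. ennreal (J (y - x)) * (indicator U x * indicator U y) *
      ennreal (\<bar>f y - f x\<bar> powr p) \<partial>lborel \<partial>lborel)"
    unfolding double_seminorm_def
    by (intro nn_integral_cong, subst nn_integral_multc[symmetric])
      (auto simp: ennreal_mult'' mult_ac intro!: nn_integral_cong)
  also have "\<dots> = (\<integral>\<^sup>+z. ennreal (J (snd z - fst z)) * (indicator U (fst z) * indicator U (snd z)) *
      ennreal (\<bar>f (snd z) - f (fst z)\<bar> powr p) \<partial>(lborel \<Otimes>\<^sub>M lborel))"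
    by (subst lborel.nn_integral_fst[symmetric]) auto
  finally show ?thesis .
qed

lemma double_seminorm_add_le:
  assumes "1 < p" and [measurable]: "J \<in> borel_measurable borel" "f \<in> borel_measurable borel"
    "g \<in> borel_measurable borel" "U \<in> sets borel"
  shows "double_seminorm p J U (\<lambda>x. f x + g x) \<le>
    ennreal (2 powr p) * (double_seminorm p J U f + double_seminorm p J U g)"
  unfolding double_seminorm_pair[OF assms(2) assms(3) assms(5)] double_seminorm_pair[OF assms(2) assms(4) assms(5)]
  apply (subst double_seminorm_pair, measurable)
  apply (subst nn_integral_add[symmetric], measurable)
  apply (subst nn_integral_cmult[symmetric], measurable)
proof (rule nn_integral_mono)
  fix z :: "'a \<times> 'a"
  have *: "\<bar>f (snd z) + g (snd z) - (f (fst z) + g (fst z))\<bar> powr p \<le>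
      2 powr p * (\<bar>f (snd z) - f (fst z)\<bar> powr p + \<bar>g (snd z) - g (fst z)\<bar> powr p)"
    using abs_add_powr_le[OF assms(1), of "f (snd z) - f (fst z)" "g (snd z) - g (fst z)"]
    by (simp add: algebra_simps)
  show "ennreal (J (snd z - fst z)) * (indicator U (fst z) * indicator U (snd z)) *
      ennreal (\<bar>f (snd z) + g (snd z) - (f (fst z) + g (fst z))\<bar> powr p)
    \<le> ennreal (2 powr p) *
      (ennreal (J (snd z - fst z)) * (indicator U (fst z) * indicator U (snd z)) * ennreal (\<bar>f (snd z) - f (fst z)\<bar> powr p) +
       ennreal (J (snd z - fst z)) * (indicator U (fst z) * indicator U (snd z)) * ennreal (\<bar>g (snd z) - g (fst z)\<bar> powr p))"
    using mult_left_mono[OF ennreal_leI[OF *], of "ennreal (J (snd z - fst z)) * (indicator U (fst z) * indicator U (snd z))"]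
    by (simp add: ennreal_mult'' distrib_left mult_ac)
qed

section \<open>Averages that do not increase the norms\<close>

text \<open>A correlation rather than a convolution: \<open>\<kappa>\<close> is a density of
  displacements \<open>z\<close>, and its support shows directly in which directions the average
  looks.\<close>

definition average :: "('a::euclidean_space \<Rightarrow> real) \<Rightarrow> ('a \<Rightarrow> real) \<Rightarrow> 'a \<Rightarrow> real" where
  "average \<kappa> f x = (\<integral>z. \<kappa> z * f (x + z) \<partial>lborel)"

lemma borel_measurable_average [measurable]:
  assumes [measurable]: "\<kappa> \<in> borel_measurable borel" "f \<in> borel_measurable borel"
  shows "average \<kappa> f \<in> borel_measurable borel"
  unfolding average_def by measurable

text \<open>A probability density of displacements each of which maps \<open>U\<close> into itself.
  Averages at points of \<open>U\<close> then see only \<open>U\<close>, so smoothing works up to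
  the boundary without extending the function first.\<close>

locale averaging_kernel =
  fixes U :: "'a::euclidean_space set" and \<kappa> :: "'a \<Rightarrow> real"
  assumes U [measurable]: "U \<in> sets borel"
    and \<kappa>_measurable [measurable]: "\<kappa> \<in> borel_measurable borel"
    and \<kappa>_nonneg: "0 \<le> \<kappa> z"
    and \<kappa>_integral: "(\<integral>\<^sup>+z. ennreal (\<kappa> z) \<partial>lborel) = 1"
    and \<kappa>_shift: "\<kappa> z \<noteq> 0 \<Longrightarrow> x \<in> U \<Longrightarrow> x + z \<in> U"
begin

text \<open>By Jensen and Fubini the left side is at most a mean, over displacements
  \<open>z\<close>, of norms of shifted functions; since \<open>U\<close> shifted by
  \<open>z\<close> stays in \<open>U\<close>, none of these exceeds the norm of
  \<open>f\<close>.\<close>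

lemma nn_integral_average_le:
  assumes p: "1 < p" and [measurable]: "f \<in> borel_measurable borel"
  shows "Lp_integral p U (average \<kappa> f) \<le>
    Lp_integral p U f" (is "_ \<le> ?I")
proof -
  have "Lp_integral p U (average \<kappa> f) \<le>
      (\<integral>\<^sup>+x. (\<integral>\<^sup>+z. ennreal (\<kappa> z * \<bar>f (x + z)\<bar> powr p) * indicator U x \<partial>lborel) \<partial>lborel)"
  proof (intro nn_integral_mono)
    fix x
    have "ennreal (\<bar>average \<kappa> f x\<bar> powr p) \<le>
        ennreal (1 powr (p - 1)) * (\<integral>\<^sup>+z. ennreal (\<kappa> z * \<bar>f (x + z)\<bar> powr p) \<partial>lborel)"
      unfolding average_def using \<kappa>_nonneg \<kappa>_integral p by (intro weighted_jensen_powr) auto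
    then show "ennreal (\<bar>average \<kappa> f x\<bar> powr p) * indicator U x \<le>
        (\<integral>\<^sup>+z. ennreal (\<kappa> z * \<bar>f (x + z)\<bar> powr p) * indicator U x \<partial>lborel)"
      by (auto split: split_indicator)
  qed
  also have "\<dots> = (\<integral>\<^sup>+z. (\<integral>\<^sup>+x. ennreal (\<kappa> z * \<bar>f (x + z)\<bar> powr p) * indicator U x \<partial>lborel) \<partial>lborel)"
    by (rule lborel_pair.Fubini') measurable
  also have "\<dots> \<le> (\<integral>\<^sup>+z. ennreal (\<kappa> z) * ?I \<partial>lborel)"
  proof (intro nn_integral_mono)
    fix z
    have "(\<integral>\<^sup>+x. ennreal (\<kappa> z * \<bar>f (x + z)\<bar> powr p) * indicator U x \<partial>lborel) \<le>
        (\<integral>\<^sup>+x. ennreal (\<kappa> z) * (ennreal (\<bar>f (x + z)\<bar> powr p) * indicator U (x + z)) \<partial>lborel)"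
      using \<kappa>_shift[of z] \<kappa>_nonneg by (intro nn_integral_mono) (auto split: split_indicator simp: ennreal_mult)
    also have "\<dots> = ennreal (\<kappa> z) * (\<integral>\<^sup>+x. (ennreal (\<bar>f (x + z)\<bar> powr p) * indicator U (x + z)) \<partial>lborel)"
      by (rule nn_integral_cmult) measurable
    also have "\<dots> = ennreal (\<kappa> z) * ?I"
      by (subst nn_integral_lborel_translate) auto
    finally show "(\<integral>\<^sup>+x. ennreal (\<kappa> z * \<bar>f (x + z)\<bar> powr p) * indicator U x \<partial>lborel) \<le> ennreal (\<kappa> z) * ?I" .
  qed
  also have "\<dots> = ?I"
    by (subst nn_integral_multc) (auto simp: \<kappa>_integral)
  finally show ?thesis .
qed

text \<open>The same argument on pairs: both points are shifted by the same \<open>z\<close>, which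
  leaves \<open>J (y - x)\<close> unchanged. The hypothesis \<open>int\<close> allows the difference
  of two averages to be written as one integral.\<close>

lemma double_seminorm_average_le:
  assumes p: "1 < p" and [measurable]: "f \<in> borel_measurable borel" "J \<in> borel_measurable borel"
    and int: "\<And>x. integrable lborel (\<lambda>z. \<kappa> z * f (x + z))"
  shows "double_seminorm p J U (average \<kappa> f) \<le> double_seminorm p J U f"
proof -
  let ?F = "\<lambda>x y z. ennreal (J (y - x) * (\<kappa> z * \<bar>f (y + z) - f (x + z)\<bar> powr p)) * indicator U y * indicator U x"
  have "double_seminorm p J U (average \<kappa> f) \<le> (\<integral>\<^sup>+x. (\<integral>\<^sup>+y. (\<integral>\<^sup>+z. ?F x y z \<partial>lborel) \<partial>lborel) \<partial>lborel)"
    unfolding double_seminorm_def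
  proof (intro nn_integral_mono, subst nn_integral_multc[symmetric], measurable, intro nn_integral_mono)
    fix x y
    have "average \<kappa> f y - average \<kappa> f x = (\<integral>z. \<kappa> z * (f (y + z) - f (x + z)) \<partial>lborel)"
      unfolding average_def by (subst Bochner_Integration.integral_diff[symmetric]) (auto simp: int right_diff_distrib)
    also have "ennreal (\<bar>\<dots>\<bar> powr p) \<le>
        ennreal (1 powr (p - 1)) * (\<integral>\<^sup>+z. ennreal (\<kappa> z * \<bar>f (y + z) - f (x + z)\<bar> powr p) \<partial>lborel)"
      using \<kappa>_nonneg \<kappa>_integral p by (intro weighted_jensen_powr) auto
    finally have "ennreal (J (y - x)) * ennreal (\<bar>average \<kappa> f y - average \<kappa> f x\<bar> powr p) \<le>
        ennreal (J (y - x)) * (\<integral>\<^sup>+z. ennreal (\<kappa> z * \<bar>f (y + z) - f (x + z)\<bar> powr p) \<partial>lborel)"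
      by (intro mult_left_mono) auto
    also have "\<dots> = (\<integral>\<^sup>+z. ennreal (J (y - x) * (\<kappa> z * \<bar>f (y + z) - f (x + z)\<bar> powr p)) \<partial>lborel)"
      by (subst nn_integral_cmult[symmetric]) (auto simp: ennreal_mult'' \<kappa>_nonneg)
    finally show "ennreal (J (y - x) * \<bar>average \<kappa> f y - average \<kappa> f x\<bar> powr p) * indicator U y * indicator U x \<le>
        (\<integral>\<^sup>+z. ?F x y z \<partial>lborel)"
      by (auto split: split_indicator simp: ennreal_mult'')
  qed
  also have "\<dots> = (\<integral>\<^sup>+x. (\<integral>\<^sup>+z. (\<integral>\<^sup>+y. ?F x y z \<partial>lborel) \<partial>lborel) \<partial>lborel)"
    by (intro nn_integral_cong lborel_pair.Fubini') measurable
  also have "\<dots> = (\<integral>\<^sup>+z. (\<integral>\<^sup>+x. (\<integral>\<^sup>+y. ?F x y z \<partial>lborel) \<partial>lborel) \<partial>lborel)"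
    by (rule lborel_pair.Fubini') measurable
  also have "\<dots> \<le> (\<integral>\<^sup>+z. ennreal (\<kappa> z) * double_seminorm p J U f \<partial>lborel)"
  proof (intro nn_integral_mono)
    fix z
    have "(\<integral>\<^sup>+x. (\<integral>\<^sup>+y. ?F x y z \<partial>lborel) \<partial>lborel) \<le>
        (\<integral>\<^sup>+x. (\<integral>\<^sup>+y. ennreal (\<kappa> z) * (ennreal (J ((y + z) - (x + z)) * \<bar>f (y + z) - f (x + z)\<bar> powr p) *
          indicator U (y + z) * indicator U (x + z)) \<partial>lborel) \<partial>lborel)"
    proof (intro nn_integral_mono)
      fix x y
      have "ennreal (J (y - x) * (\<kappa> z * \<bar>f (y + z) - f (x + z)\<bar> powr p)) =
          ennreal (\<kappa> z) * ennreal (J (y - x) * \<bar>f (y + z) - f (x + z)\<bar> powr p)"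
        by (subst ennreal_mult'[symmetric]) (auto simp: \<kappa>_nonneg mult_ac)
      then show "?F x y z \<le> ennreal (\<kappa> z) * (ennreal (J ((y + z) - (x + z)) * \<bar>f (y + z) - f (x + z)\<bar> powr p) *
          indicator U (y + z) * indicator U (x + z))"
        using \<kappa>_shift[of z] by (cases "\<kappa> z = 0") (auto split: split_indicator)
    qed
    also have "\<dots> = (\<integral>\<^sup>+x. ennreal (\<kappa> z) * (\<integral>\<^sup>+y. ennreal (J ((y + z) - (x + z)) * \<bar>f (y + z) - f (x + z)\<bar> powr p) *
          indicator U (y + z) * indicator U (x + z) \<partial>lborel) \<partial>lborel)"
      by (intro nn_integral_cong nn_integral_cmult) measurable
    also have "\<dots> = ennreal (\<kappa> z) * (\<integral>\<^sup>+x. (\<integral>\<^sup>+y. ennreal (J ((y + z) - (x + z)) * \<bar>f (y + z) - f (x + z)\<bar> powr p) *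
          indicator U (y + z) * indicator U (x + z) \<partial>lborel) \<partial>lborel)"
      by (rule nn_integral_cmult) measurable
    also have "(\<integral>\<^sup>+x. (\<integral>\<^sup>+y. ennreal (J ((y + z) - (x + z)) * \<bar>f (y + z) - f (x + z)\<bar> powr p) *
          indicator U (y + z) * indicator U (x + z) \<partial>lborel) \<partial>lborel) =
        (\<integral>\<^sup>+x. (\<integral>\<^sup>+y. ennreal (J (y - (x + z)) * \<bar>f y - f (x + z)\<bar> powr p) *
          indicator U y * indicator U (x + z) \<partial>lborel) \<partial>lborel)"
      by (intro nn_integral_cong nn_integral_lborel_translate[where c = z and
            f = "\<lambda>y. ennreal (J (y - (x + z)) * \<bar>f y - f (x + z)\<bar> powr p) * indicator U y * indicator U (x + z)" for x]) measurable
    also have "\<dots> = (\<integral>\<^sup>+x. (\<integral>\<^sup>+y. ennreal (J (y - x) * \<bar>f y - f x\<bar> powr p) * indicator U y * indicator U x \<partial>lborel) \<partial>lborel)"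
      by (rule nn_integral_lborel_translate[where c = z and
            f = "\<lambda>x. (\<integral>\<^sup>+y. ennreal (J (y - x) * \<bar>f y - f x\<bar> powr p) * indicator U y * indicator U x \<partial>lborel)"]) measurable
    also have "\<dots> = double_seminorm p J U f"
      unfolding double_seminorm_def by (intro nn_integral_cong nn_integral_multc) measurable
    finally show "(\<integral>\<^sup>+x. (\<integral>\<^sup>+y. ?F x y z \<partial>lborel) \<partial>lborel) \<le> ennreal (\<kappa> z) * double_seminorm p J U f" .
  qed
  also have "\<dots> = double_seminorm p J U f"
    by (subst nn_integral_multc) (auto simp: \<kappa>_integral)
  finally show ?thesis .
qed

end

text \<open>The Riesz--Scheffe lemma is applied twice, to \<open>F n\<close> on \<open>U\<close> and
  to the differences \<open>F n (snd z) - F n (fst z)\<close> on pairs weighted by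
  \<open>J\<close>.\<close>

lemma tendsto_norms_of_AE_tendsto:
  assumes p: "1 < p" and [measurable]: "\<And>n. F n \<in> borel_measurable borel" "f \<in> borel_measurable borel"
      "J \<in> borel_measurable borel" "U \<in> sets borel"
    and lim: "AE x in lborel. x \<in> U \<longrightarrow> (\<lambda>n. F n x) \<longlonglongrightarrow> f x"
    and le1: "\<And>n. Lp_integral p U (F n) \<le> Lp_integral p U f"
    and le2: "\<And>n. double_seminorm p J U (F n) \<le> double_seminorm p J U f"
    and fin: "Lp_integral p U f < top" "double_seminorm p J U f < top"
  shows "(\<lambda>n. Lp_integral p U (\<lambda>x. F n x - f x) +
    double_seminorm p J U (\<lambda>x. F n x - f x)) \<longlonglongrightarrow> 0"
proof -
  let ?M = "density lborel (indicator U)"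
  have "(\<lambda>n. \<integral>\<^sup>+x. ennreal (\<bar>F n x - f x\<bar> powr p) \<partial>?M) \<longlonglongrightarrow> 0"
  proof (rule tendsto_Lp_of_AE_tendsto[OF p])
    show "AE x in ?M. (\<lambda>n. F n x) \<longlonglongrightarrow> f x"
      using lim by (subst AE_density) (auto simp: indicator_def)
  qed (use le1 fin in \<open>simp_all add: nn_integral_density mult.commute\<close>)
  then have L1: "(\<lambda>n. \<integral>\<^sup>+x. ennreal (\<bar>F n x - f x\<bar> powr p) * indicator U x \<partial>lborel) \<longlonglongrightarrow> 0"
    by (simp add: nn_integral_density mult.commute)
  let ?w = "\<lambda>z. ennreal (J (snd z - fst z)) * (indicator U (fst z) * indicator U (snd z))"
  let ?N = "density (lborel \<Otimes>\<^sub>M lborel) ?w"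
  have N_eq: "(\<integral>\<^sup>+z. ennreal (\<bar>g (snd z) - g (fst z)\<bar> powr p) \<partial>?N) = double_seminorm p J U g"
    if [measurable]: "g \<in> borel_measurable borel" for g
    by (simp add: nn_integral_density double_seminorm_pair)
  obtain N where N: "N \<in> null_sets lborel" "{x. \<not> (x \<in> U \<longrightarrow> (\<lambda>n. F n x) \<longlonglongrightarrow> f x)} \<subseteq> N"
    using lim by (auto simp: eventually_ae_filter)
  have [measurable]: "N \<in> sets borel"
    using N(1) by auto
  \<comment> \<open>Pairs with a coordinate in the exceptional set are null, so almost everywhere
    convergence passes to differences.\<close>
  have AE1: "AE z in lborel \<Otimes>\<^sub>M lborel. fst z \<notin> N \<and> snd z \<notin> N"
  proof (rule lborel_pair.AE_pair_measure)
    show "AE x in lborel. AE y in lborel. fst (x, y) \<notin> N \<and> snd (x, y) \<notin> N"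
      using AE_not_in[OF N(1)] by eventually_elim (use AE_not_in[OF N(1)] in simp)
  qed measurable
  have "(\<lambda>n. \<integral>\<^sup>+z. ennreal (\<bar>(F n (snd z) - F n (fst z)) - (f (snd z) - f (fst z))\<bar> powr p) \<partial>?N) \<longlonglongrightarrow> 0"
  proof (rule tendsto_Lp_of_AE_tendsto[OF p])
    show "AE z in ?N. (\<lambda>n. F n (snd z) - F n (fst z)) \<longlonglongrightarrow> f (snd z) - f (fst z)"
      using AE1
    proof (subst AE_density, measurable, eventually_elim)
      case (elim z)
      then have "fst z \<in> U \<Longrightarrow> (\<lambda>n. F n (fst z)) \<longlonglongrightarrow> f (fst z)" "snd z \<in> U \<Longrightarrow> (\<lambda>n. F n (snd z)) \<longlonglongrightarrow> f (snd z)"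
        using N(2) by auto
      then show ?case
        by (auto split: split_indicator intro: tendsto_diff)
    qed
  qed (use le2 fin N_eq in \<open>simp_all\<close>)
  moreover have "(\<integral>\<^sup>+z. ennreal (\<bar>(F n (snd z) - F n (fst z)) - (f (snd z) - f (fst z))\<bar> powr p) \<partial>?N) =
      double_seminorm p J U (\<lambda>x. F n x - f x)" for n
    using N_eq[of "\<lambda>x. F n x - f x"] by (simp add: algebra_simps)
  ultimately have L2: "(\<lambda>n. double_seminorm p J U (\<lambda>x. F n x - f x)) \<longlonglongrightarrow> 0"
    by simp
  show ?thesis
    using tendsto_add[OF L1 L2] by simp
qed

text \<open>On a set of finite measure the bound \<bar>f\<bar> \<le> 1 + \<bar>f\<bar> powr p
  suffices.\<close>

lemma set_integrable_of_nn_integral_powr: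
  fixes f :: "'a::euclidean_space \<Rightarrow> real"
  assumes p: "1 < p" and [measurable]: "f \<in> borel_measurable borel" "S \<in> sets borel"
    and "bounded S" "(\<integral>\<^sup>+x. ennreal (\<bar>f x\<bar> powr p) \<partial>lborel) < top"
  shows "set_integrable lborel S f"
  unfolding set_integrable_def
proof (rule integrableI_bounded)
  have "(\<integral>\<^sup>+x. ennreal (norm (indicator S x *\<^sub>R f x)) \<partial>lborel) \<le>
      (\<integral>\<^sup>+x. indicator S x + ennreal (\<bar>f x\<bar> powr p) \<partial>lborel)"
  proof (intro nn_integral_mono)
    fix x
    have "\<bar>f x\<bar> \<le> 1 + \<bar>f x\<bar> powr p"
    proof (cases "\<bar>f x\<bar> \<le> 1")
      case False
      then have "\<bar>f x\<bar> powr 1 \<le> \<bar>f x\<bar> powr p"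
        using p by (intro powr_mono) auto
      then show ?thesis
        using False by simp
    qed (auto intro: add_increasing2)
    then show "ennreal (norm (indicator S x *\<^sub>R f x)) \<le> indicator S x + ennreal (\<bar>f x\<bar> powr p)"
      by (auto split: split_indicator simp: ennreal_plus[symmetric] ennreal_1[symmetric] simp del: ennreal_plus ennreal_1 intro!: ennreal_leI)
  qed
  also have "\<dots> = emeasure lborel S + (\<integral>\<^sup>+x. ennreal (\<bar>f x\<bar> powr p) \<partial>lborel)"
    by (subst nn_integral_add) auto
  also have "\<dots> < \<infinity>"
    using assms emeasure_bounded_finite[OF \<open>bounded S\<close>] by simp
  finally show "(\<integral>\<^sup>+x. ennreal (norm (indicator S x *\<^sub>R f x)) \<partial>lborel) < \<infinity>" .
qed measurable

section \<open>Averages over cubes\<close>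

text \<open>The cube has a corner at the origin, so displacements have nonnegative coordinates; this
  is also the shape for which the differentiation theorem
  \<open>integrable_ccontinuous_explicit\<close> is stated.\<close>

definition cube_kernel :: "real \<Rightarrow> 'a::euclidean_space \<Rightarrow> real" where
  "cube_kernel h z = indicator (cbox 0 (h *\<^sub>R One)) z / h ^ DIM('a)"

lemma borel_measurable_cube_kernel [measurable]: "cube_kernel h \<in> borel_measurable borel"
  unfolding cube_kernel_def by measurable

lemma averaging_kernel_cube:
  assumes "0 < h"
  shows "averaging_kernel (half_space k \<delta>) (cube_kernel h)"
proof
  have "(\<integral>\<^sup>+z. ennreal (cube_kernel h (z::real^'a)) \<partial>lborel) =
      (\<integral>\<^sup>+z. ennreal (1 / h ^ CARD('a)) * indicator (cbox 0 (h *\<^sub>R One)) (z::real^'a) \<partial>lborel)"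
    by (intro nn_integral_cong) (auto simp: cube_kernel_def split: split_indicator)
  also have "\<dots> = ennreal (1 / h ^ CARD('a)) * emeasure lborel (cbox 0 (h *\<^sub>R One) :: (real^'a) set)"
    by (rule nn_integral_cmult_indicator) auto
  also have "emeasure lborel (cbox 0 (h *\<^sub>R One) :: (real^'a) set) = ennreal (h ^ CARD('a))"
    using assms by (subst emeasure_lborel_cbox) auto
  finally show "(\<integral>\<^sup>+z. ennreal (cube_kernel h (z::real^'a)) \<partial>lborel) = 1"
    using assms by (simp add: ennreal_mult'[symmetric])
  show "0 \<le> cube_kernel h z" for z :: "real^'a"
    using assms by (simp add: cube_kernel_def)
  show "x + z \<in> half_space k \<delta>" if "cube_kernel h z \<noteq> 0" "x \<in> half_space k \<delta>" for x z
  proof -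
    have "z \<in> cbox 0 (h *\<^sub>R One)"
      using that by (auto simp: cube_kernel_def split: split_indicator_asm)
    then have "0 \<le> z $ k"
      by (simp add: mem_box_cart)
    then show ?thesis
      using that by (simp add: half_space_def)
  qed
qed measurable

lemma average_cube_eq:
  fixes f :: "'a::euclidean_space \<Rightarrow> real"
  assumes [measurable]: "f \<in> borel_measurable borel"
    and int: "set_integrable lborel (cbox x (x + h *\<^sub>R One)) f"
  shows "average (cube_kernel h) f x = integral (cbox x (x + h *\<^sub>R One)) f /\<^sub>R h ^ DIM('a)"
proof -
  have "average (cube_kernel h) f x =
      (\<integral>z. indicator (cbox x (x + h *\<^sub>R One)) (z + x) * f (z + x) / h ^ DIM('a) \<partial>lborel)"
    unfolding average_def cube_kernel_def
    by (intro Bochner_Integration.integral_cong) (auto simp: mem_box inner_add_left add.commute split: split_indicator)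
  also have "\<dots> = (\<integral>z. indicator (cbox x (x + h *\<^sub>R One)) z * f z / h ^ DIM('a) \<partial>lborel)"
    by (rule integral_lborel_translate) measurable
  also have "\<dots> = (LINT z : cbox x (x + h *\<^sub>R One) | lborel. f z) / h ^ DIM('a)"
    unfolding set_lebesgue_integral_def by simp
  also have "(LINT z : cbox x (x + h *\<^sub>R One) | lborel. f z) = integral (cbox x (x + h *\<^sub>R One)) f"
    by (rule set_borel_integral_eq_integral[OF int])
  finally show ?thesis
    by (simp add: field_simps)
qed

lemma continuous_average_cube:
  fixes f :: "'a::euclidean_space \<Rightarrow> real"
  assumes [measurable]: "f \<in> borel_measurable borel" and int: "\<And>a b. set_integrable lborel (cbox a b) f"
    and h: "0 < h"
  shows "continuous_on UNIV (average (cube_kernel h) f)"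
proof -
  have int': "f integrable_on cbox a b" for a b
    using set_borel_integral_eq_integral[OF int] by blast
  have "continuous_on UNIV (\<lambda>x. integral (cbox x (x + h *\<^sub>R One)) f)"
    unfolding continuous_on_iff
  proof (intro ballI allI impI)
    fix x :: 'a and e :: real assume e: "0 < e"
    let ?a = "x - (1 + h) *\<^sub>R One" and ?b = "x + (1 + h) *\<^sub>R One"
    have mem: "x \<in> cbox ?a ?b" "x + h *\<^sub>R One \<in> cbox ?a ?b"
      using h by (auto simp: mem_box inner_diff_left inner_add_left)
    obtain d where d: "0 < d" "\<And>c' d'. \<lbrakk>c' \<in> cbox ?a ?b; d' \<in> cbox ?a ?b; norm (c' - x) \<le> d; norm (d' - (x + h *\<^sub>R One)) \<le> d\<rbrakk>
        \<Longrightarrow> norm (integral (cbox c' d') f - integral (cbox x (x + h *\<^sub>R One)) f) < e"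
      using indefinite_integral_continuous[OF int' mem e] by metis
    show "\<exists>d>0. \<forall>y\<in>UNIV. dist y x < d \<longrightarrow> dist (integral (cbox y (y + h *\<^sub>R One)) f) (integral (cbox x (x + h *\<^sub>R One)) f) < e"
    proof (intro exI[of _ "min d 1"] conjI ballI impI)
      fix y assume y: "dist y x < min d 1"
      have "\<bar>(y - x) \<bullet> i\<bar> \<le> 1" if "i \<in> Basis" for i
        using Basis_le_norm[OF that, of "y - x"] y by (simp add: dist_norm)
      then have "y \<in> cbox ?a ?b" "y + h *\<^sub>R One \<in> cbox ?a ?b"
        using h by (fastforce simp: mem_box inner_diff_left inner_add_left abs_le_iff)+
      then show "dist (integral (cbox y (y + h *\<^sub>R One)) f) (integral (cbox x (x + h *\<^sub>R One)) f) < e"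
        using d(2)[of y "y + h *\<^sub>R One"] y by (simp add: dist_norm)
    qed (use d in auto)
  qed
  moreover have "average (cube_kernel h) f = (\<lambda>x. integral (cbox x (x + h *\<^sub>R One)) f /\<^sub>R h ^ DIM('a))"
    using average_cube_eq[OF assms(1) int] by auto
  ultimately show ?thesis
    by (simp only:) (intro continuous_intros)
qed

text \<open>Lebesgue differentiation over cubes with corner \<open>x\<close>; its negligible set is
  carried over to \<open>lborel\<close>.\<close>

lemma average_cube_tendsto_AE:
  fixes f :: "'a::euclidean_space \<Rightarrow> real"
  assumes [measurable]: "f \<in> borel_measurable borel" and int: "\<And>a b. set_integrable lborel (cbox a b) f"
  shows "AE x in lborel. (\<lambda>n. average (cube_kernel (1 / real (Suc n))) f x) \<longlonglongrightarrow> f x"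
proof -
  have int': "f integrable_on cbox a b" for a b
    using set_borel_integral_eq_integral[OF int] by blast
  obtain N where N: "negligible N" "\<And>x e. \<lbrakk>x \<notin> N; 0 < e\<rbrakk> \<Longrightarrow> \<exists>d>0. \<forall>h. 0 < h \<and> h < d \<longrightarrow>
      norm (integral (cbox x (x + h *\<^sub>R One)) f /\<^sub>R h ^ DIM('a) - f x) < e"
    using integrable_ccontinuous_explicit[OF int'] by metis
  have "AE x in lebesgue. x \<notin> N"
    using N(1) by (intro AE_not_in) (simp add: negligible_iff_null_sets)
  then have "AE x in lborel. x \<notin> N"
    by (simp add: AE_completion_iff)
  then show ?thesis
  proof eventually_elim
    case (elim x)
    show ?case
    proof (rule metric_LIMSEQ_I)
      fix e :: real assume "0 < e"
      then obtain d where d: "0 < d" "\<And>h. 0 < h \<Longrightarrow> h < d \<Longrightarrow>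
          norm (integral (cbox x (x + h *\<^sub>R One)) f /\<^sub>R h ^ DIM('a) - f x) < e"
        using N(2)[OF elim] by blast
      obtain n0 where n0: "1 / real (Suc n0) < d"
        using nat_approx_posE[OF d(1)] by (auto simp: field_simps)
      have "dist (average (cube_kernel (1 / real (Suc n))) f x) (f x) < e" if "n0 \<le> n" for n
      proof -
        have "1 / real (Suc n) < d"
          using that n0 by (smt (verit) frac_le of_nat_0_less_iff of_nat_le_iff zero_less_Suc Suc_le_mono)
        then show ?thesis
          using d(2)[of "1 / real (Suc n)"] by (simp add: average_cube_eq int dist_norm)
      qed
      then show "\<exists>n0. \<forall>n\<ge>n0. dist (average (cube_kernel (1 / real (Suc n))) f x) (f x) < e"
        by blast
    qed
  qed
qed

lemma continuous_integral_translate: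
  fixes w :: "'a::euclidean_space \<Rightarrow> 'b::{banach, second_countable_topology}" and v :: "'a \<Rightarrow> real"
  assumes w: "integrable lborel w" "\<And>z. R < norm z \<Longrightarrow> w z = 0" and v: "continuous_on UNIV v"
  shows "integrable lborel (\<lambda>z. v (x + z) *\<^sub>R w z)"
    and "continuous_on UNIV (\<lambda>x. \<integral>z. v (x + z) *\<^sub>R w z \<partial>lborel)"
proof -
  have [measurable]: "v \<in> borel_measurable borel"
    using v by (rule borel_measurable_continuous_onI)
  have [measurable]: "w \<in> borel_measurable borel"
    using w(1) by auto
  \<comment> \<open>Where \<open>w\<close> does not vanish, \<open>x + z\<close> stays in a compact
    ball; this gives one dominating function for all \<open>x\<close> of norm at most
    \<open>r\<close>.\<close>
  have bnd: "\<exists>B\<ge>0. \<forall>x z. norm x \<le> r \<longrightarrow> norm (v (x + z) *\<^sub>R w z) \<le> B * norm (w z)" for r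
  proof -
    have "compact (v ` cball 0 (r + R))"
      by (intro compact_continuous_image continuous_on_subset[OF v]) auto
    then obtain B where B: "0 < B" "\<And>y. y \<in> cball 0 (r + R) \<Longrightarrow> norm (v y) \<le> B"
      using bounded_pos[of "v ` cball 0 (r + R)"] compact_imp_bounded by auto
    have "norm (v (x + z) *\<^sub>R w z) \<le> B * norm (w z)" if "norm x \<le> r" for x z
    proof (cases "norm z \<le> R")
      case True
      then have "x + z \<in> cball 0 (r + R)"
        using that norm_triangle_ineq[of x z] by simp
      then show ?thesis
        using B(2) by (simp add: mult_right_mono)
    qed (use w(2) in simp)
    then show ?thesis
      using B(1) by (intro exI[of _ B]) auto
  qed
  show "integrable lborel (\<lambda>z. v (x + z) *\<^sub>R w z)" for x
  proof -
    obtain B where "0 \<le> B" "\<And>z. norm (v (x + z) *\<^sub>R w z) \<le> B * norm (w z)"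
      using bnd[of "norm x"] by auto
    then show ?thesis
      by (intro Bochner_Integration.integrable_bound[OF integrable_mult_right[OF integrable_norm[OF w(1)], of B]]) auto
  qed
  show "continuous_on UNIV (\<lambda>x. \<integral>z. v (x + z) *\<^sub>R w z \<partial>lborel)"
    unfolding continuous_on_sequentially
  proof safe
    fix X :: "nat \<Rightarrow> 'a" and x assume X: "X \<longlonglongrightarrow> x"
    obtain r where r: "\<And>n. norm (X n) \<le> r"
      using X convergent_imp_Bseq[of X] by (auto simp: convergent_def Bseq_def)
    obtain B where B: "0 \<le> B" "\<And>x z. norm x \<le> r \<Longrightarrow> norm (v (x + z) *\<^sub>R w z) \<le> B * norm (w z)"
      using bnd[of r] by auto
    have "(\<lambda>n. \<integral>z. v (X n + z) *\<^sub>R w z \<partial>lborel) \<longlonglongrightarrow> (\<integral>z. v (x + z) *\<^sub>R w z \<partial>lborel)"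
    proof (rule integral_dominated_convergence[where w = "\<lambda>z. B * norm (w z)"])
      show "AE z in lborel. (\<lambda>n. v (X n + z) *\<^sub>R w z) \<longlonglongrightarrow> v (x + z) *\<^sub>R w z"
      proof (rule AE_I2)
        fix z
        have "isCont v (x + z)"
          using v by (simp add: continuous_on_eq_continuous_at)
        then show "(\<lambda>n. v (X n + z) *\<^sub>R w z) \<longlonglongrightarrow> v (x + z) *\<^sub>R w z"
          by (intro tendsto_scaleR isCont_tendsto_compose[of _ v] tendsto_add X tendsto_const)
      qed
    qed (use w(1) r B in auto)
    then show "((\<lambda>x. \<integral>z. v (x + z) *\<^sub>R w z \<partial>lborel) \<circ> X) \<longlonglongrightarrow> (\<integral>z. v (x + z) *\<^sub>R w z \<partial>lborel)"
      by (simp add: o_def)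
  qed
qed

lemma integrable_lborel_translate:
  fixes f :: "'a::euclidean_space \<Rightarrow> 'b::{banach, second_countable_topology}"
  assumes "integrable lborel f"
  shows "integrable lborel (\<lambda>x. f (x + c))"
proof -
  have [measurable]: "f \<in> borel_measurable borel"
    using assms by auto
  have "integrable (distr lborel borel ((+) c)) f"
    using assms by (simp add: lborel_distr_plus)
  then show ?thesis
    by (simp add: integrable_distr_eq add.commute)
qed

section \<open>A continuously differentiable bump and averages against it\<close>

text \<open>The square of the positive part is C^1 with derivative \<open>2 * max 0 r\<close>, and
  its Taylor remainder is quadratic across the kink as well. This gives the bump below a uniform
  first-order expansion.\<close>

lemma max_0_squared_remainder:
  fixes r s :: real
  shows "\<bar>(max 0 s)\<^sup>2 - (max 0 r)\<^sup>2 - 2 * max 0 r * (s - r)\<bar> \<le> (s - r)\<^sup>2"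
proof -
  consider "0 \<le> r" "0 \<le> s" | "0 \<le> r" "s < 0" | "r < 0" "0 \<le> s" | "r < 0" "s < 0"
    by linarith
  then show ?thesis
  proof cases
    case 1
    then have "(max 0 s)\<^sup>2 - (max 0 r)\<^sup>2 - 2 * max 0 r * (s - r) = (s - r)\<^sup>2"
      by (simp add: max_def power2_eq_square algebra_simps)
    then show ?thesis
      by simp
  next
    case 2
    then have "(max 0 s)\<^sup>2 - (max 0 r)\<^sup>2 - 2 * max 0 r * (s - r) = r * r + 2 * (r * (- s))"
      by (simp add: max_def power2_eq_square algebra_simps)
    moreover have "(s - r)\<^sup>2 = r * r + 2 * (r * (- s)) + s * s"
      by (simp add: power2_eq_square algebra_simps)
    moreover have "0 \<le> r * (- s)" "0 \<le> r * r" "0 \<le> s * s"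
      using 2 by (intro mult_nonneg_nonneg, auto)
    ultimately show ?thesis
      by linarith
  next
    case 3
    then show ?thesis
      by (simp add: max_def power_mono)
  qed (simp add: max_def)
qed

text \<open>The outer square makes this C^1 across the sphere of radius \<open>h\<close>; more
  smoothness is not asked of the approximants.\<close>

definition bump :: "'a::euclidean_space \<Rightarrow> real \<Rightarrow> 'a \<Rightarrow> real" where
  "bump c h z = (max 0 (h\<^sup>2 - (norm (z - c))\<^sup>2))\<^sup>2"

lemma continuous_bump: "continuous_on UNIV (bump c h)"
  unfolding bump_def by (intro continuous_intros)

lemma borel_measurable_bump [measurable]: "bump c h \<in> borel_measurable borel"
  by (rule borel_measurable_continuous_onI) (rule continuous_bump)

lemma bump_eq_0:
  assumes "0 \<le> h" "norm c + h < norm z"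
  shows "bump c h z = 0"
proof -
  have "h \<le> norm (z - c)"
    using assms norm_triangle_ineq2[of z c] by linarith
  then have "h\<^sup>2 \<le> (norm (z - c))\<^sup>2"
    using assms by (intro power_mono) auto
  then show ?thesis
    by (simp add: bump_def)
qed

lemma integrable_bump:
  assumes "0 \<le> h"
  shows "integrable lborel (bump c h)"
proof -
  have "integrable lborel (\<lambda>z. indicator (cball 0 (norm c + h)) z *\<^sub>R bump c h z)"
    by (intro borel_integrable_compact continuous_on_subset[OF continuous_bump]) auto
  moreover have "(\<lambda>z. indicator (cball 0 (norm c + h)) z *\<^sub>R bump c h z) = bump c h"
    using bump_eq_0[OF assms, of c] by (auto split: split_indicator simp: not_le)
  ultimately show ?thesis
    by simp
qed

lemma integral_bump_pos:
  assumes "0 < h"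
  shows "0 < (\<integral>z. bump c h z \<partial>lborel)"
proof -
  have "0 < ennreal ((h\<^sup>2 / 2)\<^sup>2) * emeasure lborel (ball c (h / 2))"
    using assms emeasure_ball[of "h / 2" c]
    by (simp add: ennreal_zero_less_mult_iff unit_ball_vol_pos)
  also have "\<dots> = (\<integral>\<^sup>+z. ennreal ((h\<^sup>2 / 2)\<^sup>2) * indicator (ball c (h / 2)) z \<partial>lborel)"
    by (subst nn_integral_cmult_indicator) auto
  also have "\<dots> \<le> (\<integral>\<^sup>+z. ennreal (bump c h z) \<partial>lborel)"
  proof (intro nn_integral_mono)
    fix z
    show "ennreal ((h\<^sup>2 / 2)\<^sup>2) * indicator (ball c (h / 2)) z \<le> ennreal (bump c h z)"
    proof (cases "z \<in> ball c (h / 2)")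
      case True
      then have "(norm (z - c))\<^sup>2 \<le> (h / 2)\<^sup>2"
        by (intro power_mono) (auto simp: dist_norm norm_minus_commute)
      then have "(norm (z - c))\<^sup>2 \<le> h\<^sup>2 / 4"
        by (simp add: power_divide)
      then have "h\<^sup>2 / 2 \<le> h\<^sup>2 - (norm (z - c))\<^sup>2"
        using zero_le_power2[of "norm (z - c)"] by linarith
      then have "h\<^sup>2 / 2 \<le> max 0 (h\<^sup>2 - (norm (z - c))\<^sup>2)"
        by (rule max.coboundedI2)
      then have "(h\<^sup>2 / 2)\<^sup>2 \<le> bump c h z"
        unfolding bump_def by (intro power_mono) auto
      then show ?thesis
        using True by (simp add: ennreal_leI)
    qed simp
  qed
  also have "\<dots> = ennreal (\<integral>z. bump c h z \<partial>lborel)"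
    using assms by (intro nn_integral_eq_integral integrable_bump) (auto simp: bump_def)
  finally show ?thesis
    by simp
qed

text \<open>Translation moves the increment \<open>e\<close> from the merely continuous
  \<open>v\<close> to the bump, whose expansion has the linear term \<open>inner e (w z)\<close>:
  \<open>w\<close> is minus the gradient of the bump.\<close>

lemma GDERIV_average_bump:
  fixes v :: "'a::euclidean_space \<Rightarrow> real" and c :: 'a and h :: real
  assumes v: "continuous_on UNIV v" and h: "0 < h"
  defines "w \<equiv> \<lambda>z. (4 * max 0 (h\<^sup>2 - (norm (z - c))\<^sup>2)) *\<^sub>R (z - c)"
  shows "GDERIV (average (bump c h) v) x :> (\<integral>z. v (x + z) *\<^sub>R w z \<partial>lborel)"
    and "continuous_on UNIV (\<lambda>x. \<integral>z. v (x + z) *\<^sub>R w z \<partial>lborel)"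
proof -
  \<comment> \<open>The extra 1 puts the bump and all its translates by \<open>e\<close> with
    \<open>norm e \<le> 1\<close> inside the ball of radius \<open>R\<close>.\<close>
  define R where "R = norm c + h + 1"
  have w0: "w z = 0" if "norm c + h < norm z" for z
    using bump_eq_0[OF _ that] h by (simp add: w_def bump_def)
  have w_cont: "continuous_on UNIV w"
    unfolding w_def by (intro continuous_intros)
  have w_int: "integrable lborel w"
  proof -
    have "integrable lborel (\<lambda>z. indicator (cball 0 (norm c + h)) z *\<^sub>R w z)"
      by (intro borel_integrable_compact continuous_on_subset[OF w_cont]) auto
    moreover have "(\<lambda>z. indicator (cball 0 (norm c + h)) z *\<^sub>R w z) = w"
      using w0 by (auto split: split_indicator simp: not_le)
    ultimately show ?thesis
      by simp
  qed
  show "continuous_on UNIV (\<lambda>x. \<integral>z. v (x + z) *\<^sub>R w z \<partial>lborel)"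
    using w_int w0 v by (rule continuous_integral_translate)
  have [measurable]: "v \<in> borel_measurable borel" "w \<in> borel_measurable borel"
    using v w_cont by (auto intro: borel_measurable_continuous_onI)
  \<comment> \<open>With \<open>?r\<close> and \<open>?s\<close> below, the square bounds
    \<open>(?s - ?r)\<^sup>2\<close>, the remainder of the outer square, and
    \<open>2 * h\<^sup>2\<close> accounts for the term \<open>- (norm e)\<^sup>2\<close> inside
    \<open>?s - ?r\<close>.\<close>
  define C where "C = (2 * (R + norm c) + 1)\<^sup>2 + 2 * h\<^sup>2"
  have rem: "\<bar>bump c h (z - e) - bump c h z - inner e (w z)\<bar> \<le> C * (norm e)\<^sup>2 * indicator (cball 0 R) z"
    if e: "norm e \<le> 1" for e z
  proof (cases "norm z \<le> R")
    case False
    then have "norm c + h < norm z" "norm c + h < norm (z - e)"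
      using e norm_triangle_ineq2[of z e] by (auto simp: R_def)
    then show ?thesis
      using h False by (simp add: bump_eq_0 w0)
  next
    case True
    let ?r = "h\<^sup>2 - (norm (z - c))\<^sup>2" and ?s = "h\<^sup>2 - (norm (z - e - c))\<^sup>2"
    have sr: "?s - ?r = 2 * inner (z - c) e - (norm e)\<^sup>2"
      by (simp add: power2_norm_eq_inner inner_diff_left inner_diff_right inner_commute algebra_simps)
    have "\<bar>?s - ?r\<bar> \<le> 2 * (norm (z - c) * norm e) + (norm e)\<^sup>2"
      unfolding sr using Cauchy_Schwarz_ineq2[of "z - c" e] by (smt (verit) zero_le_power2)
    also have "\<dots> \<le> 2 * ((R + norm c) * norm e) + 1 * norm e"
      using True e norm_triangle_ineq4[of z c]
      by (intro add_mono mult_left_mono mult_right_mono) (auto simp: power2_eq_square mult_left_le)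
    finally have "(?s - ?r)\<^sup>2 \<le> ((2 * (R + norm c) + 1) * norm e)\<^sup>2"
      by (subst abs_le_square_iff[symmetric]) (simp add: algebra_simps)
    then have sr2: "(?s - ?r)\<^sup>2 \<le> (2 * (R + norm c) + 1)\<^sup>2 * (norm e)\<^sup>2"
      by (simp add: power_mult_distrib)
    have "2 * max 0 ?r * (?s - ?r) = inner e (w z) - 2 * max 0 ?r * (norm e)\<^sup>2"
      unfolding sr by (simp add: w_def inner_commute algebra_simps)
    moreover have "2 * max 0 ?r * (norm e)\<^sup>2 \<le> 2 * h\<^sup>2 * (norm e)\<^sup>2"
      by (intro mult_right_mono) auto
    moreover have "0 \<le> 2 * max 0 ?r * (norm e)\<^sup>2"
      by simp
    moreover have "bump c h (z - e) = (max 0 ?s)\<^sup>2" "bump c h z = (max 0 ?r)\<^sup>2"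
      by (simp_all add: bump_def)
    ultimately have "\<bar>bump c h (z - e) - bump c h z - inner e (w z)\<bar> \<le> (?s - ?r)\<^sup>2 + 2 * h\<^sup>2 * (norm e)\<^sup>2"
      using max_0_squared_remainder[of ?s ?r] by linarith
    also have "\<dots> \<le> C * (norm e)\<^sup>2"
      using sr2 by (simp add: C_def algebra_simps)
    finally show ?thesis
      using True by simp
  qed
  have bint: "integrable lborel (\<lambda>z. v (y + z) *\<^sub>R bump c h z)" for y
    using h by (intro continuous_integral_translate(1)[OF integrable_bump _ v]) (auto intro: bump_eq_0)
  define V where "V = (\<integral>z. \<bar>v (x + z)\<bar> * indicator (cball 0 R) z \<partial>lborel)"
  have Vint: "integrable lborel (\<lambda>z. \<bar>v (x + z)\<bar> * indicator (cball 0 R) z)"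
  proof -
    have "integrable lborel (\<lambda>z. indicator (cball 0 R) z *\<^sub>R \<bar>v (x + z)\<bar>)"
      by (intro borel_integrable_compact continuous_intros continuous_on_compose2[OF v]) auto
    then show ?thesis
      by (simp add: mult.commute)
  qed
  have main: "\<bar>average (bump c h) v (x + e) - average (bump c h) v x - inner e (\<integral>z. v (x + z) *\<^sub>R w z \<partial>lborel)\<bar>
      \<le> C * V * (norm e)\<^sup>2" if e: "norm e \<le> 1" for e
  proof -
    have shift: "integrable lborel (\<lambda>z. v (x + z) * bump c h (z - e))"
      using integrable_lborel_translate[OF bint[of "x + e"], of "- e"] by (simp add: algebra_simps)
    have "average (bump c h) v (x + e) = (\<integral>z. v (x + e + (z + - e)) *\<^sub>R bump c h (z + - e) \<partial>lborel)"
      unfolding average_def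
      by (subst integral_lborel_translate[where f = "\<lambda>z. v (x + e + z) *\<^sub>R bump c h z"]) (auto simp: mult.commute)
    then have 1: "average (bump c h) v (x + e) = (\<integral>z. v (x + z) * bump c h (z - e) \<partial>lborel)"
      by (simp add: algebra_simps)
    have 2: "inner e (\<integral>z. v (x + z) *\<^sub>R w z \<partial>lborel) = (\<integral>z. v (x + z) * inner e (w z) \<partial>lborel)"
      using continuous_integral_translate(1)[OF w_int w0 v, of "norm c + h" x]
      by (subst integral_inner_right[symmetric]) auto
    have wint: "integrable lborel (\<lambda>z. v (x + z) * inner e (w z))"
      using integrable_inner_right[OF continuous_integral_translate(1)[OF w_int w0 v, of "norm c + h" x], of e] by simp
    have 3: "average (bump c h) v x = (\<integral>z. v (x + z) * bump c h z \<partial>lborel)"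
      by (simp add: average_def mult.commute)
    have "average (bump c h) v (x + e) - average (bump c h) v x - inner e (\<integral>z. v (x + z) *\<^sub>R w z \<partial>lborel)
        = (\<integral>z. v (x + z) * (bump c h (z - e) - bump c h z - inner e (w z)) \<partial>lborel)"
      unfolding 1 2 3 using bint[of x] shift wint
      by (simp add: right_diff_distrib Bochner_Integration.integral_diff)
    also have "norm \<dots> \<le> (\<integral>z. C * (norm e)\<^sup>2 * (\<bar>v (x + z)\<bar> * indicator (cball 0 R) z) \<partial>lborel)"
    proof (rule Bochner_Integration.integral_norm_bound_integral)
      show "integrable lborel (\<lambda>z. v (x + z) * (bump c h (z - e) - bump c h z - inner e (w z)))"
        using bint[of x] shift wint by (auto simp: right_diff_distrib)
      show "integrable lborel (\<lambda>z. C * (norm e)\<^sup>2 * (\<bar>v (x + z)\<bar> * indicator (cball 0 R) z))"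
        using Vint by simp
      fix z
      show "norm (v (x + z) * (bump c h (z - e) - bump c h z - inner e (w z))) \<le>
          C * (norm e)\<^sup>2 * (\<bar>v (x + z)\<bar> * indicator (cball 0 R) z)"
        using mult_left_mono[OF rem[OF e, of z], of "\<bar>v (x + z)\<bar>"] by (simp add: abs_mult mult_ac)
    qed
    also have "\<dots> = C * V * (norm e)\<^sup>2"
      by (simp add: V_def)
    finally show ?thesis
      by simp
  qed
  show "GDERIV (average (bump c h) v) x :> (\<integral>z. v (x + z) *\<^sub>R w z \<partial>lborel)"
    unfolding gderiv_def has_derivative_at
  proof
    show "bounded_linear (\<lambda>e. inner e (\<integral>z. v (x + z) *\<^sub>R w z \<partial>lborel))"
      by (rule bounded_linear_inner_left)
    let ?q = "\<lambda>e. norm (average (bump c h) v (x + e) - average (bump c h) v x - inner e (\<integral>z. v (x + z) *\<^sub>R w z \<partial>lborel)) / norm e"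
    show "?q \<midarrow>0\<rightarrow> 0"
    proof (rule tendsto_sandwich[of "\<lambda>_. 0"])
      have "\<forall>\<^sub>F e in at (0::'a). norm e < 1"
        using order_tendstoD(2)[OF tendsto_norm_zero[OF tendsto_ident_at[of "0::'a" UNIV]], of 1] by simp
      then show "\<forall>\<^sub>F e in at 0. ?q e \<le> C * V * norm e"
      proof eventually_elim
        case (elim e)
        then show ?case
          using main[of e] by (cases "e = 0") (auto simp: power2_eq_square field_simps)
      qed
      show "(\<lambda>e. C * V * norm e) \<midarrow>(0::'a)\<rightarrow> 0"
        by (rule tendsto_eq_intros | simp)+
    qed auto
  qed
qed

subsection \<open>Density of smooth functions in the half space\<close>

text \<open>The centre is at height \<open>h\<close> and the radius is \<open>h\<close>: the
  supporting ball touches the boundary hyperplane from inside, so only displacements with positive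
  k-th coordinate carry weight.\<close>

definition bump_kernel :: "'n::finite \<Rightarrow> real \<Rightarrow> real ^ 'n \<Rightarrow> real" where
  "bump_kernel k h z = bump (h *\<^sub>R axis k 1) h z / (\<integral>z. bump (h *\<^sub>R axis k 1 :: real ^ 'n) h z \<partial>lborel)"

lemma integral_bump_kernel:
  fixes k :: "'n::finite"
  assumes "0 < h"
  shows "integrable lborel (bump_kernel k h)" "(\<integral>z. bump_kernel k h z \<partial>lborel) = 1"
  using integrable_bump[of h "h *\<^sub>R axis k 1 :: real ^ 'n"]
    integral_bump_pos[OF assms, of "h *\<^sub>R axis k 1 :: real ^ 'n"] assms
  unfolding bump_kernel_def by auto

lemma bump_kernel_nonneg: "0 \<le> bump_kernel k h z"
  unfolding bump_kernel_def by (intro divide_nonneg_nonneg integral_nonneg_AE) (auto simp: bump_def)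

lemma bump_kernel_eq_0:
  assumes "0 \<le> h" "2 * h < norm z"
  shows "bump_kernel k h z = 0"
  using bump_eq_0[of h "h *\<^sub>R axis k 1" z] assms by (simp add: bump_kernel_def norm_axis_1)

lemma averaging_kernel_bump:
  assumes h: "0 < h"
  shows "averaging_kernel (half_space k \<delta>) (bump_kernel k h)"
proof
  show "bump_kernel k h \<in> borel_measurable borel"
    unfolding bump_kernel_def by measurable
  show "(\<integral>\<^sup>+z. ennreal (bump_kernel k h z) \<partial>lborel) = 1"
    using integral_bump_kernel[OF h, of k] by (subst nn_integral_eq_integral) (auto simp: bump_kernel_nonneg)
  show "x + z \<in> half_space k \<delta>" if "bump_kernel k h z \<noteq> 0" "x \<in> half_space k \<delta>" for x z
  proof -
    let ?c = "h *\<^sub>R axis k 1 :: real ^ 'a"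
    have "(norm (z - ?c))\<^sup>2 < h\<^sup>2"
      using that by (auto simp: bump_kernel_def bump_def max_def split: if_splits)
    then have "norm (z - ?c) < h"
      using h by (simp add: power_less_imp_less_base)
    then have "\<bar>(z - ?c) $ k\<bar> < h"
      using component_le_norm_cart[of "z - ?c" k] by linarith
    then have "0 < z $ k"
      by (simp add: axis_def)
    then show ?thesis
      using that by (simp add: half_space_def)
  qed
qed (simp_all add: bump_kernel_nonneg)

lemma average_bump_kernel:
  "average (bump_kernel k h) v x =
    average (bump (h *\<^sub>R axis k 1) h) v x / (\<integral>z. bump (h *\<^sub>R axis k 1 :: real ^ 'n::finite) h z \<partial>lborel)"
  unfolding average_def bump_kernel_def by simp

lemma C1_average_bump_kernel:
  fixes v :: "real ^ 'n \<Rightarrow> real"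
  assumes v: "continuous_on UNIV v" and h: "0 < h"
  shows "C1_closure U (average (bump_kernel k h) v)"
proof -
  let ?c = "h *\<^sub>R axis k 1 :: real ^ 'n" and ?I = "\<integral>z. bump (h *\<^sub>R axis k 1 :: real ^ 'n) h z \<partial>lborel"
  define D where "D x = (\<integral>z. v (x + z) *\<^sub>R ((4 * max 0 (h\<^sup>2 - (norm (z - ?c))\<^sup>2)) *\<^sub>R (z - ?c)) \<partial>lborel)" for x
  have "GDERIV (average (bump ?c h) v) x :> D x" for x
    unfolding D_def by (rule GDERIV_average_bump(1)[OF v h])
  then have "((average (bump ?c h) v) has_derivative (\<lambda>e. inner e (D x))) (at x)" for x
    by (simp add: gderiv_def)
  then have "((\<lambda>x. average (bump ?c h) v x * inverse ?I) has_derivative (\<lambda>e. inner e (D x) * inverse ?I)) (at x)" for x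
    by (intro has_derivative_mult_left)
  then have G: "GDERIV (average (bump_kernel k h) v) x :> inverse ?I *\<^sub>R D x" for x
    unfolding gderiv_def average_bump_kernel[abs_def] by (simp add: divide_inverse mult.commute)
  then have "isCont (average (bump_kernel k h) v) x" for x
    unfolding gderiv_def by (rule has_derivative_continuous)
  then have "continuous_on (closure U) (average (bump_kernel k h) v)"
    by (simp add: continuous_at_imp_continuous_on)
  moreover have "continuous_on (closure U) (\<lambda>x. inverse ?I *\<^sub>R D x)"
    using GDERIV_average_bump(2)[OF v h, of ?c] unfolding D_def[symmetric]
    by (intro continuous_intros) (auto intro: continuous_on_subset)
  ultimately show ?thesis
    unfolding C1_closure_def using G by blast
qed

lemma average_bump_kernel_tendsto:
  fixes v :: "real ^ 'n \<Rightarrow> real"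
  assumes v: "continuous_on UNIV v"
  shows "(\<lambda>n. average (bump_kernel k (1 / real (Suc n))) v x) \<longlonglongrightarrow> v x"
proof (rule metric_LIMSEQ_I)
  fix e :: real assume e: "0 < e"
  have "isCont v x"
    using v by (simp add: continuous_on_eq_continuous_at)
  then obtain d where d: "0 < d" "\<And>y. dist y x < d \<Longrightarrow> dist (v y) (v x) < e / 2"
    using e unfolding continuous_at_eps_delta by (metis half_gt_zero)
  obtain n0 where n0: "1 / real (Suc n0) < d / 2"
    using nat_approx_posE[of "d / 2"] d(1) by (auto simp: field_simps)
  have "dist (average (bump_kernel k (1 / real (Suc n))) v x) (v x) < e" if "n0 \<le> n" for n
  proof -
    let ?h = "1 / real (Suc n)"
    have h: "0 < ?h" "2 * ?h < d"
      using n0 that frac_le[of 1 1 "real (Suc n0)" "real (Suc n)"] by auto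
    note I = integral_bump_kernel[OF h(1), of k]
    have J: "integrable lborel (\<lambda>z. v (x + z) *\<^sub>R bump_kernel k ?h z)"
      using h by (intro continuous_integral_translate(1)[OF I(1) _ v]) (auto intro: bump_kernel_eq_0)
    have "average (bump_kernel k ?h) v x - v x = (\<integral>z. bump_kernel k ?h z * v (x + z) - bump_kernel k ?h z * v x \<partial>lborel)"
      unfolding average_def using I J by (subst Bochner_Integration.integral_diff) (auto simp: mult.commute)
    also have "norm \<dots> \<le> (\<integral>z. bump_kernel k ?h z * (e / 2) \<partial>lborel)"
    proof (rule Bochner_Integration.integral_norm_bound_integral)
      fix z
      show "norm (bump_kernel k ?h z * v (x + z) - bump_kernel k ?h z * v x) \<le> bump_kernel k ?h z * (e / 2)"
      proof (cases "norm z \<le> 2 * ?h")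
        case True
        then have "dist (v (x + z)) (v x) < e / 2"
          using h by (intro d(2)) (simp add: dist_norm)
        then show ?thesis
          using mult_left_mono[OF less_imp_le bump_kernel_nonneg, of "dist (v (x + z)) (v x)" "e / 2" k ?h z]
            bump_kernel_nonneg[of k ?h z]
          by (simp only: right_diff_distrib[symmetric] real_norm_def abs_mult dist_real_def) simp
      next
        case False
        then show ?thesis
          using h bump_kernel_eq_0[of ?h z k] by simp
      qed
    qed (use I J in \<open>auto simp: mult.commute\<close>)
    also have "\<dots> = e / 2"
      using I by simp
    finally show ?thesis
      using e by (simp add: dist_norm)
  qed
  then show "\<exists>n0. \<forall>n\<ge>n0. dist (average (bump_kernel k (1 / real (Suc n))) v x) (v x) < e"
    by blast
qed

definition S_pow :: "real \<Rightarrow> real \<Rightarrow> real \<Rightarrow> (real ^ 'n) set \<Rightarrow> (real ^ 'n \<Rightarrow> real) \<Rightarrow> ennreal" where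
  "S_pow p \<beta> \<delta> U u = Lp_integral p U u +
     double_seminorm p (\<lambda>z. kernel CARD('n) p \<beta> \<delta> (norm z)) U u"

lemma S_norm_eq:
  "U \<in> sets borel \<Longrightarrow> S_norm p \<beta> \<delta> U u = ennroot p (S_pow p \<beta> \<delta> U u)"
  unfolding S_norm_def S_pow_def Lp_pow_def S_seminorm_pow_def double_seminorm_def
  by (simp add: nn_integral_lebesgue_on_borel)

lemma S_pow_cong:
  assumes "\<And>x. x \<in> U \<Longrightarrow> u x = v x"
  shows "S_pow p \<beta> \<delta> U u = S_pow p \<beta> \<delta> U v"
  unfolding S_pow_def double_seminorm_def
  by (intro arg_cong2[where f = "(+)"] nn_integral_cong) (auto simp: assms split: split_indicator intro!: nn_integral_cong)

lemma borel_measurable_kernel [measurable]: "kernel d p \<beta> \<delta> \<in> borel_measurable borel"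
  unfolding kernel_def by measurable

lemma S_pow_add_le:
  assumes p: "1 < p" and [measurable]: "f \<in> borel_measurable borel" "g \<in> borel_measurable borel" "U \<in> sets borel"
  shows "S_pow p \<beta> \<delta> U (\<lambda>x. f x + g x) \<le> ennreal (2 powr p) * (S_pow p \<beta> \<delta> U f + S_pow p \<beta> \<delta> U g)"
proof -
  have "Lp_integral p U (\<lambda>x. f x + g x) \<le>
      (\<integral>\<^sup>+x. ennreal (2 powr p) * (ennreal (\<bar>f x\<bar> powr p) * indicator U x + ennreal (\<bar>g x\<bar> powr p) * indicator U x) \<partial>lborel)"
    using ennreal_leI[OF abs_add_powr_le[OF p]]
    by (intro nn_integral_mono) (auto split: split_indicator simp: ennreal_mult' ennreal_plus[symmetric] simp del: ennreal_plus)
  also have "\<dots> = ennreal (2 powr p) * (Lp_integral p U f +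
      Lp_integral p U g)"
    by (subst nn_integral_cmult) (auto simp: nn_integral_add)
  finally have "S_pow p \<beta> \<delta> U (\<lambda>x. f x + g x) \<le> ennreal (2 powr p) * (Lp_integral p U f +
      Lp_integral p U g) +
      ennreal (2 powr p) * (double_seminorm p (\<lambda>z. kernel CARD('a) p \<beta> \<delta> (norm z)) U f +
      double_seminorm p (\<lambda>z. kernel CARD('a) p \<beta> \<delta> (norm z)) U g)"
    unfolding S_pow_def using p by (intro add_mono double_seminorm_add_le) auto
  then show ?thesis
    unfolding S_pow_def by (simp add: distrib_left add_ac)
qed

lemma S_pow_approx_smooth:
  fixes f :: "real ^ 'n \<Rightarrow> real"
  assumes p: "1 < p" and [measurable]: "f \<in> borel_measurable borel"
    and fin: "S_pow p \<beta> \<delta> (half_space k \<delta>) f < top" and e: "0 < e"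
  shows "\<exists>g. C1_closure (half_space k \<delta>) g \<and> S_pow p \<beta> \<delta> (half_space k \<delta>) g < top \<and>
    S_pow p \<beta> \<delta> (half_space k \<delta>) (\<lambda>x. g x - f x) < e"
proof -
  let ?H = "half_space k \<delta>"
  let ?S = "S_pow p \<beta> \<delta> ?H"
  let ?J = "\<lambda>z::real ^ 'n. kernel CARD('n) p \<beta> \<delta> (norm z)"
  define f0 where "f0 x = f x * indicator ?H x" for x
  have [measurable]: "f0 \<in> borel_measurable borel"
    unfolding f0_def by measurable
  have f0_eq: "f0 x = f x" if "x \<in> ?H" for x
    using that by (simp add: f0_def)
  have fin0: "?S f0 < top"
    using fin S_pow_cong[of ?H f0 f] f0_eq by simp
  \<comment> \<open>\<open>S_pow\<close> is a p-th power, so the triangle inequality for the two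
    errors costs a factor \<open>2 powr p\<close>.\<close>
  obtain e' :: ennreal where e': "0 < e'" "ennreal (2 powr p) * (e' + e') < e"
  proof -
    obtain r :: real where r: "0 < r" "ennreal r < e"
      using e by (metis ennreal_0 ennreal_less_zero_iff dense ennreal_cases less_top top.extremum_strict not_less_iff_gr_or_eq)
    let ?e = "r / (2 * 2 powr p)"
    have "ennreal (2 powr p) * (ennreal ?e + ennreal ?e) = ennreal r"
      using r by (simp add: ennreal_plus[symmetric] ennreal_mult'[symmetric] del: ennreal_plus)
    then show ?thesis
      using r by (intro that[of "ennreal ?e"]) auto
  qed
  have Lp: "(\<integral>\<^sup>+x. ennreal (\<bar>f0 x\<bar> powr p) \<partial>lborel) < top"
  proof -
    have "(\<integral>\<^sup>+x. ennreal (\<bar>f0 x\<bar> powr p) \<partial>lborel) = Lp_integral p ?H f0"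
      using p by (intro nn_integral_cong) (auto simp: f0_def split: split_indicator)
    also have "\<dots> \<le> ?S f0"
      unfolding S_pow_def by simp
    finally show ?thesis
      using fin0 by simp
  qed
  have int: "set_integrable lborel (cbox a b) f0" for a b
    using Lp by (intro set_integrable_of_nn_integral_powr[OF p]) auto
  define F where "F n = average (cube_kernel (1 / real (Suc n))) f0" for n
  have [measurable]: "F n \<in> borel_measurable borel" for n
    unfolding F_def by measurable
  have F_le: "Lp_integral p ?H (F n) \<le> Lp_integral p ?H f0"
    "double_seminorm p ?J ?H (F n) \<le> double_seminorm p ?J ?H f0" for n
  proof -
    interpret averaging_kernel ?H "cube_kernel (1 / real (Suc n)) :: real ^ 'n \<Rightarrow> real"
      by (rule averaging_kernel_cube) simp
    show "Lp_integral p ?H (F n) \<le> Lp_integral p ?H f0"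
      unfolding F_def using p by (intro nn_integral_average_le) auto
    have "integrable lborel (\<lambda>z. cube_kernel (1 / real (Suc n)) z * f0 (x + z))" for x
    proof -
      let ?h = "1 / real (Suc n)"
      have "integrable lborel (\<lambda>z. indicator (cbox x (x + ?h *\<^sub>R One)) z *\<^sub>R f0 z / ?h ^ CARD('n))"
        using int[of x "x + ?h *\<^sub>R One"] unfolding set_integrable_def by (rule integrable_divide)
      then have "integrable lborel (\<lambda>z. indicator (cbox x (x + ?h *\<^sub>R One)) (z + x) *\<^sub>R f0 (z + x) / ?h ^ CARD('n))"
        by (rule integrable_lborel_translate)
      also have "(\<lambda>z. indicator (cbox x (x + ?h *\<^sub>R One)) (z + x) *\<^sub>R f0 (z + x) / ?h ^ CARD('n)) =
          (\<lambda>z. cube_kernel ?h z * f0 (x + z))"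
        by (auto simp: cube_kernel_def mem_box inner_add_left add.commute fun_eq_iff split: split_indicator)
      finally show ?thesis .
    qed
    then show "double_seminorm p ?J ?H (F n) \<le> double_seminorm p ?J ?H f0"
      unfolding F_def using p by (intro double_seminorm_average_le) auto
  qed
  have F_fin: "?S (F n) < top" for n
    using add_mono[OF F_le] fin0 unfolding S_pow_def by (rule le_less_trans)
  have "(\<lambda>n. ?S (\<lambda>x. F n x - f0 x)) \<longlonglongrightarrow> 0"
    unfolding S_pow_def
  proof (rule tendsto_norms_of_AE_tendsto[OF p])
    show "AE x in lborel. x \<in> ?H \<longrightarrow> (\<lambda>n. F n x) \<longlonglongrightarrow> f0 x"
      using average_cube_tendsto_AE[OF _ int] unfolding F_def by auto
  qed (use F_le fin0 in \<open>auto simp: S_pow_def\<close>)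
  then have "\<forall>\<^sub>F n in sequentially. ?S (\<lambda>x. F n x - f0 x) < e'"
    using e'(1) by (rule order_tendstoD(2))
  then obtain n where n: "?S (\<lambda>x. F n x - f0 x) < e'"
    by (auto simp: eventually_sequentially)
  define v where "v = F n"
  have v_cont: "continuous_on UNIV v"
    unfolding v_def F_def by (intro continuous_average_cube int) auto
  have [measurable]: "v \<in> borel_measurable borel"
    unfolding v_def by measurable
  define G where "G m = average (bump_kernel k (1 / real (Suc m))) v" for m
  have [measurable]: "bump_kernel k h \<in> borel_measurable borel" for k h
    unfolding bump_kernel_def by measurable
  have [measurable]: "G m \<in> borel_measurable borel" for m
    unfolding G_def by measurable
  have G_le: "Lp_integral p ?H (G m) \<le> Lp_integral p ?H v"
    "double_seminorm p ?J ?H (G m) \<le> double_seminorm p ?J ?H v" for m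
  proof -
    interpret averaging_kernel ?H "bump_kernel k (1 / real (Suc m))"
      by (rule averaging_kernel_bump) simp
    show "Lp_integral p ?H (G m) \<le> Lp_integral p ?H v"
      unfolding G_def using p by (intro nn_integral_average_le) auto
    have "integrable lborel (\<lambda>z. v (x + z) *\<^sub>R bump_kernel k (1 / real (Suc m)) z)" for x
      by (intro continuous_integral_translate(1)[OF integral_bump_kernel(1) bump_kernel_eq_0 v_cont]) auto
    then show "double_seminorm p ?J ?H (G m) \<le> double_seminorm p ?J ?H v"
      unfolding G_def using p by (intro double_seminorm_average_le) (auto simp: mult.commute)
  qed
  have G_fin: "?S (G m) < top" for m
    using add_mono[OF G_le] F_fin[of n] unfolding S_pow_def v_def by (rule le_less_trans)
  have "(\<lambda>m. ?S (\<lambda>x. G m x - v x)) \<longlonglongrightarrow> 0"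
    unfolding S_pow_def
  proof (rule tendsto_norms_of_AE_tendsto[OF p])
    show "AE x in lborel. x \<in> ?H \<longrightarrow> (\<lambda>m. G m x) \<longlonglongrightarrow> v x"
      using average_bump_kernel_tendsto[OF v_cont] unfolding G_def by auto
  qed (use G_le F_fin[of n] in \<open>auto simp: S_pow_def v_def\<close>)
  then have "\<forall>\<^sub>F m in sequentially. ?S (\<lambda>x. G m x - v x) < e'"
    using e'(1) by (rule order_tendstoD(2))
  then obtain m where m: "?S (\<lambda>x. G m x - v x) < e'"
    by (auto simp: eventually_sequentially)
  have "?S (\<lambda>x. G m x - f x) = ?S (\<lambda>x. (G m x - v x) + (v x - f0 x))"
    by (rule S_pow_cong) (simp add: f0_eq)
  also have "\<dots> \<le> ennreal (2 powr p) * (?S (\<lambda>x. G m x - v x) + ?S (\<lambda>x. v x - f0 x))"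
    using p by (intro S_pow_add_le) auto
  also have "\<dots> \<le> ennreal (2 powr p) * (e' + e')"
    using m n by (intro mult_left_mono add_mono) (auto simp: v_def)
  finally have "?S (\<lambda>x. G m x - f x) < e"
    using e'(2) by simp
  moreover have "C1_closure ?H (G m)"
    unfolding G_def by (rule C1_average_bump_kernel[OF v_cont]) simp
  ultimately show ?thesis
    using G_fin[of m] by blast
qed

lemma mem_S_space:
  fixes f :: "real ^ 'n \<Rightarrow> real"
  assumes p: "1 < p" and f [measurable]: "f \<in> borel_measurable borel"
    and fin: "S_pow p \<beta> \<delta> (half_space k \<delta>) f < top"
  shows "f \<in> S_space p \<beta> \<delta> (half_space k \<delta>)"
proof -
  let ?H = "half_space k \<delta>"
  have "\<exists>g. C1_closure ?H g \<and> S_pow p \<beta> \<delta> ?H g < top \<and> S_pow p \<beta> \<delta> ?H (\<lambda>x. g x - f x) < ennreal (1 / real (Suc n))" for n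
    by (rule S_pow_approx_smooth[OF p f fin]) simp
  then obtain g where g: "\<And>n. C1_closure ?H (g n)" "\<And>n. S_pow p \<beta> \<delta> ?H (g n) < top"
      "\<And>n. S_pow p \<beta> \<delta> ?H (\<lambda>x. g n x - f x) < ennreal (1 / real (Suc n))"
    by metis
  have "(\<lambda>n. 1 / real (Suc n)) \<longlonglongrightarrow> 0"
    using LIMSEQ_inverse_real_of_nat by (simp only: inverse_eq_divide)
  then have "(\<lambda>n. ennreal (1 / real (Suc n))) \<longlonglongrightarrow> ennreal 0"
    by (rule tendsto_ennrealI)
  then have lim: "(\<lambda>n. ennreal (1 / real (Suc n))) \<longlonglongrightarrow> 0"
    by (simp only: ennreal_0)
  have "(\<lambda>n. S_pow p \<beta> \<delta> ?H (\<lambda>x. g n x - f x)) \<longlonglongrightarrow> 0"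
  proof (rule tendsto_sandwich[OF _ _ tendsto_const lim])
    show "\<forall>\<^sub>F n in sequentially. S_pow p \<beta> \<delta> ?H (\<lambda>x. g n x - f x) \<le> ennreal (1 / real (Suc n))"
      using less_imp_le[OF g(3)] by (rule always_eventually[OF allI])
  qed simp
  then have "(\<lambda>n. S_norm p \<beta> \<delta> ?H (\<lambda>x. g n x - f x)) \<longlonglongrightarrow> 0"
    unfolding S_norm_eq[OF borel_half_space] using p by (intro tendsto_ennroot_0) auto
  moreover have "f \<in> borel_measurable (lebesgue_on ?H)"
    by (intro measurable_restrict_space1 measurable_completion) auto
  moreover have "S_norm p \<beta> \<delta> ?H (g n) < top" for n
    using g(2) by (simp add: S_norm_eq ennroot_less_top_iff)
  ultimately show ?thesis
    unfolding S_space_def using g(1) by blast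
qed

subsection \<open>The averaging kernel of the strip\<close>

locale strip_geometry =
  fixes k :: "'n::finite" and \<delta> :: real
  assumes \<delta>_pos: "0 < \<delta>"
begin

text \<open>The height above the hyperplane at level - 2 \<delta>, the length scale at
  \<open>x\<close>. It exceeds \<delta> on the half space and has Lipschitz constant 1, so it is
  comparable at two points at distance less than \<delta>.\<close>

definition lam :: "real ^ 'n \<Rightarrow> real" where
  "lam x = x $ k + 2 * \<delta>"

text \<open>The unnormalised weight. It is Lipschitz in \<open>x\<close>, also through the radius,
  and the factor 4 keeps it above \<open>2 * lam x\<close> on a box of the strip of size comparable
  to \<open>lam x\<close>.\<close>

definition tent :: "real ^ 'n \<Rightarrow> real ^ 'n \<Rightarrow> real" where
  "tent x a = max 0 (4 * lam x - norm (a - x)) * indicator (strip k \<delta>) a"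

definition mass :: "real ^ 'n \<Rightarrow> real" where
  "mass x = (\<integral>a. tent x a \<partial>lborel)"

definition avg_kernel :: "real ^ 'n \<Rightarrow> real ^ 'n \<Rightarrow> real" where
  "avg_kernel x a = tent x a / mass x"

text \<open>The order of magnitude of the volume of the strip near \<open>x\<close>: thickness
  \<delta>, and width \<open>lam x\<close> in the d - 1 directions along it.\<close>

abbreviation vol :: "real ^ 'n \<Rightarrow> real" where
  "vol x \<equiv> \<delta> * lam x ^ (CARD('n) - 1)"

lemma lam_measurable [measurable]: "lam \<in> borel_measurable borel"
  unfolding lam_def by measurable

lemma tent_measurable [measurable]: "case_prod tent \<in> borel_measurable (borel \<Otimes>\<^sub>M borel)"
  unfolding tent_def by measurable

lemma mass_measurable [measurable]: "mass \<in> borel_measurable borel"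
  unfolding mass_def by measurable

lemma avg_kernel_measurable [measurable]: "case_prod avg_kernel \<in> borel_measurable (borel \<Otimes>\<^sub>M borel)"
  unfolding avg_kernel_def by measurable

lemma lam_gt: "x \<in> half_space k \<delta> \<Longrightarrow> \<delta> < lam x"
  by (simp add: half_space_def lam_def)

lemma lam_pos: "x \<in> half_space k \<delta> \<Longrightarrow> 0 < lam x"
  using lam_gt \<delta>_pos by fastforce

lemma lam_diff_le: "\<bar>lam y - lam x\<bar> \<le> norm (y - x)"
  using component_le_norm_cart[of "y - x" k] by (simp add: lam_def)

lemma tent_nonneg: "0 \<le> tent x a"
  by (simp add: tent_def)

lemma prod_slab: "(\<Prod>i\<in>UNIV. if i = k then \<delta> else r) = \<delta> * r ^ (CARD('n) - 1)"
proof -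
  have "(\<Prod>i\<in>UNIV. if i = k then \<delta> else r) = \<delta> * (\<Prod>i\<in>UNIV - {k}. if i = k then \<delta> else r)"
    by (subst prod.remove[of _ k]) auto
  also have "(\<Prod>i\<in>UNIV - {k}. if i = k then \<delta> else r) = (\<Prod>i\<in>UNIV - {k}. r)"
    by (intro prod.cong) auto
  finally show ?thesis
    by (simp add: card_Diff_singleton)
qed

lemma emeasure_slab_box:
  assumes "0 \<le> r"
  shows "emeasure lborel (cbox (\<chi> i. if i = k then - \<delta> else x $ i - r) (\<chi> i. if i = k then 0 else x $ i + r)) =
    ennreal (\<delta> * (2 * r) ^ (CARD('n) - 1))"
    and "emeasure lborel (box (\<chi> i. if i = k then - \<delta> else x $ i - r) (\<chi> i. if i = k then 0 else x $ i + r)) =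
    ennreal (\<delta> * (2 * r) ^ (CARD('n) - 1))"
proof -
  let ?a = "\<chi> i. if i = k then - \<delta> else x $ i - r" and ?b = "\<chi> i. if i = k then 0 else x $ i + r"
  have ne: "cbox ?a ?b \<noteq> {}"
    using assms \<delta>_pos by (auto simp: interval_ne_empty_cart)
  have "measure lborel (cbox ?a ?b) = (\<Prod>i\<in>UNIV. if i = k then \<delta> else 2 * r)"
    unfolding content_cbox_cart[OF ne] by (intro prod.cong) auto
  then have c: "measure lborel (cbox ?a ?b) = \<delta> * (2 * r) ^ (CARD('n) - 1)"
    by (simp add: prod_slab)
  show 1: "emeasure lborel (cbox ?a ?b) = ennreal (\<delta> * (2 * r) ^ (CARD('n) - 1))"
    using c emeasure_lborel_cbox_finite[of ?a ?b] by (simp add: emeasure_eq_ennreal_measure)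
  have "emeasure lborel (box ?a ?b) = emeasure lborel (cbox ?a ?b)"
    by (simp add: emeasure_lborel_box_eq emeasure_lborel_cbox_eq)
  with 1 show "emeasure lborel (box ?a ?b) = ennreal (\<delta> * (2 * r) ^ (CARD('n) - 1))"
    by simp
qed

lemma emeasure_strip_ball_le:
  assumes "0 \<le> r"
  shows "emeasure lborel (strip k \<delta> \<inter> ball x r) \<le> ennreal (\<delta> * (2 * r) ^ (CARD('n) - 1))"
  unfolding emeasure_slab_box(1)[OF assms, of x, symmetric]
proof (rule emeasure_mono)
  show "strip k \<delta> \<inter> ball x r \<subseteq> cbox (\<chi> i. if i = k then - \<delta> else x $ i - r) (\<chi> i. if i = k then 0 else x $ i + r)"
  proof
    fix a assume a: "a \<in> strip k \<delta> \<inter> ball x r"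
    have "\<bar>a $ i - x $ i\<bar> \<le> r" for i
      using component_le_norm_cart[of "a - x" i] a by (simp add: dist_norm norm_minus_commute)
    then have "x $ i - r \<le> a $ i \<and> a $ i \<le> x $ i + r" for i
      by (simp add: abs_le_iff algebra_simps)
    then show "a \<in> cbox (\<chi> i. if i = k then - \<delta> else x $ i - r) (\<chi> i. if i = k then 0 else x $ i + r)"
      using a by (auto simp: mem_box_cart strip_def)
  qed
qed simp

text \<open>The constants of this locale mention neither \<open>k\<close> nor \<open>\<delta>\<close>, so outside of it they depend on the
  index type only; this gives the uniformity in \<open>\<delta>\<close>.\<close>

definition mass_const :: real where
  "mass_const = 2 * (2 / real CARD('n)) ^ (CARD('n) - 1)"

lemma mass_const_pos: "0 < mass_const"
  by (simp add: mass_const_def)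

lemma tent_integrable:
  "integrable lborel (tent x)"
proof (rule integrableI_bounded_set[where A = "strip k \<delta> \<inter> ball x (4 * max 0 (lam x))" and B = "4 * max 0 (lam x)"])
  show "emeasure lborel (strip k \<delta> \<inter> ball x (4 * max 0 (lam x))) < \<infinity>"
    by (rule le_less_trans[OF emeasure_strip_ball_le]) auto
  show "AE a in lborel. a \<in> strip k \<delta> \<inter> ball x (4 * max 0 (lam x)) \<longrightarrow> norm (tent x a) \<le> 4 * max 0 (lam x)"
    by (intro AE_I2) (auto simp: tent_def max_def)
  show "AE a in lborel. a \<notin> strip k \<delta> \<inter> ball x (4 * max 0 (lam x)) \<longrightarrow> tent x a = 0"
    by (intro AE_I2) (auto simp: tent_def max_def dist_norm norm_minus_commute split: split_indicator dest: order_trans[OF norm_ge_zero])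
qed measurable

text \<open>On the box with half width \<open>lam x / d\<close> along the strip, the l1 norm gives
  \<open>norm (a - x) \<le> 2 * lam x\<close>: at most \<open>lam x\<close> from coordinate
  \<open>k\<close>, and at most (d - 1) / d times that from the others. So the tent is at least
  \<open>2 * lam x\<close> there, and the volume of the box supplies the remaining factors of
  \<open>mass_const\<close>.\<close>

lemma mass_ge:
  assumes x: "x \<in> half_space k \<delta>"
  shows "mass_const * (vol x * lam x) \<le> mass x"
proof -
  let ?d = "real CARD('n)" and ?L = "lam x"
  let ?B = "box (\<chi> i. if i = k then - \<delta> else x $ i - ?L / ?d) (\<chi> i. if i = k then 0 else x $ i + ?L / ?d)"
  have L: "0 < ?L" "\<delta> < ?L"
    using x lam_pos lam_gt by auto
  have sub: "2 * ?L * indicator ?B a \<le> tent x a" for a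
  proof (cases "a \<in> ?B")
    case True
    then have comp: "(if i = k then - \<delta> else x $ i - ?L / ?d) < a $ i \<and> a $ i < (if i = k then 0 else x $ i + ?L / ?d)" for i
      by (auto simp: mem_box_cart)
    have ak: "- \<delta> < a $ k" "a $ k < 0"
      using comp[of k] by auto
    have "norm (a - x) \<le> (\<Sum>i\<in>UNIV. \<bar>(a - x) $ i\<bar>)"
      by (rule norm_le_l1_cart)
    also have "\<dots> = \<bar>(a - x) $ k\<bar> + (\<Sum>i\<in>UNIV - {k}. \<bar>(a - x) $ i\<bar>)"
      by (rule sum.remove) auto
    also have "(\<Sum>i\<in>UNIV - {k}. \<bar>(a - x) $ i\<bar>) \<le> (\<Sum>i\<in>UNIV - {k}. ?L / ?d)"
    proof (rule sum_mono)
      fix i assume "i \<in> UNIV - {k}"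
      then have "x $ i - ?L / ?d < a $ i \<and> a $ i < x $ i + ?L / ?d"
        using comp[of i] by simp
      then show "\<bar>(a - x) $ i\<bar> \<le> ?L / ?d"
        by (simp add: abs_le_iff)
    qed
    also have "\<dots> \<le> ?L"
      using L by (simp add: card_Diff_singleton field_simps)
    also have "\<bar>(a - x) $ k\<bar> \<le> ?L"
      using ak x by (auto simp: lam_def half_space_def)
    finally have "norm (a - x) \<le> 2 * ?L"
      by simp
    then show ?thesis
      using True ak by (simp add: tent_def strip_def)
  qed (simp add: tent_nonneg)
  have "emeasure lborel ?B = ennreal (\<delta> * (2 * (?L / ?d)) ^ (CARD('n) - 1))"
    using L by (intro emeasure_slab_box(2)) auto
  then have meas: "measure lborel ?B = \<delta> * (2 * (?L / ?d)) ^ (CARD('n) - 1)" and fin: "emeasure lborel ?B < \<infinity>"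
    using L \<delta>_pos by (simp_all add: measure_def)
  have "mass_const * (vol x * ?L) = 2 * ?L * measure lborel ?B"
    unfolding meas mass_const_def by (simp add: power_mult_distrib power_divide)
  also have "\<dots> = (\<integral>a. 2 * ?L * indicator ?B a \<partial>lborel)"
    by simp
  also have "\<dots> \<le> mass x"
    unfolding mass_def using fin by (intro integral_mono tent_integrable sub) (auto intro!: integrable_mult_right)
  finally show ?thesis .
qed

lemma mass_pos: "x \<in> half_space k \<delta> \<Longrightarrow> 0 < mass x"
  using mass_const_pos \<delta>_pos lam_pos[of x] by (intro less_le_trans[OF _ mass_ge] mult_pos_pos) auto

lemma avg_kernel_nonneg: "x \<in> half_space k \<delta> \<Longrightarrow> 0 \<le> avg_kernel x a"
  using mass_pos[of x] by (simp add: avg_kernel_def tent_nonneg)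

lemma avg_kernel_integral:
  assumes "x \<in> half_space k \<delta>"
  shows "integrable lborel (avg_kernel x)" "(\<integral>a. avg_kernel x a \<partial>lborel) = 1"
    "(\<integral>\<^sup>+a. ennreal (avg_kernel x a) \<partial>lborel) = 1"
proof -
  show 1: "integrable lborel (avg_kernel x)" "(\<integral>a. avg_kernel x a \<partial>lborel) = 1"
    using tent_integrable[of x] mass_pos[OF assms] unfolding avg_kernel_def by (auto simp: mass_def)
  show "(\<integral>\<^sup>+a. ennreal (avg_kernel x a) \<partial>lborel) = 1"
    using 1 avg_kernel_nonneg[OF assms] by (subst nn_integral_eq_integral) auto
qed

lemma avg_kernel_le:
  assumes x: "x \<in> half_space k \<delta>"
  shows "avg_kernel x a \<le> 4 / (mass_const * vol x) * (indicator (strip k \<delta>) a * indicator (ball x (4 * lam x)) a)"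
proof (cases "a \<in> strip k \<delta> \<and> a \<in> ball x (4 * lam x)")
  case True
  have pos: "0 < mass_const * vol x" "0 < lam x"
    using mass_const_pos \<delta>_pos lam_pos[OF x] by auto
  have "avg_kernel x a \<le> 4 * lam x / mass x"
    unfolding avg_kernel_def using mass_pos[OF x] lam_pos[OF x] by (intro divide_right_mono) (auto simp: tent_def split: split_indicator)
  also have "\<dots> \<le> 4 * lam x / (mass_const * (vol x * lam x))"
    using mass_ge[OF x] pos mass_pos[OF x] \<delta>_pos mass_const_pos by (intro divide_left_mono mult_pos_pos) auto
  also have "\<dots> = 4 / (mass_const * vol x)"
    using pos by (simp add: field_simps)
  finally show ?thesis
    using True by simp
next
  case False
  then have "tent x a = 0"
    by (auto simp: tent_def dist_norm norm_minus_commute max_def split: split_indicator)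
  then show ?thesis
    using False by (auto simp: avg_kernel_def)
qed

lemma lam_comparable:
  assumes "x \<in> half_space k \<delta>" "y \<in> half_space k \<delta>" "norm (y - x) < \<delta>"
  shows "lam y \<le> 2 * lam x" "lam x \<le> 2 * lam y"
  using lam_diff_le[of y x] lam_gt[OF assms(1)] lam_gt[OF assms(2)] assms(3) by auto

text \<open>The constant is 4 from the radius plus 1 from the norm. The ball of radius
  \<open>9 * lam x\<close> contains both supports, since \<open>4 * lam y + norm (y - x)\<close> is
  at most (8 + 1) \<open>lam x\<close>.\<close>

lemma tent_diff_le:
  assumes x: "x \<in> half_space k \<delta>" and y: "y \<in> half_space k \<delta>" and xy: "norm (y - x) < \<delta>"
  shows "\<bar>tent y a - tent x a\<bar> \<le> 5 * norm (y - x) * (indicator (strip k \<delta>) a * indicator (ball x (9 * lam x)) a)"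
proof (cases "a \<in> strip k \<delta> \<and> a \<in> ball x (9 * lam x)")
  case True
  have "\<bar>norm (a - y) - norm (a - x)\<bar> \<le> norm (y - x)"
    using norm_triangle_ineq3[of "a - y" "a - x"] by (simp add: norm_minus_commute)
  then have "\<bar>(4 * lam y - norm (a - y)) - (4 * lam x - norm (a - x))\<bar> \<le> 5 * norm (y - x)"
    using lam_diff_le[of y x] by linarith
  then have "\<bar>max 0 (4 * lam y - norm (a - y)) - max 0 (4 * lam x - norm (a - x))\<bar> \<le> 5 * norm (y - x)"
    by (simp add: max_def) linarith
  then show ?thesis
    using True by (simp add: tent_def)
next
  case False
  have "tent x a = 0"
    using False lam_pos[OF x] by (auto simp: tent_def dist_norm norm_minus_commute max_def split: split_indicator)
  moreover have "tent y a = 0"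
  proof (cases "a \<in> strip k \<delta>")
    case True
    then have "9 * lam x \<le> norm (a - x)"
      using False by (simp add: dist_norm norm_minus_commute)
    moreover have "norm (a - x) \<le> norm (a - y) + norm (y - x)"
      using norm_triangle_ineq[of "a - y" "y - x"] by simp
    ultimately have "4 * lam y \<le> norm (a - y)"
      using lam_comparable(1)[OF x y xy] xy lam_gt[OF x] by linarith
    then show ?thesis
      by (simp add: tent_def)
  qed (simp add: tent_def)
  ultimately show ?thesis
    by simp
qed

text \<open>Integrates the previous bound; a ball of radius \<open>9 * lam x\<close> meets the strip
  in volume at most \<open>18 ^ (CARD('n) - 1) * vol x\<close>.\<close>

lemma mass_diff_le:
  assumes x: "x \<in> half_space k \<delta>" and y: "y \<in> half_space k \<delta>" and xy: "norm (y - x) < \<delta>"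
  shows "\<bar>mass y - mass x\<bar> \<le> 5 * norm (y - x) * (18 ^ (CARD('n) - 1) * vol x)"
proof -
  let ?S = "strip k \<delta> \<inter> ball x (9 * lam x)"
  have S: "emeasure lborel ?S \<le> ennreal (18 ^ (CARD('n) - 1) * vol x)"
    using emeasure_strip_ball_le[of "9 * lam x" x] lam_pos[OF x] by (simp add: power_mult_distrib mult_ac)
  then have fin: "emeasure lborel ?S < \<infinity>"
    by (rule le_less_trans) simp
  have meas: "measure lborel ?S \<le> 18 ^ (CARD('n) - 1) * vol x"
    unfolding measure_def using enn2real_mono[OF S] lam_pos[OF x] \<delta>_pos by simp
  have "\<bar>mass y - mass x\<bar> = norm (\<integral>a. tent y a - tent x a \<partial>lborel)"
    unfolding mass_def by (simp add: tent_integrable)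
  also have "\<dots> \<le> (\<integral>a. 5 * norm (y - x) * indicator ?S a \<partial>lborel)"
  proof (rule Bochner_Integration.integral_norm_bound_integral)
    show "integrable lborel (\<lambda>a. 5 * norm (y - x) * indicator ?S a)"
      using fin by (intro integrable_mult_right) auto
    show "norm (tent y a - tent x a) \<le> 5 * norm (y - x) * indicator ?S a" for a
      using tent_diff_le[OF x y xy, of a] by (simp add: indicator_inter_arith)
  qed (auto intro!: Bochner_Integration.integrable_diff tent_integrable)
  also have "\<dots> = 5 * norm (y - x) * measure lborel ?S"
    by simp
  also have "\<dots> \<le> 5 * norm (y - x) * (18 ^ (CARD('n) - 1) * vol x)"
    using meas by (intro mult_left_mono) auto
  finally show ?thesis .
qed

text \<open>The first summand comes from the variation of the tent, the second from that of the
  normalisation: 20 = 4 * 5 and 36 = 2 * 18.\<close>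

definition lip_const :: real where
  "lip_const = 5 / mass_const + 20 * 36 ^ (CARD('n) - 1) / mass_const\<^sup>2"

lemma lip_const_pos: "0 < lip_const"
  unfolding lip_const_def using mass_const_pos by (intro add_pos_pos) auto

lemma avg_kernel_diff_le:
  assumes x: "x \<in> half_space k \<delta>" and y: "y \<in> half_space k \<delta>" and xy: "norm (y - x) < \<delta>"
  shows "\<bar>avg_kernel y a - avg_kernel x a\<bar> \<le>
    lip_const * norm (y - x) / (vol x * lam x) * (indicator (strip k \<delta>) a * indicator (ball x (9 * lam x)) a)"
proof -
  let ?c = mass_const and ?I = "indicator (strip k \<delta>) a * indicator (ball x (9 * lam x)) a :: real"
  let ?e = "CARD('n) - 1"
  have pos: "0 < ?c" "0 < lam x" "0 < lam y" "0 < mass x" "0 < mass y" "0 < vol x" "0 < vol y"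
    using mass_const_pos lam_pos[OF x] lam_pos[OF y] mass_pos[OF x] mass_pos[OF y] \<delta>_pos by auto
  have ky: "avg_kernel y a \<le> 4 * 2 ^ ?e / (?c * vol x) * ?I"
  proof -
    have "lam x ^ ?e \<le> (2 * lam y) ^ ?e"
      using lam_comparable[OF x y xy] pos by (intro power_mono) auto
    then have "\<delta> * lam x ^ ?e \<le> 2 ^ ?e * (\<delta> * lam y ^ ?e)"
      using \<delta>_pos by (simp add: power_mult_distrib mult.left_commute)
    moreover have "4 / (c * v) \<le> 4 * t / (c * u)" if "u \<le> t * v" "0 < c" "0 < u" "0 < v" for c t u v :: real
      using that by (simp add: field_simps)
    ultimately have *: "4 / (?c * vol y) \<le> 4 * 2 ^ ?e / (?c * vol x)"
      using pos by blast
    have sub: "indicator (strip k \<delta>) a * indicator (ball y (4 * lam y)) a \<le> ?I"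
    proof (cases "a \<in> ball y (4 * lam y)")
      case True
      have "norm (a - x) \<le> norm (a - y) + norm (y - x)"
        using norm_triangle_ineq[of "a - y" "y - x"] by simp
      then have "norm (a - x) < 9 * lam x"
        using True lam_comparable[OF x y xy] xy lam_gt[OF x] by (simp add: dist_norm norm_minus_commute)
      then show ?thesis
        by (simp add: dist_norm norm_minus_commute split: split_indicator)
    qed simp
    have "avg_kernel y a \<le> 4 / (?c * vol y) * (indicator (strip k \<delta>) a * indicator (ball y (4 * lam y)) a)"
      by (rule avg_kernel_le[OF y])
    also have "\<dots> \<le> 4 * 2 ^ ?e / (?c * vol x) * ?I"
      using pos by (intro mult_mono[OF * sub]) auto
    finally show ?thesis .
  qed
  \<comment> \<open>The quotient rule in difference form; only \<open>mass x\<close> remains in the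
    denominators, so the result is expressed at \<open>x\<close>.\<close>
  have "avg_kernel y a - avg_kernel x a = avg_kernel y a * ((mass x - mass y) / mass x) + (tent y a - tent x a) / mass x"
    using pos by (simp add: avg_kernel_def field_simps)
  also have "\<bar>\<dots>\<bar> \<le> avg_kernel y a * (\<bar>mass y - mass x\<bar> / mass x) + \<bar>tent y a - tent x a\<bar> / mass x"
    using pos avg_kernel_nonneg[OF y, of a]
    by (intro order_trans[OF abs_triangle_ineq]) (simp add: abs_mult abs_minus_commute)
  also have "\<dots> \<le> (4 * 2 ^ ?e / (?c * vol x) * ?I) * (5 * norm (y - x) * (18 ^ ?e * vol x) / (?c * (vol x * lam x)))
      + 5 * norm (y - x) * ?I / (?c * (vol x * lam x))"
  proof (intro add_mono mult_mono frac_le)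
    show "5 * norm (y - x) * ?I \<ge> 0"
      by simp
  qed (use pos ky mass_diff_le[OF x y xy] tent_diff_le[OF x y xy, of a] mass_ge[OF x] in auto)
  also have "\<dots> = lip_const * norm (y - x) / (vol x * lam x) * ?I"
  proof -
    have "(2::real) ^ ?e * 18 ^ ?e = 36 ^ ?e"
      by (simp add: power_mult_distrib[symmetric])
    then have "(4 * 2 ^ ?e / (?c * v) * i) * (5 * n * (18 ^ ?e * v) / (?c * (v * l))) = 20 * 36 ^ ?e / ?c\<^sup>2 * n / (v * l) * i"
      if "0 < v" "0 < l" for v l n i :: real
      using that pos(1) by (simp add: field_simps power2_eq_square)
    from this[of "vol x" "lam x" ?I "norm (y - x)"] show ?thesis
      using pos by (simp add: lip_const_def add_divide_distrib distrib_left distrib_right)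
  qed
  finally show ?thesis .
qed

lemma avg_kernel_diff_integral_le:
  assumes x: "x \<in> half_space k \<delta>" and y: "y \<in> half_space k \<delta>" and xy: "norm (y - x) < \<delta>"
  shows "(\<integral>\<^sup>+a. ennreal \<bar>avg_kernel y a - avg_kernel x a\<bar> \<partial>lborel) \<le>
    ennreal (lip_const * 18 ^ (CARD('n) - 1) * norm (y - x) / lam x)"
proof -
  let ?S = "strip k \<delta> \<inter> ball x (9 * lam x)"
  have pos: "0 < lip_const" "0 < lam x" "0 < vol x"
    using lip_const_pos lam_pos[OF x] \<delta>_pos by auto
  have "(\<integral>\<^sup>+a. ennreal \<bar>avg_kernel y a - avg_kernel x a\<bar> \<partial>lborel) \<le>
      (\<integral>\<^sup>+a. ennreal (lip_const * norm (y - x) / (vol x * lam x)) * indicator ?S a \<partial>lborel)"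
  proof (rule nn_integral_mono)
    fix a
    have "ennreal (lip_const * norm (y - x) / (vol x * lam x)) * indicator ?S a =
        ennreal (lip_const * norm (y - x) / (vol x * lam x) * (indicator (strip k \<delta>) a * indicator (ball x (9 * lam x)) a))"
      by (auto split: split_indicator)
    then show "ennreal \<bar>avg_kernel y a - avg_kernel x a\<bar> \<le> ennreal (lip_const * norm (y - x) / (vol x * lam x)) * indicator ?S a"
      using avg_kernel_diff_le[OF x y xy, of a] by (simp only: ennreal_leI)
  qed
  also have "\<dots> = ennreal (lip_const * norm (y - x) / (vol x * lam x)) * emeasure lborel ?S"
    by (rule nn_integral_cmult_indicator) measurable
  also have "\<dots> \<le> ennreal (lip_const * norm (y - x) / (vol x * lam x)) * ennreal (18 ^ (CARD('n) - 1) * vol x)"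
    using emeasure_strip_ball_le[of "9 * lam x" x] pos by (intro mult_left_mono) (auto simp: power_mult_distrib mult_ac)
  also have "\<dots> = ennreal (lip_const * 18 ^ (CARD('n) - 1) * norm (y - x) / lam x)"
  proof -
    have "(l * n / (v * m)) * (c * v) = l * c * n / m" if "0 < v" for l n v m c :: real
      using that by simp
    from this[OF pos(3), of lip_const "norm (y - x)" "lam x" "18 ^ (CARD('n) - 1)"] show ?thesis
      using pos by (simp add: ennreal_mult'[symmetric])
  qed
  finally show ?thesis .
qed

end

subsection \<open>Averages of a function on the strip\<close>

lemma powr_minus_divide_eq:
  fixes x y e :: real
  assumes "0 < x" "0 < y"
  shows "(x / y) powr (- e) = y powr e * x powr (- e)"
  using assms by (simp add: powr_divide powr_minus_divide)

lemma nn_integral_cmult2: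
  assumes [measurable]: "case_prod F \<in> borel_measurable (lborel \<Otimes>\<^sub>M lborel)"
  shows "(\<integral>\<^sup>+a. \<integral>\<^sup>+b. c * F a b \<partial>lborel \<partial>lborel) = c * (\<integral>\<^sup>+a. \<integral>\<^sup>+b. F a b \<partial>lborel \<partial>lborel)"
  by (simp add: nn_integral_cmult)

context strip_geometry
begin

definition ext_avg :: "(real ^ 'n \<Rightarrow> real) \<Rightarrow> real ^ 'n \<Rightarrow> real" where
  "ext_avg g x = (\<integral>a. avg_kernel x a * g a \<partial>lborel)"

lemma ext_avg_measurable [measurable]:
  assumes [measurable]: "g \<in> borel_measurable borel"
  shows "ext_avg g \<in> borel_measurable borel"
  unfolding ext_avg_def by measurable

lemma avg_kernel_mult_integrable:
  assumes p: "1 < p" and [measurable]: "g \<in> borel_measurable borel"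
    and fin: "(\<integral>\<^sup>+a. ennreal (\<bar>g a\<bar> powr p) \<partial>lborel) < top" and x: "x \<in> half_space k \<delta>"
  shows "integrable lborel (\<lambda>a. avg_kernel x a * g a)"
proof (rule Bochner_Integration.integrable_bound)
  let ?B = "4 / (mass_const * vol x)"
  have "set_integrable lborel (ball x (4 * lam x)) g"
    using fin by (intro set_integrable_of_nn_integral_powr[OF p]) auto
  then show "integrable lborel (\<lambda>a. ?B * (indicator (ball x (4 * lam x)) a *\<^sub>R g a))"
    unfolding set_integrable_def by (rule integrable_mult_right)
  have B: "0 \<le> ?B"
    using mass_const_pos \<delta>_pos lam_pos[OF x] by simp
  show "AE a in lborel. norm (avg_kernel x a * g a) \<le> norm (?B * (indicator (ball x (4 * lam x)) a *\<^sub>R g a))"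
  proof (rule AE_I2)
    fix a
    have "avg_kernel x a \<le> ?B * (indicator (strip k \<delta>) a * indicator (ball x (4 * lam x)) a)"
      by (rule avg_kernel_le[OF x])
    also have "\<dots> \<le> ?B * indicator (ball x (4 * lam x)) a"
      using B by (intro mult_left_mono) (auto split: split_indicator)
    finally have "avg_kernel x a * \<bar>g a\<bar> \<le> ?B * indicator (ball x (4 * lam x)) a * \<bar>g a\<bar>"
      by (rule mult_right_mono) simp
    then show "norm (avg_kernel x a * g a) \<le> norm (?B * (indicator (ball x (4 * lam x)) a *\<^sub>R g a))"
      using avg_kernel_nonneg[OF x, of a] B by (simp only: norm_mult real_norm_def real_scaleR_def abs_mult mult.assoc abs_of_nonneg) simp
  qed
qed measurable

text \<open>The kernel has integral 1, so averaging reproduces the constant \<open>c\<close>; then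
  Jensen.\<close>

lemma ext_avg_minus_powr_le:
  assumes p: "1 < p" and [measurable]: "g \<in> borel_measurable borel"
    and fin: "(\<integral>\<^sup>+a. ennreal (\<bar>g a\<bar> powr p) \<partial>lborel) < top" and x: "x \<in> half_space k \<delta>"
  shows "ennreal (\<bar>ext_avg g x - c\<bar> powr p) \<le> (\<integral>\<^sup>+a. ennreal (avg_kernel x a * \<bar>g a - c\<bar> powr p) \<partial>lborel)"
proof -
  have "ext_avg g x - c = (\<integral>a. avg_kernel x a * (g a - c) \<partial>lborel)"
    using avg_kernel_mult_integrable[OF assms] avg_kernel_integral[OF x]
    by (simp add: ext_avg_def right_diff_distrib)
  also have "ennreal (\<bar>\<dots>\<bar> powr p) \<le> ennreal (1 powr (p - 1)) * (\<integral>\<^sup>+a. ennreal (avg_kernel x a * \<bar>g a - c\<bar> powr p) \<partial>lborel)"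
    using p avg_kernel_nonneg[OF x] avg_kernel_integral(3)[OF x] by (intro weighted_jensen_powr) auto
  finally show ?thesis
    by simp
qed

text \<open>The radius is that of \<open>tent_diff_le\<close>: one patch serves the kernels of
  \<open>x\<close> and of all \<open>y\<close> in the half space at distance less than
  \<delta>.\<close>

definition patch :: "real ^ 'n \<Rightarrow> real ^ 'n \<Rightarrow> real" where
  "patch x a = indicator (strip k \<delta>) a * indicator (ball x (9 * lam x)) a"

lemma patch_nonneg: "0 \<le> patch x a"
  by (simp add: patch_def)

lemma patch_eq: "patch x a = indicator (strip k \<delta>) a * indicator {0<..} (9 * lam x - norm (a - x))"
  by (auto simp: patch_def dist_norm norm_minus_commute split: split_indicator)

lemma patch_measurable [measurable]: "case_prod patch \<in> borel_measurable (borel \<Otimes>\<^sub>M borel)"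
  unfolding patch_eq by measurable

definition patch_energy :: "real \<Rightarrow> (real ^ 'n \<Rightarrow> real) \<Rightarrow> real ^ 'n \<Rightarrow> ennreal" where
  "patch_energy p g x = (\<integral>\<^sup>+a. \<integral>\<^sup>+b. ennreal (patch x a * patch x b * \<bar>g b - g a\<bar> powr p) \<partial>lborel \<partial>lborel)"

definition diff_const :: "real \<Rightarrow> real" where
  "diff_const p = (lip_const * 18 ^ (CARD('n) - 1)) powr (p - 1) * lip_const * (4 / mass_const)"

lemma diff_const_pos: "0 < diff_const p"
  unfolding diff_const_def using lip_const_pos mass_const_pos by simp

text \<open>Both kernels integrate to 1, so the constant \<open>ext_avg g x\<close> may be
  subtracted from \<open>g\<close> under the difference of kernels. Jensen with the weight
  \<bar>?D\<bar>, of mass at most \<open>A\<close>, and again for \<open>g a - ext_avg g x\<close>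
  leaves pairs in the patch. The factors are \<open>A powr (p - 1) * c1\<close>, of order norm (y -
  x)^p lam^(-p) / vol, and \<open>c2\<close>, of order 1 / vol.\<close>

lemma ext_avg_diff_powr_le:
  assumes p: "1 < p" and [measurable]: "g \<in> borel_measurable borel"
    and fin: "(\<integral>\<^sup>+a. ennreal (\<bar>g a\<bar> powr p) \<partial>lborel) < top"
    and x: "x \<in> half_space k \<delta>" and y: "y \<in> half_space k \<delta>" and xy: "norm (y - x) < \<delta>"
  shows "ennreal (\<bar>ext_avg g y - ext_avg g x\<bar> powr p) \<le>
    ennreal (diff_const p * norm (y - x) powr p * (lam x powr (- p) / (vol x)\<^sup>2)) * patch_energy p g x"
proof (cases "y = x")
  case True
  then show ?thesis
    using p by simp
next
  case False
  let ?n = "norm (y - x)" and ?L = "lam x"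
  let ?D = "\<lambda>a. avg_kernel y a - avg_kernel x a"
  define A where "A = lip_const * 18 ^ (CARD('n) - 1) * ?n / ?L"
  define c1 where "c1 = lip_const * ?n / (vol x * ?L)"
  define c2 where "c2 = 4 / (mass_const * vol x)"
  have pos: "0 < ?n" "0 < ?L" "0 < vol x" "0 < lip_const" "0 < mass_const"
    using False lam_pos[OF x] \<delta>_pos lip_const_pos mass_const_pos by auto
  have A: "0 < A" and c1: "0 < c1" and c2: "0 < c2"
    using pos unfolding A_def c1_def c2_def by auto
  note int = avg_kernel_mult_integrable[OF p assms(2) fin]
  have "ext_avg g y - ext_avg g x = (\<integral>a. ?D a * (g a - ext_avg g x) \<partial>lborel)"
    using int[OF x] int[OF y] avg_kernel_integral[OF x] avg_kernel_integral[OF y]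
    by (simp add: ext_avg_def left_diff_distrib right_diff_distrib)
  \<comment> \<open>Jensen wants a nonnegative weight, so the sign goes into the averaged
    function.\<close>
  also have "\<dots> = (\<integral>a. \<bar>?D a\<bar> * (sgn (?D a) * (g a - ext_avg g x)) \<partial>lborel)"
    by (simp only: mult.assoc[symmetric] abs_mult_sgn)
  finally have eq: "ext_avg g y - ext_avg g x = (\<integral>a. \<bar>?D a\<bar> * (sgn (?D a) * (g a - ext_avg g x)) \<partial>lborel)" .
  have first: "ennreal (\<bar>ext_avg g y - ext_avg g x\<bar> powr p) \<le> ennreal (A powr (p - 1)) *
      (\<integral>\<^sup>+a. ennreal (\<bar>?D a\<bar> * \<bar>sgn (?D a) * (g a - ext_avg g x)\<bar> powr p) \<partial>lborel)"
    unfolding eq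
  proof (rule weighted_jensen_powr[OF p A])
    show "(\<integral>\<^sup>+a. ennreal \<bar>?D a\<bar> \<partial>lborel) \<le> ennreal A"
      unfolding A_def by (rule avg_kernel_diff_integral_le[OF x y xy])
    show "(\<lambda>a. \<bar>?D a\<bar>) \<in> borel_measurable lborel"
      by measurable
    have "?D \<in> borel_measurable lborel"
      by measurable
    then have "(\<lambda>a. sgn (?D a)) \<in> borel_measurable lborel"
      by (rule measurable_compose[OF _ borel_measurable_sgn])
    then show "(\<lambda>a. sgn (?D a) * (g a - ext_avg g x)) \<in> borel_measurable lborel"
      by (rule borel_measurable_times) measurable
  qed simp
  have "(\<integral>\<^sup>+a. ennreal (\<bar>?D a\<bar> * \<bar>sgn (?D a) * (g a - ext_avg g x)\<bar> powr p) \<partial>lborel) \<le>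
      (\<integral>\<^sup>+a. (\<integral>\<^sup>+b. ennreal (c1 * c2) * ennreal (patch x a * patch x b * \<bar>g b - g a\<bar> powr p) \<partial>lborel) \<partial>lborel)"
  proof (rule nn_integral_mono)
    fix a
    have "\<bar>sgn (?D a) * (g a - ext_avg g x)\<bar> \<le> \<bar>ext_avg g x - g a\<bar>"
      by (simp add: abs_mult sgn_if abs_minus_commute)
    then have "ennreal (\<bar>?D a\<bar> * \<bar>sgn (?D a) * (g a - ext_avg g x)\<bar> powr p) \<le> ennreal (\<bar>?D a\<bar> * \<bar>ext_avg g x - g a\<bar> powr p)"
      using p by (intro ennreal_leI mult_left_mono powr_mono2) auto
    also have "\<dots> = ennreal \<bar>?D a\<bar> * ennreal (\<bar>ext_avg g x - g a\<bar> powr p)"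
      by (simp add: ennreal_mult)
    also have "\<dots> \<le> ennreal (c1 * patch x a) * (\<integral>\<^sup>+b. ennreal (avg_kernel x b * \<bar>g b - g a\<bar> powr p) \<partial>lborel)"
      using avg_kernel_diff_le[OF x y xy, of a]
      by (intro mult_mono ext_avg_minus_powr_le[OF p assms(2) fin x] ennreal_leI) (auto simp: c1_def patch_def)
    also have "\<dots> = (\<integral>\<^sup>+b. ennreal (c1 * patch x a) * ennreal (avg_kernel x b * \<bar>g b - g a\<bar> powr p) \<partial>lborel)"
      by (rule nn_integral_cmult[symmetric]) measurable
    also have "\<dots> \<le> (\<integral>\<^sup>+b. ennreal (c1 * c2) * ennreal (patch x a * patch x b * \<bar>g b - g a\<bar> powr p) \<partial>lborel)"
    proof (rule nn_integral_mono)
      fix b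
      have "avg_kernel x b \<le> c2 * (indicator (strip k \<delta>) b * indicator (ball x (4 * lam x)) b)"
        unfolding c2_def by (rule avg_kernel_le[OF x])
      also have "\<dots> \<le> c2 * patch x b"
        using c2 pos by (intro mult_left_mono) (auto simp: patch_def split: split_indicator)
      finally have "c1 * patch x a * (avg_kernel x b * \<bar>g b - g a\<bar> powr p) \<le> c1 * patch x a * (c2 * patch x b * \<bar>g b - g a\<bar> powr p)"
        using c1 patch_nonneg by (intro mult_left_mono mult_right_mono mult_nonneg_nonneg) auto
      also have "\<dots> = c1 * c2 * (patch x a * patch x b * \<bar>g b - g a\<bar> powr p)"
        by (simp add: mult_ac)
      finally show "ennreal (c1 * patch x a) * ennreal (avg_kernel x b * \<bar>g b - g a\<bar> powr p) \<le>
          ennreal (c1 * c2) * ennreal (patch x a * patch x b * \<bar>g b - g a\<bar> powr p)"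
        using c1 c2 patch_nonneg avg_kernel_nonneg[OF x]
        by (simp add: ennreal_mult'[symmetric] ennreal_leI)
    qed
    finally show "ennreal (\<bar>?D a\<bar> * \<bar>sgn (?D a) * (g a - ext_avg g x)\<bar> powr p) \<le>
      (\<integral>\<^sup>+b. ennreal (c1 * c2) * ennreal (patch x a * patch x b * \<bar>g b - g a\<bar> powr p) \<partial>lborel)" .
  qed
  also have "\<dots> = (\<integral>\<^sup>+a. ennreal (c1 * c2) * (\<integral>\<^sup>+b. ennreal (patch x a * patch x b * \<bar>g b - g a\<bar> powr p) \<partial>lborel) \<partial>lborel)"
    by (intro nn_integral_cong nn_integral_cmult) measurable
  also have "\<dots> = ennreal (c1 * c2) * patch_energy p g x"
    unfolding patch_energy_def by (intro nn_integral_cmult) measurable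
  finally have second: "(\<integral>\<^sup>+a. ennreal (\<bar>?D a\<bar> * \<bar>sgn (?D a) * (g a - ext_avg g x)\<bar> powr p) \<partial>lborel) \<le>
      ennreal (c1 * c2) * patch_energy p g x" .
  have "ennreal (\<bar>ext_avg g y - ext_avg g x\<bar> powr p) \<le> ennreal (A powr (p - 1)) * (ennreal (c1 * c2) * patch_energy p g x)"
    by (rule order_trans[OF first mult_left_mono[OF second]]) simp
  also have "\<dots> = ennreal (A powr (p - 1) * (c1 * c2)) * patch_energy p g x"
    by (subst ennreal_mult') (auto simp: mult.assoc)
  also have "A powr (p - 1) * (c1 * c2) = diff_const p * ?n powr p * (?L powr (- p) / (vol x)\<^sup>2)"
  proof -
    have A: "A powr (p - 1) = (lip_const * 18 ^ (CARD('n) - 1)) powr (p - 1) * ?n powr (p - 1) / ?L powr (p - 1)"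
      using pos unfolding A_def by (simp add: powr_mult powr_divide)
    have N: "?n powr p = ?n powr (p - 1) * ?n" and L: "?L powr (- p) = 1 / (?L powr (p - 1) * ?L)"
      using powr_add[of ?n "p - 1" 1] powr_add[of ?L "p - 1" 1] pos by (simp_all add: powr_minus_divide)
    have "B * n1 / L1 * (l * n / (v * L) * (4 / (c * v))) = (B * l * (4 / c)) * (n1 * n) * (1 / (L1 * L) / v\<^sup>2)"
      for B n1 L1 l n v L c :: real
      by (simp add: power2_eq_square mult_ac)
    then show ?thesis
      unfolding A N L c1_def c2_def diff_const_def .
  qed
  finally show ?thesis .
qed

text \<open>The norm of \<open>x - base_point a\<close> is comparable to \<open>lam x\<close>, which turns powers of \<open>lam\<close> into radial
  functions.\<close>

definition base_point :: "real ^ 'n \<Rightarrow> real ^ 'n" where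
  "base_point a = (\<chi> i. if i = k then - 2 * \<delta> else a $ i)"

text \<open>The k-th component of \<open>x - base_point a\<close> is exactly \<open>lam x\<close>.
  In the upper bound 11 is 9 from \<open>a - x\<close> plus 2 from \<open>a - base_point a\<close>,
  as \<delta> is below \<open>lam x\<close>.\<close>

lemma base_point_bounds:
  assumes "x \<in> half_space k \<delta>" "a \<in> strip k \<delta>" "norm (a - x) < 9 * lam x"
  shows "lam x \<le> norm (x - base_point a)" "norm (x - base_point a) \<le> 11 * lam x"
proof -
  show "lam x \<le> norm (x - base_point a)"
    using component_le_norm_cart[of "x - base_point a" k] by (simp add: lam_def base_point_def)
  have "a - base_point a = (a $ k + 2 * \<delta>) *\<^sub>R axis k 1"
    by (simp add: vec_eq_iff base_point_def axis_def)
  then have "norm (a - base_point a) = \<bar>a $ k + 2 * \<delta>\<bar>"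
    by (simp add: norm_axis_1)
  also have "\<dots> \<le> 2 * \<delta>"
    using assms(2) by (auto simp: strip_def)
  finally show "norm (x - base_point a) \<le> 11 * lam x"
    using norm_triangle_ineq[of "x - a" "a - base_point a"] assms(3) lam_gt[OF assms(1)]
    by (simp add: norm_minus_commute)
qed

section \<open>From averages in the half space to the trace seminorm\<close>

text \<open>The trace kernel with the minimum replaced by \<delta>; the powers of \<delta> then
  combine to the exponent - 2 and \<beta> disappears.\<close>

definition far_density :: "real \<Rightarrow> real ^ 'n \<Rightarrow> real" where
  "far_density p z = \<delta> powr (- 2) * max (norm z) \<delta> powr (- (real CARD('n) + p - 2))"

lemma far_density_measurable [measurable]: "far_density p \<in> borel_measurable borel"
  unfolding far_density_def by measurable

lemma far_density_nonneg: "0 \<le> far_density p z"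
  by (simp add: far_density_def)

definition far_const :: "real \<Rightarrow> real" where
  "far_const p = 11 powr (p + 2 * real CARD('n) - 2) * sphere_area CARD('n) *
     18 powr (real CARD('n) + p - 2) / (real CARD('n) + p - 2)"

lemma card_ge_1: "1 \<le> real CARD('n)"
  using zero_less_card_finite[where 'a = 'n] by linarith

lemma sphere_area_pos: "0 < sphere_area CARD('n)"
  unfolding sphere_area_def by simp

lemma exponent_pos: "1 < p \<Longrightarrow> 0 < real CARD('n) + p - 2"
  using card_ge_1 by linarith

lemma far_const_pos: "1 < p \<Longrightarrow> 0 < far_const p"
  unfolding far_const_def using exponent_pos sphere_area_pos by (intro divide_pos_pos mult_pos_pos) auto

text \<open>If the patch of \<open>x\<close> contains both points, then norm (b - a) <
  \<open>18 * lam x\<close>, and also \<delta> < \<open>lam x\<close>; hence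
  \<open>m \<le> lam x\<close>. The weight equals \<delta>^(-2) lam^(-q), and
  \<open>base_point\<close> turns this into a radial power, integrated outside the ball of radius
  \<open>m\<close>. The exponent d - q is -(d + p - 2).\<close>

lemma patch_integral_le:
  assumes p: "1 < p" and a: "a \<in> strip k \<delta>" and b: "b \<in> strip k \<delta>"
  shows "(\<integral>\<^sup>+x. ennreal (lam x powr (- p) / (vol x)\<^sup>2 * (patch x a * patch x b)) * indicator (half_space k \<delta>) x \<partial>lborel) \<le>
    ennreal (far_const p * far_density p (b - a))"
proof -
  let ?d = "real CARD('n)"
  define q where "q = p + 2 * ?d - 2"
  define m where "m = max (norm (b - a)) \<delta> / 18"
  define c where "c = 11 powr q * \<delta> powr (- 2)"
  have q: "?d < q" "q - ?d = ?d + p - 2" "0 < q"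
    unfolding q_def using p card_ge_1 by linarith+
  have m: "0 < m"
    using \<delta>_pos by (simp add: m_def)
  have "(\<integral>\<^sup>+x. ennreal (lam x powr (- p) / (vol x)\<^sup>2 * (patch x a * patch x b)) * indicator (half_space k \<delta>) x \<partial>lborel) \<le>
      (\<integral>\<^sup>+x. ennreal c * (ennreal (norm (x + - base_point a) powr (- q)) * indicator {m..} (norm (x + - base_point a))) \<partial>lborel)"
  proof (rule nn_integral_mono)
    fix x
    let ?z = "norm (x - base_point a)"
    show "ennreal (lam x powr (- p) / (vol x)\<^sup>2 * (patch x a * patch x b)) * indicator (half_space k \<delta>) x \<le>
      ennreal c * (ennreal (norm (x + - base_point a) powr (- q)) * indicator {m..} (norm (x + - base_point a)))"
    proof (cases "x \<in> half_space k \<delta> \<and> norm (a - x) < 9 * lam x \<and> norm (b - x) < 9 * lam x")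
      case False
      then have "indicator (half_space k \<delta>) x = (0::ennreal) \<or> patch x a * patch x b = 0"
        by (auto simp: patch_eq)
      then show ?thesis
        by auto
    next
      case True
      then have x: "x \<in> half_space k \<delta>" and ax: "norm (a - x) < 9 * lam x" and bx: "norm (b - x) < 9 * lam x"
        by auto
      note z = base_point_bounds[OF x a ax]
      have L: "0 < lam x"
        by (rule lam_pos[OF x])
      have "norm (b - a) \<le> norm (b - x) + norm (a - x)"
        using norm_triangle_ineq[of "b - x" "x - a"] by (simp add: norm_minus_commute)
      then have "m \<le> lam x"
        using ax bx lam_gt[OF x] L \<delta>_pos by (auto simp: m_def max_def)
      then have mz: "m \<le> ?z"
        using z by simp
      have W: "lam x powr (- p) / (vol x)\<^sup>2 = \<delta> powr (- 2) * lam x powr (- q)"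
      proof -
        have "lam x ^ (CARD('n) - 1) = lam x powr (?d - 1)"
          using L card_ge_1 powr_realpow[OF L, of "CARD('n) - 1"] by (simp add: of_nat_diff)
        then have "lam x ^ (CARD('n) - 1) * lam x ^ (CARD('n) - 1) = lam x powr (?d - 1 + (?d - 1))"
          by (simp only: powr_add)
        also have "?d - 1 + (?d - 1) = 2 * ?d - 2"
          by simp
        finally have "lam x ^ (CARD('n) - 1) * lam x ^ (CARD('n) - 1) = lam x powr (2 * ?d - 2)" .
        moreover have "(vol x)\<^sup>2 = \<delta>\<^sup>2 * (lam x ^ (CARD('n) - 1) * lam x ^ (CARD('n) - 1))"
          by (simp only: power2_eq_square mult_ac)
        moreover have "\<delta> powr 2 = \<delta>\<^sup>2"
          using \<delta>_pos by simp
        ultimately have sq: "(vol x)\<^sup>2 = \<delta> powr 2 * lam x powr (2 * ?d - 2)"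
          by (simp only:)
        have "lam x powr (- q) = lam x powr (- p - (2 * ?d - 2))"
          by (rule arg_cong[where f = "\<lambda>t. lam x powr t"]) (simp add: q_def)
        then have "lam x powr (- q) = lam x powr (- p) / lam x powr (2 * ?d - 2)"
          by (simp only: powr_diff)
        then show ?thesis
          unfolding sq by (simp add: powr_minus_divide)
      qed
      have "lam x powr (- q) \<le> (?z / 11) powr (- q)"
        using z L q mz m by (intro powr_mono2') auto
      also have "(?z / 11) powr (- q) = 11 powr q * ?z powr (- q)"
        using mz m by (intro powr_minus_divide_eq) auto
      finally have main: "lam x powr (- p) / (vol x)\<^sup>2 \<le> c * ?z powr (- q)"
        unfolding W c_def by (simp add: mult.assoc mult.left_commute mult_left_mono)
      have "lam x powr (- p) / (vol x)\<^sup>2 * (patch x a * patch x b) \<le> lam x powr (- p) / (vol x)\<^sup>2"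
        by (intro mult_right_le_one_le) (auto simp: patch_def split: split_indicator)
      then have "ennreal (lam x powr (- p) / (vol x)\<^sup>2 * (patch x a * patch x b)) \<le> ennreal (c * ?z powr (- q))"
        using main by (intro ennreal_leI) (rule order_trans)
      also have "\<dots> = ennreal c * ennreal (?z powr (- q))"
        by (rule ennreal_mult') (simp add: c_def)
      finally show ?thesis
        using x mz by simp
    qed
  qed
  also have "\<dots> = (\<integral>\<^sup>+z. ennreal c * (ennreal (norm (z :: real ^ 'n) powr (- q)) * indicator {m..} (norm z)) \<partial>lborel)"
    by (rule nn_integral_lborel_translate) measurable
  also have "\<dots> = ennreal c * (\<integral>\<^sup>+z. ennreal (norm (z :: real ^ 'n) powr (- q)) * indicator {m..} (norm z) \<partial>lborel)"
    by (rule nn_integral_cmult) measurable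
  also have "\<dots> = ennreal c * ennreal (sphere_area CARD('n) * m powr (?d - q) / (q - ?d))"
  proof -
    have "real DIM(real ^ 'n) < q"
      using q(1) by simp
    from nn_integral_norm_powr_outside_ball[OF this m] show ?thesis
      by (simp add: sphere_area_def)
  qed
  also have "\<dots> = ennreal (c * (sphere_area CARD('n) * m powr (?d - q) / (q - ?d)))"
    by (rule ennreal_mult'[symmetric]) (simp add: c_def)
  also have "m powr (?d - q) = 18 powr (?d + p - 2) * max (norm (b - a)) \<delta> powr (- (?d + p - 2))"
  proof -
    have "m powr (?d - q) = m powr (- (?d + p - 2))"
      by (rule arg_cong[where f = "\<lambda>t. m powr t"]) (simp add: q_def)
    also have "\<dots> = 18 powr (?d + p - 2) * max (norm (b - a)) \<delta> powr (- (?d + p - 2))"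
      unfolding m_def using \<delta>_pos by (intro powr_minus_divide_eq) auto
    finally show ?thesis .
  qed
  also have "c * (sphere_area CARD('n) * (18 powr (?d + p - 2) * max (norm (b - a)) \<delta> powr (- (?d + p - 2))) / (q - ?d)) =
      far_const p * far_density p (b - a)"
    unfolding far_const_def far_density_def c_def q(2) by (simp add: q_def mult_ac)
  finally show ?thesis .
qed

definition far_energy :: "real \<Rightarrow> (real ^ 'n \<Rightarrow> real) \<Rightarrow> ennreal" where
  "far_energy p g = (\<integral>\<^sup>+a. (\<integral>\<^sup>+b. ennreal (far_density p (b - a) * \<bar>g b - g a\<bar> powr p) * indicator (strip k \<delta>) b \<partial>lborel)
     * indicator (strip k \<delta>) a \<partial>lborel)"

text \<open>Tonelli moves the integral over \<open>x\<close> innermost, so that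
  \<open>patch_integral_le\<close> applies to each fixed pair.\<close>

lemma patch_energy_integral_le:
  assumes p: "1 < p" and [measurable]: "g \<in> borel_measurable borel"
  shows "(\<integral>\<^sup>+x. ennreal (lam x powr (- p) / (vol x)\<^sup>2) * patch_energy p g x * indicator (half_space k \<delta>) x \<partial>lborel) \<le>
    ennreal (far_const p) * far_energy p g"
proof -
  let ?W = "\<lambda>x. lam x powr (- p) / (vol x)\<^sup>2"
  let ?H = "half_space k \<delta>" and ?V = "strip k \<delta>"
  let ?F = "\<lambda>x a b. ennreal (?W x * (patch x a * patch x b)) * indicator ?H x * ennreal (\<bar>g b - g a\<bar> powr p)"
  have "(\<integral>\<^sup>+x. ennreal (?W x) * patch_energy p g x * indicator ?H x \<partial>lborel) = (\<integral>\<^sup>+x. \<integral>\<^sup>+a. \<integral>\<^sup>+b. ?F x a b \<partial>lborel \<partial>lborel \<partial>lborel)"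
  proof (rule nn_integral_cong)
    fix x
    have "ennreal (?W x) * patch_energy p g x * indicator ?H x =
        (\<integral>\<^sup>+a. \<integral>\<^sup>+b. (ennreal (?W x) * indicator ?H x) * ennreal (patch x a * patch x b * \<bar>g b - g a\<bar> powr p) \<partial>lborel \<partial>lborel)"
      unfolding patch_energy_def by (subst nn_integral_cmult2) (measurable, simp only: mult_ac)
    also have "\<dots> = (\<integral>\<^sup>+a. \<integral>\<^sup>+b. ?F x a b \<partial>lborel \<partial>lborel)"
    proof (intro nn_integral_cong)
      fix a b
      have "ennreal (w * (r * s)) * i * ennreal t = (ennreal w * i) * ennreal (r * s * t)"
        if "0 \<le> w" "0 \<le> r" "0 \<le> s" "0 \<le> t" for w r s t :: real and i :: ennreal
        using that by (simp add: ennreal_mult mult_ac)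
      then show "(ennreal (?W x) * indicator ?H x) * ennreal (patch x a * patch x b * \<bar>g b - g a\<bar> powr p) = ?F x a b"
        by (simp only: patch_nonneg powr_ge_zero divide_nonneg_nonneg zero_le_power2)
    qed
    finally show "ennreal (?W x) * patch_energy p g x * indicator ?H x = (\<integral>\<^sup>+a. \<integral>\<^sup>+b. ?F x a b \<partial>lborel \<partial>lborel)" .
  qed
  also have "\<dots> = (\<integral>\<^sup>+a. \<integral>\<^sup>+x. \<integral>\<^sup>+b. ?F x a b \<partial>lborel \<partial>lborel \<partial>lborel)"
    by (rule lborel_pair.Fubini') measurable
  also have "\<dots> = (\<integral>\<^sup>+a. \<integral>\<^sup>+b. \<integral>\<^sup>+x. ?F x a b \<partial>lborel \<partial>lborel \<partial>lborel)"
    by (intro nn_integral_cong lborel_pair.Fubini') measurable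
  also have "\<dots> \<le> (\<integral>\<^sup>+a. \<integral>\<^sup>+b. ennreal (far_const p) * (ennreal (far_density p (b - a) * \<bar>g b - g a\<bar> powr p) * indicator ?V b * indicator ?V a) \<partial>lborel \<partial>lborel)"
  proof (intro nn_integral_mono)
    fix a b
    have "(\<integral>\<^sup>+x. ?F x a b \<partial>lborel) = (\<integral>\<^sup>+x. ennreal (?W x * (patch x a * patch x b)) * indicator ?H x \<partial>lborel) * ennreal (\<bar>g b - g a\<bar> powr p)"
      by (rule nn_integral_multc) measurable
    also have "\<dots> \<le> ennreal (far_const p) * (ennreal (far_density p (b - a) * \<bar>g b - g a\<bar> powr p) * indicator ?V b * indicator ?V a)"
    proof (cases "a \<in> ?V \<and> b \<in> ?V")
      case True
      then have "(\<integral>\<^sup>+x. ennreal (?W x * (patch x a * patch x b)) * indicator ?H x \<partial>lborel) * ennreal (\<bar>g b - g a\<bar> powr p)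
          \<le> ennreal (far_const p * far_density p (b - a)) * ennreal (\<bar>g b - g a\<bar> powr p)"
        using patch_integral_le[OF p, of a b] by (intro mult_right_mono) auto
      then show ?thesis
        using True far_const_pos[OF p] far_density_nonneg by (simp add: ennreal_mult mult_ac)
    next
      case False
      then have zero: "patch x a * patch x b = 0" for x
        by (auto simp: patch_def)
      show ?thesis
        by (simp only: zero) simp
    qed
    finally show "(\<integral>\<^sup>+x. ?F x a b \<partial>lborel) \<le> ennreal (far_const p) * (ennreal (far_density p (b - a) * \<bar>g b - g a\<bar> powr p) * indicator ?V b * indicator ?V a)" .
  qed
  also have "\<dots> = ennreal (far_const p) * far_energy p g"
    unfolding far_energy_def by (simp add: nn_integral_cmult nn_integral_multc)
  finally show ?thesis .
qed

section \<open>The L^p norm of the average up to height 2 M\<close>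

definition Lp_const :: real where
  "Lp_const = 4 / mass_const * 11 ^ (CARD('n) - 1) * sphere_area CARD('n) * 44"

lemma Lp_const_pos: "0 < Lp_const"
  unfolding Lp_const_def using mass_const_pos sphere_area_pos by simp

text \<open>The kernel is at most of order 1 / (\<delta> lam^(d-1)), that is, of the radial power 1
  - d around \<open>base_point b\<close> divided by \<delta>, whose integral over a ball grows like
  its radius. Heights below 2 M give \<open>lam x < 4 * M\<close>, hence the radius 44 M = 11 * 4 M.
  The quotient by \<delta> is the weight of the L^p part of the T norm.\<close>

lemma avg_kernel_column_integral_le:
  assumes b: "b \<in> strip k \<delta>" and M: "\<delta> < M"
  shows "(\<integral>\<^sup>+x. ennreal (avg_kernel x b) * indicator (half_space k \<delta> \<inter> {x. x $ k < 2 * M}) x \<partial>lborel) \<le>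
    ennreal (Lp_const * M / \<delta>)"
proof -
  let ?d = "real CARD('n)" and ?U = "half_space k \<delta> \<inter> {x. x $ k < 2 * M}"
  define \<alpha> where "\<alpha> = 1 - ?d"
  define c where "c = 4 / (mass_const * \<delta>) * 11 ^ (CARD('n) - 1)"
  have c: "0 < c"
    using mass_const_pos \<delta>_pos by (simp add: c_def)
  have "(\<integral>\<^sup>+x. ennreal (avg_kernel x b) * indicator ?U x \<partial>lborel) \<le>
      (\<integral>\<^sup>+x. ennreal c * (ennreal (norm (x + - base_point b) powr \<alpha>) * indicator {..<44 * M} (norm (x + - base_point b))) \<partial>lborel)"
  proof (rule nn_integral_mono)
    fix x
    let ?z = "norm (x - base_point b)"
    show "ennreal (avg_kernel x b) * indicator ?U x \<le>
      ennreal c * (ennreal (norm (x + - base_point b) powr \<alpha>) * indicator {..<44 * M} (norm (x + - base_point b)))"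
    proof (cases "x \<in> ?U \<and> norm (b - x) < 4 * lam x")
      case False
      then have "x \<notin> ?U \<or> avg_kernel x b \<le> 0"
        using avg_kernel_le[of x b] by (cases "x \<in> ?U") (auto simp: dist_norm norm_minus_commute split: split_indicator_asm)
      then show ?thesis
        by (auto simp: ennreal_neg)
    next
      case True
      then have x: "x \<in> half_space k \<delta>" and xM: "x $ k < 2 * M" and bx: "norm (b - x) < 4 * lam x"
        by auto
      have L: "0 < lam x"
        by (rule lam_pos[OF x])
      note z = base_point_bounds[OF x b]
      have z1: "lam x \<le> ?z" "?z \<le> 11 * lam x"
        using z bx L by auto
      have "lam x < 4 * M"
        using xM M by (simp add: lam_def)
      then have zM: "?z < 44 * M"
        using z1 by simp
      have pow: "r ^ (CARD('n) - 1) = r powr (- \<alpha>)" if "0 < r" for r :: real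
        using that card_ge_1 powr_realpow[OF that, of "CARD('n) - 1"] by (simp add: of_nat_diff \<alpha>_def)
      have "avg_kernel x b \<le> 4 / (mass_const * vol x) * (indicator (strip k \<delta>) b * indicator (ball x (4 * lam x)) b)"
        by (rule avg_kernel_le[OF x])
      also have "\<dots> = 4 / (mass_const * \<delta>) * (1 / lam x ^ (CARD('n) - 1))"
        using b bx by (simp add: dist_norm norm_minus_commute)
      also have "\<dots> \<le> 4 / (mass_const * \<delta>) * (1 / (?z / 11) ^ (CARD('n) - 1))"
        using mass_const_pos \<delta>_pos z1 L by (intro mult_left_mono divide_left_mono power_mono mult_pos_pos zero_less_power) auto
      also have "\<dots> = c * (1 / ?z ^ (CARD('n) - 1))"
        by (simp add: c_def power_divide)
      also have "1 / ?z ^ (CARD('n) - 1) = ?z powr \<alpha>"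
        using pow[of ?z] z1 L by (simp only: powr_minus_divide) simp
      finally show ?thesis
        using True zM c by (simp add: ennreal_mult'[symmetric] ennreal_leI)
    qed
  qed
  also have "\<dots> = (\<integral>\<^sup>+z. ennreal c * (ennreal (norm (z :: real ^ 'n) powr \<alpha>) * indicator {..<44 * M} (norm z)) \<partial>lborel)"
    by (rule nn_integral_lborel_translate) measurable
  also have "\<dots> = ennreal c * (\<integral>\<^sup>+z. ennreal (norm (z :: real ^ 'n) powr \<alpha>) * indicator {..<44 * M} (norm z) \<partial>lborel)"
    by (rule nn_integral_cmult) measurable
  also have "\<dots> = ennreal c * ennreal (sphere_area CARD('n) * (44 * M))"
    using nn_integral_norm_powr_ball[of \<alpha> "44 * M", where 'a = "real ^ 'n"] M \<delta>_pos
    by (simp add: sphere_area_def \<alpha>_def)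
  also have "\<dots> = ennreal (Lp_const * M / \<delta>)"
    using c by (subst ennreal_mult'[symmetric]) (simp_all add: c_def Lp_const_def mult_ac)
  finally show ?thesis .
qed

lemma ext_avg_Lp_le:
  assumes p: "1 < p" and [measurable]: "g \<in> borel_measurable borel"
    and fin: "(\<integral>\<^sup>+a. ennreal (\<bar>g a\<bar> powr p) \<partial>lborel) < top" and M: "\<delta> < M"
  shows "(\<integral>\<^sup>+x. ennreal (\<bar>ext_avg g x\<bar> powr p) * indicator (half_space k \<delta> \<inter> {x. x $ k < 2 * M}) x \<partial>lborel) \<le>
    ennreal (Lp_const * M / \<delta>) * (\<integral>\<^sup>+a. ennreal (\<bar>g a\<bar> powr p) \<partial>lborel)"
proof -
  let ?U = "half_space k \<delta> \<inter> {x. x $ k < 2 * M}"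
  have [measurable]: "?U \<in> sets borel"
    by measurable
  have "Lp_integral p ?U (ext_avg g) \<le>
      (\<integral>\<^sup>+x. \<integral>\<^sup>+a. ennreal (avg_kernel x a) * indicator ?U x * ennreal (\<bar>g a\<bar> powr p) \<partial>lborel \<partial>lborel)"
  proof (rule nn_integral_mono)
    fix x
    show "ennreal (\<bar>ext_avg g x\<bar> powr p) * indicator ?U x \<le>
        (\<integral>\<^sup>+a. ennreal (avg_kernel x a) * indicator ?U x * ennreal (\<bar>g a\<bar> powr p) \<partial>lborel)"
    proof (cases "x \<in> ?U")
      case True
      then show ?thesis
        using ext_avg_minus_powr_le[OF p assms(2) fin, of x 0] avg_kernel_nonneg[of x]
        by (simp add: ennreal_mult)
    qed simp
  qed
  also have "\<dots> = (\<integral>\<^sup>+a. \<integral>\<^sup>+x. ennreal (avg_kernel x a) * indicator ?U x * ennreal (\<bar>g a\<bar> powr p) \<partial>lborel \<partial>lborel)"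
    by (rule lborel_pair.Fubini') measurable
  also have "\<dots> \<le> (\<integral>\<^sup>+a. ennreal (Lp_const * M / \<delta>) * ennreal (\<bar>g a\<bar> powr p) \<partial>lborel)"
  proof (rule nn_integral_mono)
    fix a
    have "(\<integral>\<^sup>+x. ennreal (avg_kernel x a) * indicator ?U x * ennreal (\<bar>g a\<bar> powr p) \<partial>lborel) =
        (\<integral>\<^sup>+x. ennreal (avg_kernel x a) * indicator ?U x \<partial>lborel) * ennreal (\<bar>g a\<bar> powr p)"
      by (rule nn_integral_multc) measurable
    also have "\<dots> \<le> ennreal (Lp_const * M / \<delta>) * ennreal (\<bar>g a\<bar> powr p)"
    proof (cases "a \<in> strip k \<delta>")
      case True
      then show ?thesis
        using avg_kernel_column_integral_le[OF _ M] by (intro mult_right_mono) auto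
    next
      case False
      then have "avg_kernel x a = 0" for x
        by (simp add: avg_kernel_def tent_def)
      then show ?thesis
        by simp
    qed
    finally show "(\<integral>\<^sup>+x. ennreal (avg_kernel x a) * indicator ?U x * ennreal (\<bar>g a\<bar> powr p) \<partial>lborel) \<le>
      ennreal (Lp_const * M / \<delta>) * ennreal (\<bar>g a\<bar> powr p)" .
  qed
  also have "\<dots> = ennreal (Lp_const * M / \<delta>) * (\<integral>\<^sup>+a. ennreal (\<bar>g a\<bar> powr p) \<partial>lborel)"
    by (rule nn_integral_cmult) measurable
  finally show ?thesis .
qed

end

subsection \<open>Cutoff and reflection\<close>

lemma double_seminorm_mono_set:
  assumes "U \<subseteq> V"
  shows "double_seminorm p J U f \<le> double_seminorm p J V f"
  unfolding double_seminorm_def using assms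
  by (intro nn_integral_mono mult_mono) (auto simp: indicator_def)

text \<open>The integral hypothesis on \<open>J\<close> says that the seminorm of a function with Lipschitz constant 1
  has density at most 1.\<close>

lemma double_seminorm_cutoff_le:
  fixes \<phi> w :: "'a::euclidean_space \<Rightarrow> real" and J :: "'a \<Rightarrow> real"
  assumes p: "1 < p" and [measurable]: "J \<in> borel_measurable borel" "\<phi> \<in> borel_measurable borel"
      "w \<in> borel_measurable borel" "H \<in> sets borel" "S \<in> sets borel"
    and J: "\<And>z. 0 \<le> J z" "\<And>z. J (- z) = J z" "(\<integral>\<^sup>+z. ennreal (J z * norm z powr p) \<partial>lborel) \<le> 1"
    and \<phi>: "\<And>x. 0 \<le> \<phi> x" "\<And>x. \<phi> x \<le> 1" "\<And>x y. \<bar>\<phi> y - \<phi> x\<bar> \<le> L * norm (y - x)" "\<And>x. x \<notin> S \<Longrightarrow> \<phi> x = 0"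
    and L: "0 \<le> L"
  shows "double_seminorm p J H (\<lambda>x. \<phi> x * w x) \<le> ennreal (2 powr p) * double_seminorm p J (H \<inter> S) w +
    ennreal (2 * (4 * L) powr p) * Lp_integral p (H \<inter> S) w"
proof -
  let ?a = "\<lambda>x y. ennreal (J (y - x) * \<bar>w y - w x\<bar> powr p) * indicator (H \<inter> S) y * indicator (H \<inter> S) x"
  let ?w = "\<lambda>x. ennreal (\<bar>w x\<bar> powr p) * indicator (H \<inter> S) x"
  let ?b = "\<lambda>x y. ennreal (J (y - x) * norm (y - x) powr p)"
  let ?I = "\<integral>\<^sup>+x. ?w x \<partial>lborel"
  have pw: "ennreal (J (y - x) * \<bar>\<phi> y * w y - \<phi> x * w x\<bar> powr p) * indicator H y * indicator H x \<le>
      ennreal (2 powr p) * ?a x y + ennreal ((4 * L) powr p) * (?w x * ?b x y) + ennreal ((4 * L) powr p) * (?w y * ?b x y)" for x y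
  proof (cases "x \<in> H \<and> y \<in> H")
    case True
    let ?i = "indicator S :: 'a \<Rightarrow> real"
    \<comment> \<open>The indicators are built into \<open>t\<close>, \<open>s\<close> and
      \<open>s'\<close>, so one inequality covers all positions of \<open>x\<close> and
      \<open>y\<close> relative to \<open>S\<close>. With one point outside \<open>S\<close> the
      cutoff vanishes there, and only the term with its variation is left.\<close>
    define t where "t = ?i x * ?i y * \<bar>w y - w x\<bar>"
    define s where "s = ?i x * \<bar>w x\<bar>"
    define s' where "s' = ?i y * \<bar>w y\<bar>"
    define n where "n = L * norm (y - x)"
    have n0: "0 \<le> n" "0 \<le> s" "0 \<le> s'" "0 \<le> t"
      using L by (auto simp: n_def s_def s'_def t_def)
    have split: "\<bar>\<phi> y * w y - \<phi> x * w x\<bar> \<le> t + n * (s + s')"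
    proof -
      have d: "\<bar>\<phi> y - \<phi> x\<bar> \<le> n"
        using \<phi>(3) by (simp add: n_def)
      consider "x \<in> S" "y \<in> S" | "x \<in> S" "y \<notin> S" | "x \<notin> S" "y \<in> S" | "x \<notin> S" "y \<notin> S"
        by blast
      then show ?thesis
      proof cases
        case 1
        have "\<phi> y * w y - \<phi> x * w x = \<phi> y * (w y - w x) + (\<phi> y - \<phi> x) * w x"
          by (simp add: algebra_simps)
        also have "\<bar>\<dots>\<bar> \<le> \<phi> y * \<bar>w y - w x\<bar> + \<bar>\<phi> y - \<phi> x\<bar> * \<bar>w x\<bar>"
          using \<phi>(1)[of y] by (intro order_trans[OF abs_triangle_ineq]) (simp add: abs_mult)
        also have "\<dots> \<le> 1 * \<bar>w y - w x\<bar> + n * \<bar>w x\<bar>"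
          using d \<phi>(2)[of y] by (intro add_mono mult_right_mono) auto
        also have "\<dots> \<le> t + n * (s + s')"
          using 1 n0 by (simp add: t_def s_def s'_def mult_left_mono)
        finally show ?thesis .
      next
        case 2
        then have "\<bar>\<phi> y * w y - \<phi> x * w x\<bar> = \<bar>\<phi> y - \<phi> x\<bar> * \<bar>w x\<bar>"
          by (simp add: \<phi>(4) abs_mult)
        also have "\<dots> \<le> n * \<bar>w x\<bar>"
          using d by (rule mult_right_mono) simp
        finally show ?thesis
          using 2 n0 by (simp add: s_def s'_def t_def)
      next
        case 3
        then have "\<bar>\<phi> y * w y - \<phi> x * w x\<bar> = \<bar>\<phi> y - \<phi> x\<bar> * \<bar>w y\<bar>"
          by (simp add: \<phi>(4) abs_mult)
        also have "\<dots> \<le> n * \<bar>w y\<bar>"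
          using d by (rule mult_right_mono) simp
        finally show ?thesis
          using 3 n0 by (simp add: s_def s'_def t_def)
      next
        case 4
        then show ?thesis
          using n0 by (simp add: \<phi>(4))
      qed
    qed
    have "\<bar>\<phi> y * w y - \<phi> x * w x\<bar> powr p \<le> \<bar>t + n * (s + s')\<bar> powr p"
      using p split by (intro powr_mono2) auto
    also have "\<dots> \<le> 2 powr p * (\<bar>t\<bar> powr p + \<bar>n * (s + s')\<bar> powr p)"
      by (rule abs_add_powr_le[OF p])
    also have "\<bar>n * (s + s')\<bar> powr p = n powr p * \<bar>s + s'\<bar> powr p"
      using n0 by (simp add: abs_mult powr_mult)
    also have "2 powr p * (\<bar>t\<bar> powr p + n powr p * \<bar>s + s'\<bar> powr p) \<le>
        2 powr p * (\<bar>t\<bar> powr p + n powr p * (2 powr p * (\<bar>s\<bar> powr p + \<bar>s'\<bar> powr p)))"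
      by (intro mult_left_mono add_left_mono abs_add_powr_le p) auto
    also have "\<dots> = 2 powr p * t powr p + (4 * L) powr p * (s powr p * norm (y - x) powr p) + (4 * L) powr p * (s' powr p * norm (y - x) powr p)"
    proof -
      \<comment> \<open>One factor \<open>2 powr p\<close> for separating \<open>t\<close>, one for
        separating \<open>s\<close> from \<open>s'\<close>.\<close>
      have "(4 * L) powr p = 2 powr p * (2 powr p * L powr p)"
        using L powr_mult[of 2 2 p] by (simp add: powr_mult)
      moreover have "n powr p = L powr p * norm (y - x) powr p"
        using L by (simp add: n_def powr_mult)
      ultimately show ?thesis
        by (simp only: abs_of_nonneg[OF n0(2)] abs_of_nonneg[OF n0(3)] abs_of_nonneg[OF n0(4)])
          (simp only: distrib_left mult_ac add_ac)
    qed
    finally have main: "J (y - x) * \<bar>\<phi> y * w y - \<phi> x * w x\<bar> powr p \<le> J (y - x) *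
        (2 powr p * t powr p + (4 * L) powr p * (s powr p * norm (y - x) powr p) + (4 * L) powr p * (s' powr p * norm (y - x) powr p))"
      using J(1) by (rule mult_left_mono)
    have "ennreal (J (y - x) * (2 powr p * t powr p + (4 * L) powr p * (s powr p * norm (y - x) powr p) + (4 * L) powr p * (s' powr p * norm (y - x) powr p)))
      = ennreal (2 powr p) * ennreal (J (y - x) * t powr p) + ennreal ((4 * L) powr p) * (ennreal (s powr p) * ?b x y) +
        ennreal ((4 * L) powr p) * (ennreal (s' powr p) * ?b x y)"
      using J(1)[of "y - x"] by (simp add: distrib_left ennreal_plus ennreal_mult mult_ac)
    moreover have "ennreal (J (y - x) * t powr p) = ?a x y" "ennreal (s powr p) = ?w x" "ennreal (s' powr p) = ?w y"
      using p True by (auto simp: t_def s_def s'_def split: split_indicator)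
    ultimately show ?thesis
      using ennreal_leI[OF main] True by simp
  qed auto
  have "double_seminorm p J H (\<lambda>x. \<phi> x * w x) =
      (\<integral>\<^sup>+x. \<integral>\<^sup>+y. ennreal (J (y - x) * \<bar>\<phi> y * w y - \<phi> x * w x\<bar> powr p) * indicator H y * indicator H x \<partial>lborel \<partial>lborel)"
    unfolding double_seminorm_def by (intro nn_integral_cong nn_integral_multc[symmetric]) measurable
  also have "\<dots> \<le> (\<integral>\<^sup>+x. \<integral>\<^sup>+y. ennreal (2 powr p) * ?a x y + ennreal ((4 * L) powr p) * (?w x * ?b x y) +
      ennreal ((4 * L) powr p) * (?w y * ?b x y) \<partial>lborel \<partial>lborel)"
    by (intro nn_integral_mono pw)
  also have "\<dots> = ennreal (2 powr p) * (\<integral>\<^sup>+x. \<integral>\<^sup>+y. ?a x y \<partial>lborel \<partial>lborel) +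
      ennreal ((4 * L) powr p) * (\<integral>\<^sup>+x. \<integral>\<^sup>+y. ?w x * ?b x y \<partial>lborel \<partial>lborel) +
      ennreal ((4 * L) powr p) * (\<integral>\<^sup>+x. \<integral>\<^sup>+y. ?w y * ?b x y \<partial>lborel \<partial>lborel)"
    by (simp add: nn_integral_add nn_integral_cmult)
  finally have base: "double_seminorm p J H (\<lambda>x. \<phi> x * w x) \<le> ennreal (2 powr p) * (\<integral>\<^sup>+x. \<integral>\<^sup>+y. ?a x y \<partial>lborel \<partial>lborel) +
      ennreal ((4 * L) powr p) * (\<integral>\<^sup>+x. \<integral>\<^sup>+y. ?w x * ?b x y \<partial>lborel \<partial>lborel) +
      ennreal ((4 * L) powr p) * (\<integral>\<^sup>+x. \<integral>\<^sup>+y. ?w y * ?b x y \<partial>lborel \<partial>lborel)" .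
  have "(\<integral>\<^sup>+x. \<integral>\<^sup>+y. ?a x y \<partial>lborel \<partial>lborel) = double_seminorm p J (H \<inter> S) w"
    unfolding double_seminorm_def by (intro nn_integral_cong nn_integral_multc) measurable
  then have A: "(\<integral>\<^sup>+x. \<integral>\<^sup>+y. ?a x y \<partial>lborel \<partial>lborel) \<le> double_seminorm p J (H \<inter> S) w"
    by simp
  have X: "(\<integral>\<^sup>+x. \<integral>\<^sup>+y. ?w x * ?b x y \<partial>lborel \<partial>lborel) \<le> ?I"
  proof (rule nn_integral_mono)
    fix x
    have "(\<integral>\<^sup>+y. ?w x * ?b x y \<partial>lborel) = ?w x * (\<integral>\<^sup>+y. ennreal (J (y + - x) * norm (y + - x) powr p) \<partial>lborel)"
      by (subst nn_integral_cmult) auto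
    also have "(\<integral>\<^sup>+y. ennreal (J (y + - x) * norm (y + - x) powr p) \<partial>lborel) = (\<integral>\<^sup>+z. ennreal (J z * norm z powr p) \<partial>lborel)"
      by (rule nn_integral_lborel_translate) measurable
    also have "?w x * \<dots> \<le> ?w x * 1"
      by (intro mult_left_mono J(3)) simp
    finally show "(\<integral>\<^sup>+y. ?w x * ?b x y \<partial>lborel) \<le> ?w x"
      by simp
  qed
  have sym: "?b x y = ?b y x" for x y
    using J(2)[of "x - y"] by (simp add: norm_minus_commute)
  have "(\<integral>\<^sup>+x. \<integral>\<^sup>+y. ?w y * ?b x y \<partial>lborel \<partial>lborel) = (\<integral>\<^sup>+y. \<integral>\<^sup>+x. ?w y * ?b x y \<partial>lborel \<partial>lborel)"
    by (rule lborel_pair.Fubini') measurable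
  also have "\<dots> = (\<integral>\<^sup>+y. \<integral>\<^sup>+x. ?w y * ?b y x \<partial>lborel \<partial>lborel)"
    by (intro nn_integral_cong arg_cong2[where f = "(*)"] refl sym)
  finally have Y: "(\<integral>\<^sup>+x. \<integral>\<^sup>+y. ?w y * ?b x y \<partial>lborel \<partial>lborel) \<le> ?I"
    using X by (simp only:)
  have "double_seminorm p J H (\<lambda>x. \<phi> x * w x) \<le> ennreal (2 powr p) * double_seminorm p J (H \<inter> S) w +
      ennreal ((4 * L) powr p) * ?I + ennreal ((4 * L) powr p) * ?I"
    by (rule order_trans[OF base]) (intro add_mono mult_left_mono A X Y; simp)
  also have "\<dots> = ennreal (2 powr p) * double_seminorm p J (H \<inter> S) w + ennreal (2 * (4 * L) powr p) * ?I"
  proof -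
    have "ennreal (2 * t) = ennreal t + ennreal t" if "0 \<le> t" for t
      using that by (subst ennreal_plus[symmetric]) auto
    then show ?thesis
      by (simp only: powr_ge_zero distrib_right add.assoc)
  qed
  finally show ?thesis .
qed

context strip_geometry
begin

text \<open>The bijective reflection, kept for the change of variables; the two-to-one map
  \<open>R\<close> of the overview is \<open>fold_point\<close>.\<close>

definition mirror :: "real ^ 'n \<Rightarrow> real ^ 'n" where
  "mirror x = (\<chi> i. if i = k then - x $ i else x $ i)"

definition fold_point :: "real ^ 'n \<Rightarrow> real ^ 'n" where
  "fold_point x = (\<chi> i. if i = k then - \<bar>x $ i\<bar> else x $ i)"

definition slab :: "(real ^ 'n) set" where
  "slab = {x. - \<delta> < x $ k \<and> x $ k < \<delta>}"

lemma slab_measurable [measurable]: "slab \<in> sets borel"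
  unfolding slab_def by measurable

lemma mirror_measurable [measurable]: "mirror \<in> borel_measurable borel"
proof -
  have "mirror = (\<lambda>x. x - (2 * x $ k) *\<^sub>R axis k 1)"
    by (auto simp: mirror_def vec_eq_iff axis_def)
  then show ?thesis
    by (simp only:) (intro borel_measurable_continuous_onI continuous_intros)
qed

lemma fold_point_measurable [measurable]: "fold_point \<in> borel_measurable borel"
proof -
  have "fold_point = (\<lambda>x. x - (x $ k + \<bar>x $ k\<bar>) *\<^sub>R axis k 1)"
    by (auto simp: fold_point_def vec_eq_iff axis_def)
  then show ?thesis
    by (simp only:) (intro borel_measurable_continuous_onI continuous_intros)
qed

lemma norm_fold_diff_le: "norm (fold_point y - fold_point x) \<le> norm (y - x)"
  by (rule norm_le_componentwise_cart) (auto simp: fold_point_def)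

lemma fold_point_strip: "x \<in> strip k \<delta> \<Longrightarrow> fold_point x = x"
  by (auto simp: fold_point_def strip_def vec_eq_iff)

lemma distr_mirror_lborel: "distr lborel borel mirror = lborel"
proof -
  let ?c = "\<lambda>j. if j = axis k 1 then - 1 else (1::real)"
  have "mirror x = 0 + (\<Sum>j\<in>Basis. (?c j * (x \<bullet> j)) *\<^sub>R j)" for x :: "real ^ 'n"
  proof (rule euclidean_eqI)
    fix b :: "real ^ 'n" assume b: "b \<in> Basis"
    then obtain i where i: "b = axis i 1"
      by (auto simp: Basis_vec_def)
    have "mirror x \<bullet> b = ?c b * (x \<bullet> b)"
      by (auto simp: i mirror_def inner_axis axis_eq_axis)
    also have "\<dots> = (0 + (\<Sum>j\<in>Basis. (?c j * (x \<bullet> j)) *\<^sub>R j)) \<bullet> b"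
      using b by (simp add: inner_sum_left_Basis)
    finally show "mirror x \<bullet> b = (0 + (\<Sum>j\<in>Basis. (?c j * (x \<bullet> j)) *\<^sub>R j)) \<bullet> b" .
  qed
  then have eq: "mirror = (\<lambda>x. 0 + (\<Sum>j\<in>Basis. (?c j * (x \<bullet> j)) *\<^sub>R j))"
    by auto
  have "lborel = density (distr lborel borel mirror) (\<lambda>_. (\<Prod>j\<in>(Basis :: (real ^ 'n) set). \<bar>?c j\<bar>))"
    unfolding eq by (rule lborel_affine_euclidean) auto
  also have "(\<lambda>_. (\<Prod>j\<in>(Basis :: (real ^ 'n) set). \<bar>?c j\<bar>)) = (\<lambda>_. 1)"
    by (auto intro!: prod.neutral)
  finally show ?thesis
    by (simp add: density_1)
qed

lemma nn_integral_mirror: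
  assumes [measurable]: "f \<in> borel_measurable borel"
  shows "(\<integral>\<^sup>+x. f (mirror x) \<partial>lborel) = (\<integral>\<^sup>+x. f x \<partial>lborel)"
  by (subst (2) distr_mirror_lborel[symmetric], subst nn_integral_distr) auto

lemma AE_component_nonzero: "AE x in lborel. x $ k \<noteq> (0::real)"
proof -
  have "negligible {x :: real ^ 'n. x $ k = 0}"
    by (rule negligible_standard_hyperplane_cart)
  then have "AE x in lebesgue. x \<notin> {x :: real ^ 'n. x $ k = 0}"
    by (intro AE_not_in) (simp add: negligible_iff_null_sets)
  then show ?thesis
    by (simp add: AE_completion_iff)
qed

text \<open>The slab consists of the strip, its mirror image and a null hyperplane, and
  \<open>fold_point\<close> maps each half onto the strip preserving measure.\<close>

lemma nn_integral_fold_le: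
  assumes [measurable]: "f \<in> borel_measurable borel"
  shows "(\<integral>\<^sup>+x. f (fold_point x) * indicator slab x \<partial>lborel) \<le> 2 * (\<integral>\<^sup>+x. f x * indicator (strip k \<delta>) x \<partial>lborel)"
proof -
  have "(\<integral>\<^sup>+x. f (fold_point x) * indicator slab x \<partial>lborel) \<le>
      (\<integral>\<^sup>+x. f x * indicator (strip k \<delta>) x + f (mirror x) * indicator (strip k \<delta>) (mirror x) \<partial>lborel)"
    using AE_component_nonzero
  proof (intro nn_integral_mono_AE, eventually_elim)
    case (elim x)
    consider "x \<notin> slab" | "x \<in> slab" "x $ k < 0" | "x \<in> slab" "0 < x $ k"
      using elim by linarith
    then show ?case
    proof cases
      case 2
      then have "x \<in> strip k \<delta>"
        by (simp add: slab_def strip_def)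
      then show ?thesis
        using 2 by (simp add: fold_point_strip)
    next
      case 3
      then have "mirror x \<in> strip k \<delta>" "fold_point x = mirror x"
        by (auto simp: slab_def strip_def mirror_def fold_point_def vec_eq_iff)
      then show ?thesis
        using 3 by simp
    qed simp
  qed
  also have "\<dots> = (\<integral>\<^sup>+x. f x * indicator (strip k \<delta>) x \<partial>lborel) + (\<integral>\<^sup>+x. f (mirror x) * indicator (strip k \<delta>) (mirror x) \<partial>lborel)"
    by (rule nn_integral_add) measurable
  also have "(\<integral>\<^sup>+x. f (mirror x) * indicator (strip k \<delta>) (mirror x) \<partial>lborel) = (\<integral>\<^sup>+x. f x * indicator (strip k \<delta>) x \<partial>lborel)"
    by (rule nn_integral_mirror) measurable
  finally show ?thesis
    by (simp add: mult_2)
qed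

text \<open>Folding does not increase distances and \<open>J\<close> decreases with distance; each
  of the two variables costs a factor 2. Monotonicity is asked away from 0 only:
  \<open>0 powr a\<close> is 0 in HOL, so the singular kernel drops to 0 at the origin. Pairs that
  fold to the same point contribute nothing.\<close>

lemma double_seminorm_fold_le:
  assumes p: "1 < p" and [measurable]: "J \<in> borel_measurable borel" "g \<in> borel_measurable borel"
    and J: "\<And>u v. 0 < norm u \<Longrightarrow> norm u \<le> norm v \<Longrightarrow> J v \<le> J u"
  shows "double_seminorm p J slab (\<lambda>x. g (fold_point x)) \<le> 4 * double_seminorm p J (strip k \<delta>) g"
proof -
  let ?F = "\<lambda>x y. ennreal (J (y - x) * \<bar>g y - g x\<bar> powr p)"
  have pw: "ennreal (J (y - x) * \<bar>g (fold_point y) - g (fold_point x)\<bar> powr p) \<le> ?F (fold_point x) (fold_point y)" for x y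
  proof (cases "fold_point y = fold_point x")
    case True
    then show ?thesis
      using p by simp
  next
    case False
    then have "J (y - x) \<le> J (fold_point y - fold_point x)"
      by (intro J norm_fold_diff_le) auto
    then show ?thesis
      by (intro ennreal_leI mult_right_mono) auto
  qed
  have "double_seminorm p J slab (\<lambda>x. g (fold_point x)) \<le>
      (\<integral>\<^sup>+x. (\<integral>\<^sup>+y. ?F (fold_point x) (fold_point y) * indicator slab y \<partial>lborel) * indicator slab x \<partial>lborel)"
    unfolding double_seminorm_def by (intro nn_integral_mono mult_right_mono pw) auto
  also have "\<dots> \<le> (\<integral>\<^sup>+x. (2 * (\<integral>\<^sup>+y. ?F (fold_point x) y * indicator (strip k \<delta>) y \<partial>lborel)) * indicator slab x \<partial>lborel)"
    by (intro nn_integral_mono mult_right_mono nn_integral_fold_le) auto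
  also have "\<dots> \<le> 2 * (\<integral>\<^sup>+x. (2 * (\<integral>\<^sup>+y. ?F x y * indicator (strip k \<delta>) y \<partial>lborel)) * indicator (strip k \<delta>) x \<partial>lborel)"
    by (rule nn_integral_fold_le) measurable
  also have "\<dots> = 4 * double_seminorm p J (strip k \<delta>) g"
    unfolding double_seminorm_def by (simp add: mult.assoc nn_integral_cmult)
  finally show ?thesis .
qed

text \<open>The support of \<open>J\<close> restricts to pairs for which
  \<open>ext_avg_diff_powr_le\<close> holds, and the p-th moment of \<open>J\<close> then absorbs
  the integral over \<open>y\<close>.\<close>

lemma double_seminorm_ext_avg_le:
  assumes p: "1 < p" and [measurable]: "J \<in> borel_measurable borel" "g \<in> borel_measurable borel"
    and fin: "(\<integral>\<^sup>+a. ennreal (\<bar>g a\<bar> powr p) \<partial>lborel) < top"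
    and J: "\<And>z. 0 \<le> J z" "\<And>z. \<delta> \<le> norm z \<Longrightarrow> J z = 0" "(\<integral>\<^sup>+z. ennreal (J z * norm z powr p) \<partial>lborel) \<le> 1"
  shows "double_seminorm p J (half_space k \<delta>) (ext_avg g) \<le> ennreal (diff_const p * far_const p) * far_energy p g"
proof -
  let ?H = "half_space k \<delta>"
  let ?W = "\<lambda>x. lam x powr (- p) / (vol x)\<^sup>2"
  have [measurable]: "patch_energy p g \<in> borel_measurable borel"
    unfolding patch_energy_def by measurable
  have "double_seminorm p J ?H (ext_avg g) \<le>
      (\<integral>\<^sup>+x. ennreal (diff_const p) * (ennreal (?W x) * patch_energy p g x * indicator ?H x) \<partial>lborel)"
    unfolding double_seminorm_def
  proof (rule nn_integral_mono)
    fix x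
    show "(\<integral>\<^sup>+y. ennreal (J (y - x) * \<bar>ext_avg g y - ext_avg g x\<bar> powr p) * indicator ?H y \<partial>lborel) * indicator ?H x
      \<le> ennreal (diff_const p) * (ennreal (?W x) * patch_energy p g x * indicator ?H x)"
    proof (cases "x \<in> ?H")
      case x: True
      let ?C = "ennreal (diff_const p * ?W x) * patch_energy p g x"
      have "(\<integral>\<^sup>+y. ennreal (J (y - x) * \<bar>ext_avg g y - ext_avg g x\<bar> powr p) * indicator ?H y \<partial>lborel) \<le>
          (\<integral>\<^sup>+y. ?C * ennreal (J (y + - x) * norm (y + - x) powr p) \<partial>lborel)"
      proof (rule nn_integral_mono)
        fix y
        show "ennreal (J (y - x) * \<bar>ext_avg g y - ext_avg g x\<bar> powr p) * indicator ?H y \<le>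
          ?C * ennreal (J (y + - x) * norm (y + - x) powr p)"
        proof (cases "y \<in> ?H \<and> norm (y - x) < \<delta>")
          case True
          then have "ennreal (J (y - x)) * ennreal (\<bar>ext_avg g y - ext_avg g x\<bar> powr p) \<le> ennreal (J (y - x)) *
              (ennreal (diff_const p * norm (y - x) powr p * ?W x) * patch_energy p g x)"
            using x by (intro mult_left_mono ext_avg_diff_powr_le[OF p _ fin]) auto
          also have "\<dots> = ?C * ennreal (J (y - x) * norm (y - x) powr p)"
          proof -
            have "ennreal j * (ennreal (c * n * t) * P) = ennreal (c * t) * P * ennreal (j * n)"
              if "0 \<le> j" "0 \<le> c" "0 \<le> n" "0 \<le> t" for j c n t :: real and P :: ennreal
              using that by (simp add: ennreal_mult mult_ac)
            from this[of "J (y - x)" "diff_const p" "norm (y - x) powr p" "?W x" "patch_energy p g x"] show ?thesis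
              using J(1) diff_const_pos[of p, THEN less_imp_le] by simp
          qed
          finally show ?thesis
            using True J(1) by (simp add: ennreal_mult)
        next
          case False
          then show ?thesis
            using J(2)[of "y - x"] by auto
        qed
      qed
      also have "\<dots> = ?C * (\<integral>\<^sup>+y. ennreal (J (y + - x) * norm (y + - x) powr p) \<partial>lborel)"
        by (rule nn_integral_cmult) measurable
      also have "(\<integral>\<^sup>+y. ennreal (J (y + - x) * norm (y + - x) powr p) \<partial>lborel) = (\<integral>\<^sup>+z. ennreal (J z * norm z powr p) \<partial>lborel)"
        by (rule nn_integral_lborel_translate) measurable
      also have "?C * \<dots> \<le> ?C * 1"
        by (intro mult_left_mono J(3)) simp
      also have "?C * 1 = ennreal (diff_const p) * (ennreal (?W x) * patch_energy p g x)"
        by (simp only: mult_1_right ennreal_mult'[OF less_imp_le[OF diff_const_pos]] mult.assoc)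
      finally show ?thesis
        using x by simp
    qed simp
  qed
  also have "\<dots> = ennreal (diff_const p) * (\<integral>\<^sup>+x. ennreal (?W x) * patch_energy p g x * indicator ?H x \<partial>lborel)"
    by (rule nn_integral_cmult) measurable
  also have "\<dots> \<le> ennreal (diff_const p) * (ennreal (far_const p) * far_energy p g)"
    by (intro mult_left_mono patch_energy_integral_le p) auto
  also have "\<dots> = ennreal (diff_const p * far_const p) * far_energy p g"
    using diff_const_pos[of p, THEN less_imp_le] by (simp add: ennreal_mult' mult.assoc)
  finally show ?thesis .
qed

definition near_const :: "real \<Rightarrow> real" where
  "near_const p = 2 * (4 / mass_const * 12 powr (real CARD('n) + p - 2))"

lemma near_const_pos: "0 < near_const p"
  using mass_const_pos by (simp add: near_const_def)

text \<open>In the slab \<open>lam x\<close> lies between \<delta> and 3 \<delta>, so the kernel is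
  at most of order \<delta>^(-d) and its support lies within 12 \<delta> = 4 * 3 \<delta>. At such
  distances \<open>far_density\<close> is at least of order \<delta>^(-d-p); the quotient is the
  gain of \<delta>^p. The factor 2 in \<open>near_const\<close> comes from folding.\<close>

lemma fold_minus_ext_avg_le:
  assumes p: "1 < p" and [measurable]: "g \<in> borel_measurable borel"
    and fin: "(\<integral>\<^sup>+a. ennreal (\<bar>g a\<bar> powr p) \<partial>lborel) < top"
  shows "Lp_integral p slab (\<lambda>x. g (fold_point x) - ext_avg g x) \<le>
    ennreal (near_const p * \<delta> powr p) * far_energy p g"
proof -
  let ?V = "strip k \<delta>"
  define e where "e = real CARD('n) + p - 2"
  define c where "c = 4 / mass_const * 12 powr e * \<delta> powr p"
  have e: "0 < e"
    unfolding e_def by (rule exponent_pos[OF p])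
  have c: "0 \<le> c"
    using mass_const_pos by (simp add: c_def)
  let ?F = "\<lambda>x b. ennreal (far_density p (b - x) * \<bar>g b - g x\<bar> powr p) * indicator ?V b"
  have "Lp_integral p slab (\<lambda>x. g (fold_point x) - ext_avg g x) \<le>
      (\<integral>\<^sup>+x. ennreal c * ((\<integral>\<^sup>+b. ?F (fold_point x) b \<partial>lborel) * indicator slab x) \<partial>lborel)"
  proof (rule nn_integral_mono)
    fix x
    show "ennreal (\<bar>g (fold_point x) - ext_avg g x\<bar> powr p) * indicator slab x \<le> ennreal c * ((\<integral>\<^sup>+b. ?F (fold_point x) b \<partial>lborel) * indicator slab x)"
    proof (cases "x \<in> slab")
      case slab: True
      then have x: "x \<in> half_space k \<delta>" and L3: "lam x \<le> 3 * \<delta>"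
        by (auto simp: slab_def half_space_def lam_def)
      have "ennreal (\<bar>g (fold_point x) - ext_avg g x\<bar> powr p) \<le> (\<integral>\<^sup>+b. ennreal (avg_kernel x b * \<bar>g b - g (fold_point x)\<bar> powr p) \<partial>lborel)"
        using ext_avg_minus_powr_le[OF p assms(2) fin x, of "g (fold_point x)"] by (simp add: abs_minus_commute)
      also have "\<dots> \<le> (\<integral>\<^sup>+b. ennreal c * ?F (fold_point x) b \<partial>lborel)"
      proof (rule nn_integral_mono)
        fix b
        show "ennreal (avg_kernel x b * \<bar>g b - g (fold_point x)\<bar> powr p) \<le> ennreal c * ?F (fold_point x) b"
        proof (cases "b \<in> ?V \<and> norm (b - x) < 4 * lam x")
          case True
          then have "norm (b - fold_point x) \<le> norm (b - x)"
            using norm_fold_diff_le[of b x] fold_point_strip[of b] by simp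
          then have "norm (b - fold_point x) \<le> 12 * \<delta>"
            using True L3 by linarith
          then have m: "max (norm (b - fold_point x)) \<delta> \<le> 12 * \<delta>" "0 < max (norm (b - fold_point x)) \<delta>"
            using \<delta>_pos by auto
          have "avg_kernel x b \<le> 4 / (mass_const * vol x) * (indicator ?V b * indicator (ball x (4 * lam x)) b)"
            by (rule avg_kernel_le[OF x])
          also have "\<dots> \<le> 4 / (mass_const * (\<delta> * \<delta> ^ (CARD('n) - 1)))"
            using True \<delta>_pos mass_const_pos lam_gt[OF x] lam_pos[OF x]
            by (simp add: dist_norm norm_minus_commute) (intro divide_left_mono mult_left_mono power_mono mult_pos_pos zero_less_power, auto)
          also have "\<dots> = 4 / mass_const * \<delta> powr (- real CARD('n))"
            using \<delta>_pos by (simp add: powr_minus_divide powr_realpow power_eq_if)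
          also have "\<dots> = c * (\<delta> powr (- 2) * (12 * \<delta>) powr (- e))"
          proof -
            have "\<delta> powr (- real CARD('n)) = \<delta> powr (p + - 2 + - e)"
              by (rule arg_cong[where f = "\<lambda>t. \<delta> powr t"]) (simp add: e_def)
            also have "\<dots> = \<delta> powr p * \<delta> powr (- 2) * \<delta> powr (- e)"
              by (simp only: powr_add)
            finally have 1: "\<delta> powr (- real CARD('n)) = \<delta> powr p * \<delta> powr (- 2) * \<delta> powr (- e)" .
            have 2: "12 powr e * (12 * \<delta>) powr (- e) = \<delta> powr (- e)"
              using \<delta>_pos by (simp add: powr_mult powr_minus_divide)
            show ?thesis
              unfolding 1 c_def 2[symmetric] by (simp add: mult_ac)
          qed
          also have "\<dots> \<le> c * (\<delta> powr (- 2) * max (norm (b - fold_point x)) \<delta> powr (- e))"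
            using c m e by (intro mult_left_mono powr_mono2') auto
          finally have "avg_kernel x b \<le> c * far_density p (b - fold_point x)"
            by (simp add: far_density_def e_def)
          then have "avg_kernel x b * \<bar>g b - g (fold_point x)\<bar> powr p \<le> c * (far_density p (b - fold_point x) * \<bar>g b - g (fold_point x)\<bar> powr p)"
            by (simp only: mult.assoc[symmetric]) (rule mult_right_mono, auto)
          then have "ennreal (avg_kernel x b * \<bar>g b - g (fold_point x)\<bar> powr p) \<le> ennreal (c * (far_density p (b - fold_point x) * \<bar>g b - g (fold_point x)\<bar> powr p))"
            by (rule ennreal_leI)
          then show ?thesis
            using True c by (simp add: ennreal_mult')
        next
          case False
          then have "avg_kernel x b \<le> 0"
            using avg_kernel_le[OF x, of b] by (auto simp: dist_norm norm_minus_commute)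
          then have "avg_kernel x b = 0"
            using avg_kernel_nonneg[OF x, of b] by simp
          then show ?thesis
            by simp
        qed
      qed
      also have "\<dots> = ennreal c * (\<integral>\<^sup>+b. ?F (fold_point x) b \<partial>lborel)"
        by (rule nn_integral_cmult) measurable
      finally show ?thesis
        using slab by simp
    qed simp
  qed
  also have "\<dots> = ennreal c * (\<integral>\<^sup>+x. (\<integral>\<^sup>+b. ?F (fold_point x) b \<partial>lborel) * indicator slab x \<partial>lborel)"
    by (rule nn_integral_cmult) measurable
  also have "\<dots> \<le> ennreal c * (2 * (\<integral>\<^sup>+x. (\<integral>\<^sup>+b. ?F x b \<partial>lborel) * indicator ?V x \<partial>lborel))"
    by (intro mult_left_mono nn_integral_fold_le) measurable
  also have "\<dots> = ennreal c * (2 * far_energy p g)"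
    by (simp add: far_energy_def)
  also have "\<dots> = ennreal (near_const p * \<delta> powr p) * far_energy p g"
  proof -
    have "ennreal (near_const p * \<delta> powr p) = ennreal (c * 2)"
      by (simp add: near_const_def c_def e_def mult_ac)
    also have "\<dots> = ennreal c * 2"
      using c by (simp add: ennreal_mult')
    finally show ?thesis
      by (simp add: mult.assoc)
  qed
  finally show ?thesis .
qed

end

subsection \<open>The extension and its norm\<close>

lemma ennreal_mult_add_mult_eq:
  assumes "0 \<le> a" "0 \<le> b" "0 \<le> c"
  shows "ennreal a * (ennreal b * Q + ennreal c * Q) = ennreal (a * (b + c)) * Q"
  using assms by (simp add: ennreal_mult' ennreal_plus distrib_right mult.assoc)

context strip_geometry
begin

definition inner_cutoff :: "real ^ 'n \<Rightarrow> real" where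
  "inner_cutoff x = max 0 (min 1 (1 - x $ k / \<delta>))"

definition outer_cutoff :: "real \<Rightarrow> real ^ 'n \<Rightarrow> real" where
  "outer_cutoff M x = max 0 (min 1 (2 - x $ k / M))"

text \<open>On the strip both cutoffs are 1 and folding is the identity, so the two averages cancel
  and \<open>g\<close> remains.\<close>

definition extend :: "real \<Rightarrow> (real ^ 'n \<Rightarrow> real) \<Rightarrow> real ^ 'n \<Rightarrow> real" where
  "extend M g x = outer_cutoff M x * ext_avg g x + inner_cutoff x * (g (fold_point x) - ext_avg g x)"

lemma cutoff_measurable [measurable]:
  "inner_cutoff \<in> borel_measurable borel" "outer_cutoff M \<in> borel_measurable borel"
  unfolding inner_cutoff_def outer_cutoff_def by measurable

lemma extend_measurable [measurable]:
  assumes [measurable]: "g \<in> borel_measurable borel"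
  shows "extend M g \<in> borel_measurable borel"
  unfolding extend_def by measurable

lemma clamp_diff_le:
  fixes c r :: real
  assumes "0 < r"
  shows "\<bar>max 0 (min 1 (c - y $ k / r)) - max 0 (min 1 (c - x $ k / r))\<bar> \<le> 1 / r * norm (y - x)"
proof -
  have "\<bar>max 0 (min 1 (c - y $ k / r)) - max 0 (min 1 (c - x $ k / r))\<bar> \<le> \<bar>(c - y $ k / r) - (c - x $ k / r)\<bar>"
    by (simp add: max_def min_def)
  also have "\<dots> = \<bar>(y - x) $ k\<bar> / r"
    using assms by (simp add: diff_divide_distrib[symmetric] abs_minus_commute)
  also have "\<dots> \<le> norm (y - x) / r"
    using assms component_le_norm_cart[of "y - x" k] by (intro divide_right_mono) auto
  finally show ?thesis
    by simp
qed

section \<open>The kernel and its comparison with the trace kernel\<close>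

lemma kernel_nonneg:
  assumes "\<beta> < real CARD('n) + p"
  shows "0 \<le> kernel CARD('n) p \<beta> \<delta> r"
  using assms sphere_area_pos by (simp add: kernel_def kernel_const_def)

lemma kernel_antimono:
  assumes "0 \<le> \<beta>" "\<beta> < real CARD('n) + p" "0 < r" "r \<le> s"
  shows "kernel CARD('n) p \<beta> \<delta> s \<le> kernel CARD('n) p \<beta> \<delta> r"
proof (cases "s < \<delta>")
  case True
  have "s powr (- \<beta>) \<le> r powr (- \<beta>)"
    using assms by (intro powr_mono2') auto
  then have "kernel_const CARD('n) p \<beta> / \<delta> powr (real CARD('n) + p - \<beta>) * s powr (- \<beta>) \<le>
      kernel_const CARD('n) p \<beta> / \<delta> powr (real CARD('n) + p - \<beta>) * r powr (- \<beta>)"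
    using assms sphere_area_pos by (intro mult_left_mono) (auto simp: kernel_const_def)
  then show ?thesis
    using True assms by (simp add: kernel_def)
next
  case False
  then have "kernel CARD('n) p \<beta> \<delta> s = 0"
    by (simp add: kernel_def)
  then show ?thesis
    using kernel_nonneg[OF assms(2)] by simp
qed

text \<open>This is the meaning of the normalising constant: the p-th moment is 1 for every \<beta>
  and \<delta>, which makes the bounds uniform in both.\<close>

lemma kernel_integral:
  assumes p: "1 < p" and \<beta>: "\<beta> < real CARD('n) + p"
  shows "(\<integral>\<^sup>+z. ennreal (kernel CARD('n) p \<beta> \<delta> (norm (z :: real ^ 'n)) * norm z powr p) \<partial>lborel) = 1"
proof -
  let ?d = "real CARD('n)"
  define c where "c = kernel_const CARD('n) p \<beta> / \<delta> powr (?d + p - \<beta>)"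
  have c: "0 \<le> c"
    using \<beta> sphere_area_pos by (simp add: c_def kernel_const_def)
  have "(\<integral>\<^sup>+z. ennreal (kernel CARD('n) p \<beta> \<delta> (norm (z :: real ^ 'n)) * norm z powr p) \<partial>lborel) =
      (\<integral>\<^sup>+z. ennreal c * (ennreal (norm (z :: real ^ 'n) powr (p - \<beta>)) * indicator {..<\<delta>} (norm z)) \<partial>lborel)"
  proof (rule nn_integral_cong)
    fix z :: "real ^ 'n"
    have "norm z powr (- \<beta>) * norm z powr p = norm z powr (p - \<beta>)"
      by (simp add: powr_add[symmetric])
    then have "kernel CARD('n) p \<beta> \<delta> (norm z) * norm z powr p = c * (norm z powr (p - \<beta>) * indicator {..<\<delta>} (norm z))"
      by (simp add: kernel_def c_def split: split_indicator)
    then show "ennreal (kernel CARD('n) p \<beta> \<delta> (norm z) * norm z powr p) =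
        ennreal c * (ennreal (norm z powr (p - \<beta>)) * indicator {..<\<delta>} (norm z))"
      using c by (simp add: ennreal_mult' split: split_indicator)
  qed
  also have "\<dots> = ennreal c * (\<integral>\<^sup>+z. ennreal (norm (z :: real ^ 'n) powr (p - \<beta>)) * indicator {..<\<delta>} (norm z) \<partial>lborel)"
    by (rule nn_integral_cmult) measurable
  also have "\<dots> = ennreal c * ennreal (sphere_area CARD('n) * \<delta> powr (p - \<beta> + ?d) / (p - \<beta> + ?d))"
  proof -
    have "0 < p - \<beta> + real DIM(real ^ 'n)"
      using \<beta> by simp
    from nn_integral_norm_powr_ball[OF this \<delta>_pos] show ?thesis
      by (simp add: sphere_area_def)
  qed
  also have "\<dots> = ennreal (c * (sphere_area CARD('n) * \<delta> powr (p - \<beta> + ?d) / (p - \<beta> + ?d)))"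
    by (rule ennreal_mult'[symmetric]) (rule c)
  also have "c * (sphere_area CARD('n) * \<delta> powr (p - \<beta> + ?d) / (p - \<beta> + ?d)) = 1"
  proof -
    have eq: "?d + p - \<beta> = p - \<beta> + ?d"
      by simp
    have "(D / s) / e * (s * e / D) = 1" if "0 < e" "0 < s" "0 < D" for e s D :: real
      using that by simp
    then show ?thesis
      unfolding c_def kernel_const_def eq using sphere_area_pos \<delta>_pos \<beta> by (auto simp only: powr_gt_zero)
  qed
  finally show ?thesis
    by simp
qed

definition trace_density :: "real \<Rightarrow> real \<Rightarrow> real ^ 'n \<Rightarrow> real" where
  "trace_density p \<beta> z = 1 / (max (norm z) \<delta> powr (real CARD('n) + p - 2) * min (norm z) \<delta> powr \<beta>)"

text \<open>As \<beta> \<ge> 0, replacing \<delta> by the smaller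
  \<open>min (norm z) \<delta>\<close> increases the power with exponent - \<beta>. At
  \<open>z = 0\<close> the right side is a division by 0, hence 0 in HOL; pairs with equal points
  are harmless in the seminorms.\<close>

lemma far_density_le:
  assumes "0 \<le> \<beta>" "z \<noteq> 0"
  shows "far_density p z \<le> \<delta> powr (\<beta> - 2) * trace_density p \<beta> z"
proof -
  let ?e = "real CARD('n) + p - 2"
  have m: "0 < min (norm z) \<delta>" "0 < max (norm z) \<delta>"
    using assms \<delta>_pos by auto
  have "\<delta> powr (- 2) = \<delta> powr (\<beta> - 2 + - \<beta>)"
    by simp
  also have "\<dots> = \<delta> powr (\<beta> - 2) * \<delta> powr (- \<beta>)"
    by (rule powr_add)
  also have "\<dots> \<le> \<delta> powr (\<beta> - 2) * min (norm z) \<delta> powr (- \<beta>)"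
    using assms m by (intro mult_left_mono powr_mono2') auto
  finally have "\<delta> powr (- 2) * max (norm z) \<delta> powr (- ?e) \<le>
      \<delta> powr (\<beta> - 2) * min (norm z) \<delta> powr (- \<beta>) * max (norm z) \<delta> powr (- ?e)"
    by (rule mult_right_mono) simp
  also have "\<dots> = \<delta> powr (\<beta> - 2) * trace_density p \<beta> z"
    unfolding trace_density_def powr_minus_divide[of _ ?e] powr_minus_divide[of _ \<beta>] by simp
  finally show ?thesis
    by (simp add: far_density_def)
qed

definition kernel_bound :: "real \<Rightarrow> real" where
  "kernel_bound p = (real CARD('n) + p) / sphere_area CARD('n)"

text \<open>Below distance \<delta> the maximum is \<delta> and the minimum is
  \<open>norm z\<close>, so the kernel is exactly \<open>kernel_const\<close> times the trace
  kernel; \<beta> \<ge> 0 bounds that constant uniformly.\<close>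

lemma kernel_le:
  assumes "1 < p" "0 \<le> \<beta>" "\<beta> < real CARD('n) + p" "z \<noteq> 0"
  shows "kernel CARD('n) p \<beta> \<delta> (norm z) \<le> kernel_bound p * (\<delta> powr (\<beta> - 2) * trace_density p \<beta> z)"
proof (cases "norm z < \<delta>")
  case True
  let ?e = "real CARD('n) + p - 2"
  have "\<delta> powr (real CARD('n) + p - \<beta>) = \<delta> powr (?e - (\<beta> - 2))"
    by (rule arg_cong[where f = "\<lambda>t. \<delta> powr t"]) simp
  also have "\<dots> = \<delta> powr ?e / \<delta> powr (\<beta> - 2)"
    by (rule powr_diff)
  finally have 1: "\<delta> powr (real CARD('n) + p - \<beta>) = \<delta> powr ?e / \<delta> powr (\<beta> - 2)" .
  have "kernel CARD('n) p \<beta> \<delta> (norm z) = kernel_const CARD('n) p \<beta> * (\<delta> powr (\<beta> - 2) * trace_density p \<beta> z)"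
    using True by (simp add: kernel_def trace_density_def 1 powr_minus_divide[of _ \<beta>] max_absorb2 min_absorb1)
  also have "\<dots> \<le> kernel_bound p * (\<delta> powr (\<beta> - 2) * trace_density p \<beta> z)"
    using assms sphere_area_pos
    by (intro mult_right_mono) (auto simp: kernel_const_def kernel_bound_def trace_density_def intro!: divide_right_mono)
  finally show ?thesis .
next
  case False
  have "0 \<le> kernel_bound p"
    using assms sphere_area_pos by (simp add: kernel_bound_def)
  then show ?thesis
    using False by (simp add: kernel_def trace_density_def)
qed

definition T_pow :: "real \<Rightarrow> real \<Rightarrow> (real ^ 'n \<Rightarrow> real) \<Rightarrow> ennreal" where
  "T_pow p \<beta> g = ennreal (1 / \<delta>) * Lp_pow p (strip k \<delta>) g + T_seminorm_pow p \<beta> \<delta> (strip k \<delta>) g"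

lemma T_seminorm_pow_eq:
  assumes [measurable]: "g \<in> borel_measurable borel"
  shows "T_seminorm_pow p \<beta> \<delta> (strip k \<delta>) g = double_seminorm p (\<lambda>z. \<delta> powr (\<beta> - 2) * trace_density p \<beta> z) (strip k \<delta>) g"
proof -
  let ?V = "strip k \<delta>"
  have [measurable]: "trace_density p \<beta> \<in> borel_measurable borel"
    unfolding trace_density_def by measurable
  have "T_seminorm_pow p \<beta> \<delta> ?V g = ennreal (\<delta> powr (\<beta> - 2)) *
      (\<integral>\<^sup>+x. (\<integral>\<^sup>+y. ennreal (trace_density p \<beta> (y - x) * \<bar>g y - g x\<bar> powr p) * indicator ?V y \<partial>lborel) * indicator ?V x \<partial>lborel)"
    unfolding T_seminorm_pow_def by (simp add: nn_integral_lebesgue_on_borel trace_density_def)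
  also have "\<dots> = (\<integral>\<^sup>+x. (\<integral>\<^sup>+y. ennreal (\<delta> powr (\<beta> - 2)) * (ennreal (trace_density p \<beta> (y - x) * \<bar>g y - g x\<bar> powr p) * indicator ?V y) \<partial>lborel) * indicator ?V x \<partial>lborel)"
    by (subst nn_integral_cmult[symmetric], measurable) (simp add: nn_integral_cmult mult.assoc)
  also have "\<dots> = double_seminorm p (\<lambda>z. \<delta> powr (\<beta> - 2) * trace_density p \<beta> z) ?V g"
    unfolding double_seminorm_def
    by (intro nn_integral_cong) (simp add: ennreal_mult' mult.assoc)
  finally show ?thesis .
qed

lemma far_energy_le:
  assumes "1 < p" "0 \<le> \<beta>" "g \<in> borel_measurable borel"
  shows "far_energy p g \<le> T_seminorm_pow p \<beta> \<delta> (strip k \<delta>) g"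
proof -
  have "far_density p (y - x) * \<bar>g y - g x\<bar> powr p \<le> \<delta> powr (\<beta> - 2) * trace_density p \<beta> (y - x) * \<bar>g y - g x\<bar> powr p" for x y
    using assms far_density_le[of \<beta> "y - x" p] by (cases "x = y") (auto intro: mult_right_mono)
  then show ?thesis
    unfolding far_energy_def T_seminorm_pow_eq[OF assms(3)] double_seminorm_def
    by (intro nn_integral_mono mult_right_mono[of "ennreal _"] mult_right_mono[of "nn_integral _ _"] ennreal_leI) auto
qed

lemma double_seminorm_kernel_le:
  assumes "1 < p" "0 \<le> \<beta>" "\<beta> < real CARD('n) + p" and [measurable]: "g \<in> borel_measurable borel"
  shows "double_seminorm p (\<lambda>z. kernel CARD('n) p \<beta> \<delta> (norm z)) (strip k \<delta>) g \<le>
    ennreal (kernel_bound p) * T_seminorm_pow p \<beta> \<delta> (strip k \<delta>) g"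
proof -
  let ?V = "strip k \<delta>" and ?D = "\<lambda>z. \<delta> powr (\<beta> - 2) * trace_density p \<beta> z"
  have [measurable]: "trace_density p \<beta> \<in> borel_measurable borel"
    unfolding trace_density_def by measurable
  have c: "0 \<le> kernel_bound p"
    using assms sphere_area_pos by (simp add: kernel_bound_def)
  have "double_seminorm p (\<lambda>z. kernel CARD('n) p \<beta> \<delta> (norm z)) ?V g \<le>
      (\<integral>\<^sup>+x. (\<integral>\<^sup>+y. ennreal (kernel_bound p) * (ennreal (?D (y - x) * \<bar>g y - g x\<bar> powr p) * indicator ?V y) \<partial>lborel) * indicator ?V x \<partial>lborel)"
    unfolding double_seminorm_def
  proof (intro nn_integral_mono mult_right_mono)
    fix x y
    have "kernel CARD('n) p \<beta> \<delta> (norm (y - x)) * \<bar>g y - g x\<bar> powr p \<le> kernel_bound p * ?D (y - x) * \<bar>g y - g x\<bar> powr p"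
      using kernel_le[OF assms(1-3), of "y - x"] assms(1) by (cases "x = y") (auto intro: mult_right_mono)
    then have "ennreal (kernel CARD('n) p \<beta> \<delta> (norm (y - x)) * \<bar>g y - g x\<bar> powr p) \<le>
        ennreal (kernel_bound p) * ennreal (?D (y - x) * \<bar>g y - g x\<bar> powr p)"
      by (subst ennreal_mult'[OF c, symmetric]) (auto simp: mult.assoc intro: ennreal_leI)
    then show "ennreal (kernel CARD('n) p \<beta> \<delta> (norm (y - x)) * \<bar>g y - g x\<bar> powr p) * indicator ?V y \<le>
        ennreal (kernel_bound p) * (ennreal (?D (y - x) * \<bar>g y - g x\<bar> powr p) * indicator ?V y)"
      by (simp only: mult.assoc[symmetric]) (rule mult_right_mono, auto)
  qed auto
  also have "\<dots> = ennreal (kernel_bound p) * double_seminorm p ?D ?V g"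
    unfolding double_seminorm_def by (simp add: nn_integral_cmult mult.assoc)
  finally show ?thesis
    by (simp only: T_seminorm_pow_eq[OF assms(4)])
qed

definition energy_const :: "real \<Rightarrow> real" where
  "energy_const p = diff_const p * far_const p"

text \<open>The outer factor separates the two parts of \<open>extend\<close>. The first group
  bounds the averaged part (\<open>S1\<close> below), the second the folded difference
  (\<open>S2\<close>).\<close>

definition total_const :: "real \<Rightarrow> real \<Rightarrow> real" where
  "total_const p M = 2 powr p *
     ((Lp_const * M + (2 powr p * energy_const p + 2 * (4 * (1 / M)) powr p * (Lp_const * M))) +
      (near_const p * M powr p + (2 powr p * (2 powr p * (4 * kernel_bound p + energy_const p)) + 2 * 4 powr p * near_const p)))"

lemma const_nonneg:
  assumes "1 < p"
  shows "0 < energy_const p" "0 \<le> Lp_const" "0 \<le> near_const p" "0 \<le> kernel_bound p"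
  using assms diff_const_pos[of p] far_const_pos[of p] Lp_const_pos near_const_pos[of p] sphere_area_pos
  by (auto simp: energy_const_def kernel_bound_def)

lemma total_const_pos:
  assumes "1 < p" "0 < M"
  shows "0 < total_const p M"
  unfolding total_const_def using const_nonneg[OF assms(1)] assms
  by (intro mult_pos_pos add_pos_nonneg add_nonneg_pos add_nonneg_nonneg mult_nonneg_nonneg) auto

lemma S_pow_extend_le:
  assumes p: "1 < p" and \<beta>: "0 \<le> \<beta>" "\<beta> < real CARD('n) + p" and M: "\<delta> < M"
    and g [measurable]: "g \<in> borel_measurable borel" and g0: "\<And>x. x \<notin> strip k \<delta> \<Longrightarrow> g x = 0"
    and fin: "Lp_pow p (strip k \<delta>) g < top"
  shows "S_pow p \<beta> \<delta> (half_space k \<delta>) (extend M g) \<le> ennreal (total_const p M) * T_pow p \<beta> g"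
proof -
  let ?H = "half_space k \<delta>" and ?V = "strip k \<delta>"
  let ?J = "\<lambda>z::real ^ 'n. kernel CARD('n) p \<beta> \<delta> (norm z)"
  let ?v = "ext_avg g" and ?w = "\<lambda>x. g (fold_point x) - ext_avg g x"
  define Q where "Q = T_pow p \<beta> g"
  have M0: "0 < M"
    using M \<delta>_pos by simp
  note cst = const_nonneg[OF p]
  have Lp: "Lp_pow p ?V g = (\<integral>\<^sup>+x. ennreal (\<bar>g x\<bar> powr p) \<partial>lborel)"
    unfolding Lp_pow_def nn_integral_lebesgue_on_borel[OF borel_strip]
    using g0 p by (intro nn_integral_cong) (auto split: split_indicator)
  have fin': "(\<integral>\<^sup>+x. ennreal (\<bar>g x\<bar> powr p) \<partial>lborel) < top"
    using fin Lp by simp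
  have TQ: "T_seminorm_pow p \<beta> \<delta> ?V g \<le> Q"
    unfolding Q_def T_pow_def by simp
  have FQ: "far_energy p g \<le> Q"
    using far_energy_le[OF p \<beta>(1) g] TQ by (rule order_trans)
  have J: "\<And>z. 0 \<le> ?J z" "\<And>z. ?J (- z) = ?J z" "(\<integral>\<^sup>+z. ennreal (?J z * norm z powr p) \<partial>lborel) \<le> 1"
      "\<And>z. \<delta> \<le> norm z \<Longrightarrow> ?J z = 0"
    using kernel_nonneg[OF \<beta>(2)] kernel_integral[OF p \<beta>(2)] by (auto simp: kernel_def)
  have [measurable]: "?J \<in> borel_measurable borel"
    by measurable
  have a: "(\<integral>\<^sup>+x. ennreal (\<bar>?v x\<bar> powr p) * indicator (?H \<inter> {x. x $ k < 2 * M}) x \<partial>lborel) \<le> ennreal (Lp_const * M) * Q"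
  proof -
    have "(\<integral>\<^sup>+x. ennreal (\<bar>?v x\<bar> powr p) * indicator (?H \<inter> {x. x $ k < 2 * M}) x \<partial>lborel) \<le>
        ennreal (Lp_const * M / \<delta>) * Lp_pow p ?V g"
      unfolding Lp by (rule ext_avg_Lp_le[OF p g fin' M])
    \<comment> \<open>The factor 1 / \<delta> is exactly the weight of the L^p part in
      \<open>T_pow\<close>.\<close>
    also have "ennreal (Lp_const * M / \<delta>) = ennreal (Lp_const * M) * ennreal (1 / \<delta>)"
      using cst M0 \<delta>_pos by (subst ennreal_mult'[symmetric]) auto
    also have "\<dots> * Lp_pow p ?V g = ennreal (Lp_const * M) * (ennreal (1 / \<delta>) * Lp_pow p ?V g)"
      by (rule mult.assoc)
    also have "\<dots> \<le> ennreal (Lp_const * M) * Q"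
      unfolding Q_def T_pow_def by (intro mult_left_mono) auto
    finally show ?thesis .
  qed
  have b: "Lp_integral p slab ?w \<le> ennreal (near_const p * \<delta> powr p) * Q"
    by (rule order_trans[OF fold_minus_ext_avg_le[OF p g fin'] mult_left_mono[OF FQ]]) simp
  have c: "double_seminorm p ?J ?H ?v \<le> ennreal (energy_const p) * Q"
    unfolding energy_const_def
    by (rule order_trans[OF double_seminorm_ext_avg_le[OF p _ g fin' J(1) J(4) J(3)] mult_left_mono[OF FQ]]) auto
  have d: "double_seminorm p ?J slab (\<lambda>x. g (fold_point x)) \<le> ennreal (4 * kernel_bound p) * Q"
  proof -
    have "double_seminorm p ?J slab (\<lambda>x. g (fold_point x)) \<le> 4 * double_seminorm p ?J ?V g"
      using kernel_antimono[OF \<beta>] by (intro double_seminorm_fold_le p) auto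
    also have "\<dots> \<le> 4 * (ennreal (kernel_bound p) * T_seminorm_pow p \<beta> \<delta> ?V g)"
      by (intro mult_left_mono double_seminorm_kernel_le p \<beta> g) auto
    also have "\<dots> \<le> 4 * (ennreal (kernel_bound p) * Q)"
      by (intro mult_left_mono TQ) auto
    also have "\<dots> = ennreal (4 * kernel_bound p) * Q"
      using cst by (simp add: ennreal_mult' mult.assoc)
    finally show ?thesis .
  qed
  have slab_H: "slab \<subseteq> ?H"
    by (auto simp: slab_def half_space_def)
  have e: "double_seminorm p ?J slab ?w \<le> ennreal (2 powr p * (4 * kernel_bound p + energy_const p)) * Q"
  proof -
    have "double_seminorm p ?J slab ?w = double_seminorm p ?J slab (\<lambda>x. g (fold_point x) + - ?v x)"
      by simp
    also have "\<dots> \<le> ennreal (2 powr p) * (double_seminorm p ?J slab (\<lambda>x. g (fold_point x)) + double_seminorm p ?J slab (\<lambda>x. - ?v x))"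
      by (intro double_seminorm_add_le p) auto
    also have "double_seminorm p ?J slab (\<lambda>x. - ?v x) = double_seminorm p ?J slab ?v"
      unfolding double_seminorm_def by (simp add: abs_minus_commute)
    also have "ennreal (2 powr p) * (double_seminorm p ?J slab (\<lambda>x. g (fold_point x)) + double_seminorm p ?J slab ?v) \<le>
        ennreal (2 powr p) * (ennreal (4 * kernel_bound p) * Q + ennreal (energy_const p) * Q)"
      by (intro mult_left_mono add_mono d order_trans[OF double_seminorm_mono_set[OF slab_H] c]) auto
    also have "\<dots> = ennreal (2 powr p * (4 * kernel_bound p + energy_const p)) * Q"
      using cst by (simp add: ennreal_mult' ennreal_plus distrib_right mult.assoc)
    finally show ?thesis .
  qed
  have f: "double_seminorm p ?J ?H (\<lambda>x. inner_cutoff x * ?w x) \<le>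
      ennreal (2 powr p * (2 powr p * (4 * kernel_bound p + energy_const p)) + 2 * 4 powr p * near_const p) * Q"
  proof -
    let ?S = "{x :: real ^ 'n. x $ k < \<delta>}"
    have HS: "?H \<inter> ?S = slab"
      by (auto simp: half_space_def slab_def)
    have "double_seminorm p ?J ?H (\<lambda>x. inner_cutoff x * ?w x) \<le> ennreal (2 powr p) * double_seminorm p ?J (?H \<inter> ?S) ?w +
        ennreal (2 * (4 * (1 / \<delta>)) powr p) * Lp_integral p (?H \<inter> ?S) ?w"
    proof (rule double_seminorm_cutoff_le[OF p _ _ _ _ _ J(1-3)])
      show "\<bar>inner_cutoff y - inner_cutoff x\<bar> \<le> 1 / \<delta> * norm (y - x)" for x y
        unfolding inner_cutoff_def using \<delta>_pos by (rule clamp_diff_le)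
      show "inner_cutoff x = 0" if "x \<notin> ?S" for x
        using that \<delta>_pos by (simp add: inner_cutoff_def)
    qed (use \<delta>_pos in \<open>auto simp: inner_cutoff_def\<close>)
    also have "\<dots> \<le> ennreal (2 powr p) * (ennreal (2 powr p * (4 * kernel_bound p + energy_const p)) * Q) +
        ennreal (2 * (4 * (1 / \<delta>)) powr p) * (ennreal (near_const p * \<delta> powr p) * Q)"
      unfolding HS by (intro add_mono mult_left_mono e b) auto
    also have "\<dots> = ennreal (2 powr p * (2 powr p * (4 * kernel_bound p + energy_const p)) +
        2 * (4 * (1 / \<delta>)) powr p * (near_const p * \<delta> powr p)) * Q"
      using cst by (simp add: ennreal_mult' ennreal_plus distrib_right mult.assoc)
    \<comment> \<open>The steep inner cutoff is paid for here: its Lipschitz constant 1 / \<delta>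
      meets the gain \<delta>^p in the L^p norm of the difference.\<close>
    also have "2 * (4 * (1 / \<delta>)) powr p * (near_const p * \<delta> powr p) = 2 * 4 powr p * near_const p"
      using \<delta>_pos by (simp add: powr_divide)
    finally show ?thesis .
  qed
  have gg: "double_seminorm p ?J ?H (\<lambda>x. outer_cutoff M x * ?v x) \<le>
      ennreal (2 powr p * energy_const p + 2 * (4 * (1 / M)) powr p * (Lp_const * M)) * Q"
  proof -
    let ?S = "{x :: real ^ 'n. x $ k < 2 * M}"
    have "double_seminorm p ?J ?H (\<lambda>x. outer_cutoff M x * ?v x) \<le> ennreal (2 powr p) * double_seminorm p ?J (?H \<inter> ?S) ?v +
        ennreal (2 * (4 * (1 / M)) powr p) * Lp_integral p (?H \<inter> ?S) ?v"
    proof (rule double_seminorm_cutoff_le[OF p _ _ _ _ _ J(1-3)])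
      show "\<bar>outer_cutoff M y - outer_cutoff M x\<bar> \<le> 1 / M * norm (y - x)" for x y
        unfolding outer_cutoff_def using M0 by (rule clamp_diff_le)
      show "outer_cutoff M x = 0" if "x \<notin> ?S" for x
        using that M0 by (simp add: outer_cutoff_def field_simps)
    qed (use M0 in \<open>auto simp: outer_cutoff_def\<close>)
    also have "\<dots> \<le> ennreal (2 powr p) * (ennreal (energy_const p) * Q) +
        ennreal (2 * (4 * (1 / M)) powr p) * (ennreal (Lp_const * M) * Q)"
      by (intro add_mono mult_left_mono a order_trans[OF double_seminorm_mono_set c]) auto
    also have "\<dots> = ennreal (2 powr p * energy_const p + 2 * (4 * (1 / M)) powr p * (Lp_const * M)) * Q"
      using cst M0 by (simp add: ennreal_mult' ennreal_plus distrib_right mult.assoc)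
    finally show ?thesis .
  qed
  have S1: "S_pow p \<beta> \<delta> ?H (\<lambda>x. outer_cutoff M x * ?v x) \<le>
      ennreal (Lp_const * M + (2 powr p * energy_const p + 2 * (4 * (1 / M)) powr p * (Lp_const * M))) * Q"
  proof -
    have "Lp_integral p ?H (\<lambda>x. outer_cutoff M x * ?v x) \<le>
        (\<integral>\<^sup>+x. ennreal (\<bar>?v x\<bar> powr p) * indicator (?H \<inter> {x. x $ k < 2 * M}) x \<partial>lborel)"
    proof (rule nn_integral_mono)
      fix x
      have "\<bar>outer_cutoff M x * ?v x\<bar> \<le> \<bar>?v x\<bar>"
        by (auto simp: abs_mult outer_cutoff_def intro!: mult_left_le_one_le)
      then have "\<bar>outer_cutoff M x * ?v x\<bar> powr p \<le> \<bar>?v x\<bar> powr p"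
        using p by (intro powr_mono2) auto
      moreover have "outer_cutoff M x = 0" if "\<not> x $ k < 2 * M"
        using that M0 by (simp add: outer_cutoff_def field_simps)
      ultimately show "ennreal (\<bar>outer_cutoff M x * ?v x\<bar> powr p) * indicator ?H x \<le>
          ennreal (\<bar>?v x\<bar> powr p) * indicator (?H \<inter> {x. x $ k < 2 * M}) x"
        using p by (auto split: split_indicator intro: ennreal_leI)
    qed
    then have "S_pow p \<beta> \<delta> ?H (\<lambda>x. outer_cutoff M x * ?v x) \<le> ennreal (Lp_const * M) * Q +
        ennreal (2 powr p * energy_const p + 2 * (4 * (1 / M)) powr p * (Lp_const * M)) * Q"
      unfolding S_pow_def by (intro add_mono gg order_trans[OF _ a])
    also have "\<dots> = ennreal (Lp_const * M + (2 powr p * energy_const p + 2 * (4 * (1 / M)) powr p * (Lp_const * M))) * Q"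
      using cst M0 by (subst distrib_right[symmetric], subst ennreal_plus[symmetric]) auto
    finally show ?thesis .
  qed
  have S2: "S_pow p \<beta> \<delta> ?H (\<lambda>x. inner_cutoff x * ?w x) \<le>
      ennreal (near_const p * M powr p + (2 powr p * (2 powr p * (4 * kernel_bound p + energy_const p)) + 2 * 4 powr p * near_const p)) * Q"
  proof -
    have "Lp_integral p ?H (\<lambda>x. inner_cutoff x * ?w x) \<le>
        Lp_integral p slab ?w"
    proof (rule nn_integral_mono)
      fix x
      have "\<bar>inner_cutoff x * ?w x\<bar> \<le> \<bar>?w x\<bar>"
        by (auto simp: abs_mult inner_cutoff_def intro!: mult_left_le_one_le)
      then have "\<bar>inner_cutoff x * ?w x\<bar> powr p \<le> \<bar>?w x\<bar> powr p"
        using p by (intro powr_mono2) auto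
      moreover have "inner_cutoff x = 0 \<or> x \<in> slab" if "x \<in> ?H"
        using that \<delta>_pos by (auto simp: inner_cutoff_def slab_def half_space_def)
      ultimately show "ennreal (\<bar>inner_cutoff x * ?w x\<bar> powr p) * indicator ?H x \<le> ennreal (\<bar>?w x\<bar> powr p) * indicator slab x"
        using p by (auto split: split_indicator intro: ennreal_leI)
    qed
    also have "\<dots> \<le> ennreal (near_const p * M powr p) * Q"
      using cst M \<delta>_pos p by (intro order_trans[OF b] mult_right_mono ennreal_leI mult_left_mono powr_mono2) auto
    finally have "S_pow p \<beta> \<delta> ?H (\<lambda>x. inner_cutoff x * ?w x) \<le> ennreal (near_const p * M powr p) * Q +
        ennreal (2 powr p * (2 powr p * (4 * kernel_bound p + energy_const p)) + 2 * 4 powr p * near_const p) * Q"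
      unfolding S_pow_def by (intro add_mono f)
    also have "\<dots> = ennreal (near_const p * M powr p + (2 powr p * (2 powr p * (4 * kernel_bound p + energy_const p)) + 2 * 4 powr p * near_const p)) * Q"
      using cst by (subst distrib_right[symmetric], subst ennreal_plus[symmetric]) auto
    finally show ?thesis .
  qed
  have "S_pow p \<beta> \<delta> ?H (extend M g) = S_pow p \<beta> \<delta> ?H (\<lambda>x. outer_cutoff M x * ?v x + inner_cutoff x * ?w x)"
    by (simp add: extend_def[abs_def])
  also have "\<dots> \<le> ennreal (2 powr p) * (S_pow p \<beta> \<delta> ?H (\<lambda>x. outer_cutoff M x * ?v x) + S_pow p \<beta> \<delta> ?H (\<lambda>x. inner_cutoff x * ?w x))"
    by (intro S_pow_add_le p) auto
  also have "\<dots> \<le> ennreal (2 powr p) *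
      (ennreal (Lp_const * M + (2 powr p * energy_const p + 2 * (4 * (1 / M)) powr p * (Lp_const * M))) * Q +
       ennreal (near_const p * M powr p + (2 powr p * (2 powr p * (4 * kernel_bound p + energy_const p)) + 2 * 4 powr p * near_const p)) * Q)"
    by (intro mult_left_mono add_mono S1 S2) auto
  also have "\<dots> = ennreal (total_const p M) * Q"
    unfolding total_const_def using cst M0
    by (intro ennreal_mult_add_mult_eq) (auto intro!: add_nonneg_nonneg mult_nonneg_nonneg)
  finally show ?thesis
    unfolding Q_def .
qed

end

subsection \<open>The extension operator on classes\<close>

text \<open>Elements of the T space are only Lebesgue measurable on \<open>V\<close>, while
  composition with the fold and the Fubini arguments use Borel functions on the whole space. The
  choice is made for each function, not each class, so linearity and compatibility with null sets
  hold almost everywhere.\<close>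

definition borel_rep :: "(real ^ 'n) set \<Rightarrow> (real ^ 'n \<Rightarrow> real) \<Rightarrow> real ^ 'n \<Rightarrow> real" where
  "borel_rep V u = (SOME g. g \<in> borel_measurable borel \<and> (\<forall>x. x \<notin> V \<longrightarrow> g x = 0) \<and>
     (AE x in lborel. x \<in> V \<longrightarrow> g x = u x))"

lemma borel_rep:
  assumes V [measurable]: "V \<in> sets borel" and u: "u \<in> borel_measurable (lebesgue_on V)"
  shows "borel_rep V u \<in> borel_measurable borel" "\<And>x. x \<notin> V \<Longrightarrow> borel_rep V u x = 0"
    "AE x in lborel. x \<in> V \<longrightarrow> borel_rep V u x = u x"
proof -
  have "(\<lambda>x. if x \<in> V then u x else 0) \<in> borel_measurable lebesgue"
    using u by (rule borel_measurable_if_I) auto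
  then obtain g' where g': "g' \<in> borel_measurable lborel" "AE x in lborel. (if x \<in> V then u x else 0) = g' x"
    using completion_ex_borel_measurable_real by blast
  have [measurable]: "g' \<in> borel_measurable borel"
    using g'(1) by simp
  have "(\<lambda>x. g' x * indicator V x) \<in> borel_measurable borel"
    by measurable
  moreover have "AE x in lborel. x \<in> V \<longrightarrow> g' x * indicator V x = u x"
    using g'(2) by eventually_elim auto
  ultimately have "\<exists>g. g \<in> borel_measurable borel \<and> (\<forall>x. x \<notin> V \<longrightarrow> g x = 0) \<and> (AE x in lborel. x \<in> V \<longrightarrow> g x = u x)"
    by (intro exI[of _ "\<lambda>x. g' x * indicator V x"]) auto
  from someI_ex[OF this] show "borel_rep V u \<in> borel_measurable borel" "\<And>x. x \<notin> V \<Longrightarrow> borel_rep V u x = 0"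
    "AE x in lborel. x \<in> V \<longrightarrow> borel_rep V u x = u x"
    unfolding borel_rep_def by auto
qed

lemma Lp_pow_cong_AE:
  assumes "AE x in lebesgue_on V. u x = v x"
  shows "Lp_pow p V u = Lp_pow p V v"
  unfolding Lp_pow_def by (rule nn_integral_cong_AE) (use assms in eventually_elim, simp)

lemma T_seminorm_pow_cong_AE:
  assumes "AE x in lebesgue_on V. u x = v x"
  shows "T_seminorm_pow p \<beta> \<delta> V u = T_seminorm_pow p \<beta> \<delta> V v"
  unfolding T_seminorm_pow_def
proof (rule arg_cong[where f = "\<lambda>t. _ * t"], rule nn_integral_cong_AE, use assms in eventually_elim)
  case (elim x)
  show ?case
    by (rule nn_integral_cong_AE, use assms in eventually_elim) (simp add: elim)
qed

context strip_geometry
begin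

text \<open>The average is the same at every point; the delicate term is the composition with
  \<open>fold_point\<close>. Applied to the indicator of the exceptional set,
  \<open>nn_integral_fold_le\<close> shows that its preimage in the slab is null, and above the slab
  \<open>inner_cutoff\<close> vanishes.\<close>

lemma extend_cong_AE:
  assumes [measurable]: "f \<in> borel_measurable borel" "g \<in> borel_measurable borel" and eq: "AE x in lborel. f x = g x"
  shows "AE x in lborel. x \<in> half_space k \<delta> \<longrightarrow> extend M f x = extend M g x"
proof -
  have avg: "ext_avg f x = ext_avg g x" for x
    unfolding ext_avg_def by (rule integral_cong_AE) (use eq in \<open>auto elim: eventually_mono\<close>)
  let ?N = "{x. f x \<noteq> g x}"
  have [measurable]: "?N \<in> sets borel"
    by measurable
  have "AE x in lborel. indicator ?N x * indicator (strip k \<delta>) x = (0::ennreal)"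
    using eq by eventually_elim auto
  then have "(\<integral>\<^sup>+x. indicator ?N x * indicator (strip k \<delta>) x \<partial>lborel) = 0"
    by (subst nn_integral_0_iff_AE) auto
  then have "(\<integral>\<^sup>+x. indicator ?N (fold_point x) * indicator slab x \<partial>lborel) = 0"
    using nn_integral_fold_le[of "indicator ?N"] by simp
  then have "AE x in lborel. indicator ?N (fold_point x) * indicator slab x = (0::ennreal)"
    by (subst (asm) nn_integral_0_iff_AE) auto
  then show ?thesis
  proof eventually_elim
    case (elim x)
    have "inner_cutoff x = 0" if "x \<in> half_space k \<delta>" "x \<notin> slab"
      using that \<delta>_pos by (auto simp: inner_cutoff_def slab_def half_space_def)
    then show ?case
      using elim by (auto simp: extend_def avg split: split_indicator_asm)
  qed
qed

lemma extend_linear: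
  assumes p: "1 < p" and [measurable]: "f \<in> borel_measurable borel" "g \<in> borel_measurable borel"
    and fin: "(\<integral>\<^sup>+a. ennreal (\<bar>f a\<bar> powr p) \<partial>lborel) < top" "(\<integral>\<^sup>+a. ennreal (\<bar>g a\<bar> powr p) \<partial>lborel) < top"
    and x: "x \<in> half_space k \<delta>"
  shows "extend M (\<lambda>z. a * f z + b * g z) x = a * extend M f x + b * extend M g x"
proof -
  have "ext_avg (\<lambda>z. a * f z + b * g z) x = (\<integral>z. a * (avg_kernel x z * f z) + b * (avg_kernel x z * g z) \<partial>lborel)"
    unfolding ext_avg_def by (simp add: algebra_simps)
  also have "\<dots> = a * ext_avg f x + b * ext_avg g x"
    using avg_kernel_mult_integrable[OF p _ fin(1) x] avg_kernel_mult_integrable[OF p _ fin(2) x]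
    unfolding ext_avg_def by simp
  finally show ?thesis
    by (simp add: extend_def algebra_simps)
qed

lemma extend_strip:
  assumes "x \<in> strip k \<delta>" "\<delta> < M"
  shows "extend M g x = g x"
proof -
  have "x $ k < 0" "0 < M"
    using assms \<delta>_pos by (auto simp: strip_def)
  then have "x $ k / M < 0" "x $ k / \<delta> < 0"
    using \<delta>_pos by (auto simp: divide_neg_pos)
  then have "outer_cutoff M x = 1" "inner_cutoff x = 1"
    by (auto simp: outer_cutoff_def inner_cutoff_def)
  then show ?thesis
    using fold_point_strip[OF assms(1)] by (simp add: extend_def)
qed

definition extension :: "real \<Rightarrow> (real ^ 'n \<Rightarrow> real) \<Rightarrow> real ^ 'n \<Rightarrow> real" where
  "extension M u = extend M (borel_rep (strip k \<delta>) u)"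

lemma T_space_borel_rep:
  assumes u: "u \<in> T_space p \<beta> \<delta> (strip k \<delta>)" and p: "1 < p"
  defines "g \<equiv> borel_rep (strip k \<delta>) u"
  shows "g \<in> borel_measurable borel" "\<And>x. x \<notin> strip k \<delta> \<Longrightarrow> g x = 0"
    "AE x in lborel. x \<in> strip k \<delta> \<longrightarrow> g x = u x"
    "T_norm p \<beta> \<delta> (strip k \<delta>) u = ennroot p (T_pow p \<beta> g)" "T_pow p \<beta> g < top"
    "Lp_pow p (strip k \<delta>) g < top" "(\<integral>\<^sup>+x. ennreal (\<bar>g x\<bar> powr p) \<partial>lborel) < top"
proof -
  let ?V = "strip k \<delta>"
  have u_meas: "u \<in> borel_measurable (lebesgue_on ?V)" and fin: "T_norm p \<beta> \<delta> ?V u < top"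
    using u by (auto simp: T_space_def)
  show 1: "g \<in> borel_measurable borel" and 2: "\<And>x. x \<notin> ?V \<Longrightarrow> g x = 0"
    and 3: "AE x in lborel. x \<in> ?V \<longrightarrow> g x = u x"
    unfolding g_def using borel_rep[OF borel_strip u_meas] by auto
  have ae: "AE x in lebesgue_on ?V. u x = g x"
    using 3 by (simp add: AE_lebesgue_on_borel eq_commute)
  show 4: "T_norm p \<beta> \<delta> ?V u = ennroot p (T_pow p \<beta> g)"
    unfolding T_norm_def T_pow_def Lp_pow_cong_AE[OF ae] T_seminorm_pow_cong_AE[OF ae] ..
  then show 5: "T_pow p \<beta> g < top"
    using fin by (simp add: ennroot_less_top_iff)
  then have "ennreal (1 / \<delta>) * Lp_pow p ?V g < top"
    by (simp add: T_pow_def)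
  then show 6: "Lp_pow p ?V g < top"
    using \<delta>_pos by (auto simp: ennreal_mult_less_top)
  have "(\<integral>\<^sup>+x. ennreal (\<bar>g x\<bar> powr p) \<partial>lborel) = Lp_pow p ?V g"
    unfolding Lp_pow_def nn_integral_lebesgue_on_borel[OF borel_strip]
    using 2 p by (intro nn_integral_cong) (auto split: split_indicator)
  then show "(\<integral>\<^sup>+x. ennreal (\<bar>g x\<bar> powr p) \<partial>lborel) < top"
    using 6 by simp
qed

lemma extension_operator_extension:
  assumes p: "1 < p" and \<beta>: "0 \<le> \<beta>" "\<beta> < real CARD('n) + p" and M: "\<delta> < M"
  shows "extension_operator (strip k \<delta>) (T_space p \<beta> \<delta> (strip k \<delta>))
      (half_space k \<delta>) (S_space p \<beta> \<delta> (half_space k \<delta>)) (extension M)"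
    and "u \<in> T_space p \<beta> \<delta> (strip k \<delta>) \<Longrightarrow> S_norm p \<beta> \<delta> (half_space k \<delta>) (extension M u) \<le>
      ennreal (total_const p M powr (1 / p)) * T_norm p \<beta> \<delta> (strip k \<delta>) u"
proof -
  let ?V = "strip k \<delta>" and ?H = "half_space k \<delta>"
  let ?T = "T_space p \<beta> \<delta> ?V" and ?g = "borel_rep (strip k \<delta>)"
  note rep = T_space_borel_rep[OF _ p]
  have K: "0 < total_const p M"
    using total_const_pos[OF p, of M] M \<delta>_pos by simp
  have bound: "S_pow p \<beta> \<delta> ?H (extension M u) \<le> ennreal (total_const p M) * T_pow p \<beta> (?g u)" if "u \<in> ?T" for u
    unfolding extension_def by (rule S_pow_extend_le[OF p \<beta> M rep(1)[OF that] rep(2)[OF that] rep(6)[OF that]])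
  show "S_norm p \<beta> \<delta> ?H (extension M u) \<le> ennreal (total_const p M powr (1 / p)) * T_norm p \<beta> \<delta> ?V u" if "u \<in> ?T"
    unfolding S_norm_eq[OF borel_half_space] rep(4)[OF that] using p K
    by (subst ennroot_cmult[symmetric]) (auto intro!: ennroot_mono bound[OF that])
  have mem: "extension M u \<in> S_space p \<beta> \<delta> ?H" if "u \<in> ?T" for u
  proof (rule mem_S_space[OF p])
    show "extension M u \<in> borel_measurable borel"
      unfolding extension_def using rep(1)[OF that] by measurable
    show "S_pow p \<beta> \<delta> ?H (extension M u) < top"
      by (rule le_less_trans[OF bound[OF that]]) (simp add: ennreal_mult_less_top rep(5)[OF that])
  qed
  have eq: "AE x in lborel. ?g u x = ?g v x" if "u \<in> ?T" "v \<in> ?T" "AE x in lebesgue_on ?V. u x = v x" for u v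
  proof -
    have "AE x in lborel. x \<in> ?V \<longrightarrow> u x = v x"
      using that(3) by (simp add: AE_lebesgue_on_borel)
    then show ?thesis
      using rep(3)[OF that(1)] rep(3)[OF that(2)]
    proof eventually_elim
      case (elim x)
      then show ?case
        using rep(2)[OF that(1), of x] rep(2)[OF that(2), of x] by (cases "x \<in> ?V") auto
    qed
  qed
  have cong: "AE x in lebesgue_on ?H. extension M u x = extension M v x"
    if "u \<in> ?T" "v \<in> ?T" "AE x in lebesgue_on ?V. u x = v x" for u v
    unfolding AE_lebesgue_on_borel[OF borel_half_space] extension_def
    by (rule extend_cong_AE[OF rep(1)[OF that(1)] rep(1)[OF that(2)] eq[OF that]])
  have lin: "AE x in lebesgue_on ?H. extension M (\<lambda>z. a * u z + b * v z) x = a * extension M u x + b * extension M v x"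
    if u: "u \<in> ?T" and v: "v \<in> ?T" for u v a b
  proof -
    let ?w = "\<lambda>z. a * u z + b * v z" and ?h = "\<lambda>z. a * ?g u z + b * ?g v z"
    have w: "?w \<in> borel_measurable (lebesgue_on ?V)"
      using u v by (auto simp: T_space_def)
    have [measurable]: "?g u \<in> borel_measurable borel" "?g v \<in> borel_measurable borel"
      by (rule rep(1)[OF u], rule rep(1)[OF v])
    \<comment> \<open>The representative of a combination and the combination of representatives are
      different choices; they agree almost everywhere on the strip and both vanish off it.\<close>
    have "AE x in lborel. ?g ?w x = ?h x"
      using borel_rep(3)[OF borel_strip w] rep(3)[OF u] rep(3)[OF v]
    proof eventually_elim
      case (elim x)
      then show ?case
        using rep(2)[OF u, of x] rep(2)[OF v, of x] borel_rep(2)[OF borel_strip w, of x] by (cases "x \<in> ?V") auto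
    qed
    then have "AE x in lborel. x \<in> ?H \<longrightarrow> extend M (?g ?w) x = extend M ?h x"
      by (intro extend_cong_AE borel_rep(1)[OF borel_strip w]) auto
    then show ?thesis
      unfolding AE_lebesgue_on_borel[OF borel_half_space] extension_def
    proof eventually_elim
      case (elim x)
      then show ?case
        using extend_linear[OF p rep(1)[OF u] rep(1)[OF v] rep(7)[OF u] rep(7)[OF v], of x M a b] by simp
    qed
  qed
  have id: "AE x in lebesgue_on ?V. extension M u x = u x" if "u \<in> ?T" for u
    unfolding AE_lebesgue_on_borel[OF borel_strip] extension_def
    using rep(3)[OF that] by eventually_elim (simp add: extend_strip M)
  show "extension_operator ?V ?T ?H (S_space p \<beta> \<delta> ?H) (extension M)"
    unfolding extension_operator_def using mem cong lin id by blast
qed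

end

text \<open>The construction is bounded uniformly in \<open>\<beta>\<close>; the factor
  \<open>\<bar>real CARD('n) - \<beta>\<bar> powr (- (1 / p))\<close> only has to be bounded from below.\<close>

theorem theorem1p2:
  fixes p M :: real and k :: "'n::finite"
  assumes "1 < p" and "0 < M"
  shows "\<exists>C>0. \<forall>\<delta> \<beta> :: real.
    0 < \<delta> \<and> \<delta> < M \<and> 0 \<le> \<beta> \<and> \<beta> < real CARD('n) + p \<and> \<beta> \<noteq> real CARD('n) \<longrightarrow>
    (\<exists>E. extension_operator (strip k \<delta>) (T_space p \<beta> \<delta> (strip k \<delta>))
            (half_space k \<delta>) (S_space p \<beta> \<delta> (half_space k \<delta>)) E \<and>
         (\<forall>u \<in> T_space p \<beta> \<delta> (strip k \<delta>).
            S_norm p \<beta> \<delta> (half_space k \<delta>) (E u)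
              \<le> ennreal (C * \<bar>real CARD('n) - \<beta>\<bar> powr (- (1 / p))) * T_norm p \<beta> \<delta> (strip k \<delta>) u))"
proof -
  let ?d = "real CARD('n)"
  \<comment> \<open>Outside the locale the constant carries only the index type, so it is fixed
    before \<delta> and \<beta>.\<close>
  define K where "K = strip_geometry.total_const TYPE('n) p M"
  \<comment> \<open>The second factor compensates the smallest value of the power of \<bar>?d -
    \<beta>\<bar>, which is at most \<open>?d + p\<close> for the admissible \<beta>.\<close>
  define C where "C = K powr (1 / p) * (?d + p) powr (1 / p)"
  have K: "0 < K"
    \<comment> \<open>Any positive width instantiates the locale; 1 is an arbitrary choice, since
      \<open>K\<close> does not mention it.\<close>
    unfolding K_def using assms by (intro strip_geometry.total_const_pos[of 1]) (auto simp: strip_geometry_def)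
  show ?thesis
  proof (intro exI[of _ C] conjI allI impI)
    show "0 < C"
      using K assms by (simp add: C_def add_nonneg_pos)
    fix \<delta> \<beta> :: real
    assume "0 < \<delta> \<and> \<delta> < M \<and> 0 \<le> \<beta> \<and> \<beta> < ?d + p \<and> \<beta> \<noteq> ?d"
    then have \<delta>: "0 < \<delta>" "\<delta> < M" and \<beta>: "0 \<le> \<beta>" "\<beta> < ?d + p" "\<beta> \<noteq> ?d"
      by auto
    interpret strip_geometry k \<delta>
      by unfold_locales (rule \<delta>)
    have "K powr (1 / p) * 1 \<le> K powr (1 / p) * ((?d + p) powr (1 / p) * \<bar>?d - \<beta>\<bar> powr (- (1 / p)))"
    proof (rule mult_left_mono)
      have "(?d + p) powr (- (1 / p)) \<le> \<bar>?d - \<beta>\<bar> powr (- (1 / p))"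
        using \<beta> assms by (intro powr_mono2') auto
      then have "(?d + p) powr (1 / p) * (?d + p) powr (- (1 / p)) \<le> (?d + p) powr (1 / p) * \<bar>?d - \<beta>\<bar> powr (- (1 / p))"
        by (rule mult_left_mono) simp
      moreover have "(?d + p) powr (1 / p) * (?d + p) powr (- (1 / p)) = 1"
        using assms by (simp add: powr_add[symmetric])
      ultimately show "1 \<le> (?d + p) powr (1 / p) * \<bar>?d - \<beta>\<bar> powr (- (1 / p))"
        by simp
    qed simp
    then have le: "ennreal (total_const p M powr (1 / p)) \<le> ennreal (C * \<bar>?d - \<beta>\<bar> powr (- (1 / p)))"
      unfolding C_def K_def by (intro ennreal_leI) (simp add: mult.assoc)
    show "\<exists>E. extension_operator (strip k \<delta>) (T_space p \<beta> \<delta> (strip k \<delta>))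
            (half_space k \<delta>) (S_space p \<beta> \<delta> (half_space k \<delta>)) E \<and>
         (\<forall>u \<in> T_space p \<beta> \<delta> (strip k \<delta>).
            S_norm p \<beta> \<delta> (half_space k \<delta>) (E u)
              \<le> ennreal (C * \<bar>?d - \<beta>\<bar> powr (- (1 / p))) * T_norm p \<beta> \<delta> (strip k \<delta>) u)"
    proof (intro exI[of _ "extension M"] conjI ballI)
      show "extension_operator (strip k \<delta>) (T_space p \<beta> \<delta> (strip k \<delta>))
          (half_space k \<delta>) (S_space p \<beta> \<delta> (half_space k \<delta>)) (extension M)"
        by (rule extension_operator_extension(1)[OF assms(1) \<beta>(1,2) \<delta>(2)])
      fix u assume "u \<in> T_space p \<beta> \<delta> (strip k \<delta>)"
      then have "S_norm p \<beta> \<delta> (half_space k \<delta>) (extension M u) \<le>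
          ennreal (total_const p M powr (1 / p)) * T_norm p \<beta> \<delta> (strip k \<delta>) u"
        by (rule extension_operator_extension(2)[OF assms(1) \<beta>(1,2) \<delta>(2)])
      also have "\<dots> \<le> ennreal (C * \<bar>?d - \<beta>\<bar> powr (- (1 / p))) * T_norm p \<beta> \<delta> (strip k \<delta>) u"
        using le by (rule mult_right_mono) simp
      finally show "S_norm p \<beta> \<delta> (half_space k \<delta>) (extension M u) \<le>
          ennreal (C * \<bar>?d - \<beta>\<bar> powr (- (1 / p))) * T_norm p \<beta> \<delta> (strip k \<delta>) u" .
    qed
  qed
qed

end
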